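(* Let $3\le p<5$ and let $\alpha=\tfrac12$. Let $\phi_0\in C^3(\mathbb{R}^3)$ and $\phi_1\in C^2(\mathbb{R}^3)$ be real-valued functions whose supports are contained in the open ball $B_\alpha(0)\subset\mathbb{R}^3$. Let $\phi\in C^2([1,\infty)\times\mathbb{R}^3)$ be a real-valued classical solution, existing globally towards the future, of $$\Box\phi+\phi|\phi|^{p-1}=0\quad\text{on }[1,\infty)\times\mathbb{R}^3,\qquad (\phi,\partial_t\phi)|_{t=1}=(\phi_0,\phi_1).$$ Then there is a constant $C>0$ such that $$|\phi(t,x)|\le\frac{C}{(1+t+|x|)\,(1+|t-|x||)^{p-2}}\qquad\text{for all }t\ge1\text{ and }x\in\mathbb{R}^3.$$
   Context: $\Box:=\partial_t^2-\Delta$ is the wave operator on $\mathbb{R}\times\mathbb{R}^3$ (with $\Delta$ the Laplacian in $x\in\mathbb{R}^3$), and $|x|$ is the Euclidean norm. $B_\rho(x)$ denotes the open ball of radius $\rho$ about $x$ in $\mathbb{R}^3$. The initial data are not assumed to be small or spherically symmetric. The constant $C$ may depend on the solution (on the initial data) and on $p$, but not on $(t,x)$. *)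

theory Defs
  imports "HOL-Analysis.Analysis"
begin

(* Derivatives are taken within S. This determines them uniquely when S is open, and also when
   S is a closed half-space such as {1..} \<times> UNIV, where they are one-sided at the boundary
   in the direction of its normal. *)
definition partial_within ::
  "'a::euclidean_space set \<Rightarrow> 'a \<Rightarrow> ('a \<Rightarrow> real) \<Rightarrow> 'a \<Rightarrow> real" where
  "partial_within S b f z = frechet_derivative f (at z within S) b"

(* The class C^k. On a closed half-space this is the usual notion: the derivatives up to order k
   exist and are continuous up to and including the boundary. *)
fun C_k_on :: "nat \<Rightarrow> 'a::euclidean_space set \<Rightarrow> ('a \<Rightarrow> real) \<Rightarrow> bool" where
  "C_k_on 0 S f \<longleftrightarrow> continuous_on S f"
| "C_k_on (Suc k) S f \<longleftrightarrow>
     f differentiable_on S \<and> (\<forall>b\<in>Basis. C_k_on k S (partial_within S b f))"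

abbreviation future :: "(real \<times> (real^3)) set" where
  "future \<equiv> {1..} \<times> UNIV"

definition dt :: "(real \<times> (real^3) \<Rightarrow> real) \<Rightarrow> real \<times> (real^3) \<Rightarrow> real" where
  "dt = partial_within future (1, 0)"

definition dx :: "3 \<Rightarrow> (real \<times> (real^3) \<Rightarrow> real) \<Rightarrow> real \<times> (real^3) \<Rightarrow> real" where
  "dx i = partial_within future (0, axis i 1)"

definition wave_op :: "(real \<times> (real^3) \<Rightarrow> real) \<Rightarrow> real \<times> (real^3) \<Rightarrow> real" where
  "wave_op f z = dt (dt f) z - (\<Sum>i\<in>UNIV. dx i (dx i f) z)"

lemma partial_within_open_eqI:
  assumes "(f has_derivative f') (at z within S)" "open S" "z \<in> S"
  shows "partial_within S b f z = f' b"
proof -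
  have at: "at z within S = at z"
    using assms(2,3) by (rule at_within_open[rotated])
  have "f' = frechet_derivative f (at z)"
    using assms(1) unfolding at by (rule frechet_derivative_at)
  then show ?thesis
    unfolding partial_within_def at by simp
qed

lemma partial_within_future_eqI:
  assumes f': "(f has_derivative f') (at z within future)" and z: "z \<in> future"
  shows "partial_within future b f z = f' b"
proof -
  have "f differentiable (at z within future)"
    using f' by (rule differentiableI)
  then have g: "(f has_derivative frechet_derivative f (at z within future)) (at z within future)"
    by (rule frechet_derivative_works[THEN iffD1])
  have "frechet_derivative f (at z within future) = f'"
  proof (rule frechet_derivative_unique_within[OF g f'])
    fix i :: "real \<times> (real^3)" and e :: real
    assume i: "i \<in> Basis" and e: "e > 0"
    have "fst i \<ge> 0"
      using i by (auto simp only: Basis_prod_def fst_conv Basis_real_def)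
    then have "0 \<le> e/2 * fst i"
      using e by (intro mult_nonneg_nonneg) auto
    then have "z + (e/2) *\<^sub>R i \<in> future"
      using z by (simp add: mem_Times_iff)
    moreover have "0 < \<bar>e/2\<bar>" "\<bar>e/2\<bar> < e"
      using e by simp_all
    ultimately show "\<exists>d. 0 < \<bar>d\<bar> \<and> \<bar>d\<bar> < e \<and> z + d *\<^sub>R i \<in> future"
      by (intro exI[of _ "e/2"] conjI)
  qed
  then show ?thesis
    unfolding partial_within_def by (rule fun_cong)
qed

end

theory Submission
  imports Defs
begin

text \<open>
  Conformal inversion turns \<open>\<phi>\<close> into \<open>\<Phi> = (t\<^sup>2 - \<bar>x\<bar>\<^sup>2) \<phi>\<close>, which solves a defocusing wave equation on a bounded
  region with the weight \<open>(t\<^sup>2 - \<bar>x\<bar>\<^sup>2) powr (3 - p)\<close> in front of the nonlinearity. Since \<open>p \<ge> 3\<close>, the energy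
  associated with the conformal Killing field \<open>(t\<^sup>2 + \<bar>x\<bar>\<^sup>2) \<partial>\<^sub>t + 2 t x \<cdot> \<partial>\<^sub>x\<close> does not increase, so its flux
  through every backward null cone is bounded. In the retarded integral representation of \<open>\<Phi>\<close> the part
  near the vertex of the cone is controlled by this flux times \<open>sup \<bar>\<Phi>\<bar>\<close>, with a small factor because
  \<open>p < 5\<close>; hence \<open>\<Phi>\<close> is bounded. On the backward cone of \<open>(t, x)\<close> one has \<open>s + \<bar>y\<bar> \<ge> t - \<bar>x\<bar>\<close>, so the weight
  is at most a multiple of \<open>(t - \<bar>x\<bar>) powr (3 - p)\<close>; inserting the boundedness of \<open>\<Phi>\<close> once more into the
  representation gives the stated decay.

  All computations are carried out in the original coordinates: only the weights are those of the
  inversion. A cutoff in time removes the data from the representation formula.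
\<close>

subsection \<open>Integrals over Euclidean space\<close>

text \<open>The radius 1/2 of the data keeps all weights finite: by finite speed \<phi> vanishes for
  |x| >= t - 1/2, so on its support t^2 - |x|^2 >= (t + |x|)/2, and inverted times stay below 2. The
  obstacle is that \<Phi> may be large, so bounding \<Phi>^p by M \<Phi>^(p-1) is circular unless
  the factor of M is small. Young's inequality splits \<Phi>^(p-1)/r into \<kappa> \<Phi>^(p+1),
  which the flux integrates, and a multiple of r^(-(p+1)/2), whose integral over a small ball is
  small because (p+1)/2 < 3. The constants do not depend on the vertex, so the estimate can be
  applied where \<Phi> attains its maximum over a truncated solid cone; compactness makes that
  maximum finite in advance. A second obstacle is regularity: \<phi> is only C^2, one-sided at t =
  1, and null cones are singular at the vertex. Hence all surfaces are C^1 graphs over R^3, the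
  divergence theorem is differentiation under the integral sign, and cones appear only as limits.
  The final exponent comes from t^2 - |x|^2 = (t + |x|)(t - |x|), whose second factor lowers 3 - p
  to 2 - p.\<close>

lemma lebesgue_integral_eq_integral_cbox:
  fixes f :: "'a::euclidean_space \<Rightarrow> real"
  assumes "continuous_on UNIV f" and "\<And>y. y \<notin> cbox a b \<Longrightarrow> f y = 0"
  shows "integrable lborel f" and "integral\<^sup>L lborel f = integral (cbox a b) f"
proof -
  have eq: "f = (\<lambda>y. indicator (cbox a b) y *\<^sub>R f y)"
    using assms(2) by (auto simp: fun_eq_iff indicator_def)
  have "set_integrable lborel (cbox a b) f"
    unfolding set_integrable_def
    by (rule borel_integrable_compact) (use assms(1) in \<open>auto intro: continuous_on_subset\<close>)
  then show i: "integrable lborel f"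
    unfolding set_integrable_def using eq by simp
  have "set_lebesgue_integral lborel (cbox a b) f = integral (cbox a b) f"
    by (rule set_borel_integral_eq_integral) fact
  then show "integral\<^sup>L lborel f = integral (cbox a b) f"
    unfolding set_lebesgue_integral_def using eq by simp
qed

lemma cball_subset_cbox_One:
  "cball (0::'a::euclidean_space) r \<subseteq> cbox (- r *\<^sub>R One) (r *\<^sub>R One)"
proof
  fix y :: 'a assume "y \<in> cball 0 r"
  then have "norm y \<le> r" by simp
  then have "\<bar>y \<bullet> i\<bar> \<le> r" if "i \<in> Basis" for i
    using Basis_le_norm[OF that, of y] by linarith
  then show "y \<in> cbox (- r *\<^sub>R One) (r *\<^sub>R One)"
    by (fastforce simp: mem_box abs_le_iff)
qed

text \<open>Translation invariance: the integral of \<open>f (y + s *\<^sub>R b)\<close> does not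
  depend on s, and the Leibniz rule identifies its derivative at 0 with the integral of
  \<open>f'\<close>. This serves as the divergence theorem, one direction at a time. The Leibniz
  rule works with integrals over boxes, hence the passage between the two integrals.\<close>

lemma integral_directional_derivative_eq_0:
  fixes f f' :: "'a::euclidean_space \<Rightarrow> real"
  assumes der: "\<And>y. ((\<lambda>s. f (y + s *\<^sub>R b)) has_real_derivative f' y) (at 0)"
    and cont: "continuous_on UNIV f" "continuous_on UNIV f'"
    and supp: "\<And>y. norm y > R \<Longrightarrow> f y = 0"
  shows "integrable lborel f'" "integral\<^sup>L lborel f' = 0" "\<And>y. norm y > R \<Longrightarrow> f' y = 0"
proof -
  \<comment> \<open>Enlarging R by \<open>norm b\<close> keeps all translates with |s| <= 1
    supported in the fixed box \<open>B\<close>.\<close>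
  define r where "r = \<bar>R\<bar> + norm b"
  define B where "B = cbox (- r *\<^sub>R One) (r *\<^sub>R One::'a)"
  have B: "norm y > r" if "y \<notin> B" for y
    using cball_subset_cbox_One[of r] that unfolding B_def by (force simp: not_le)
  show f'0': "f' y = 0" if yR: "norm y > R" for y
  proof -
    have "((\<lambda>s. 0) has_real_derivative f' y) (at 0)"
    proof (rule has_field_derivative_transform_within_open[OF der])
      show "open {s::real. R < norm (y + s *\<^sub>R b)}"
        by (intro open_Collect_less continuous_intros)
    qed (use yR supp in auto)
    then show ?thesis by (metis DERIV_const DERIV_unique)
  qed
  have f'0: "f' y = 0" if "norm y > r" for y
    by (rule f'0') (use that norm_ge_zero[of b] in \<open>unfold r_def, linarith\<close>)
  have i': "integral\<^sup>L lborel f' = integral B f'" and int': "integrable lborel f'"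
    unfolding B_def using cont f'0 B lebesgue_integral_eq_integral_cbox[of f' "- r *\<^sub>R One" "r *\<^sub>R One"]
    by (auto simp: B_def)
  show "integrable lborel f'" by (rule int')
  have der': "((\<lambda>s. f (y + s *\<^sub>R b)) has_real_derivative f' (y + t *\<^sub>R b)) (at t)" for y t
  proof -
    have "((\<lambda>s. f ((y + t *\<^sub>R b) + s *\<^sub>R b)) has_real_derivative f' (y + t *\<^sub>R b)) (at (0::real))"
      by (rule der)
    then show ?thesis
      using DERIV_shift[of "\<lambda>s. f (y + s *\<^sub>R b)" "f' (y + t *\<^sub>R b)" 0 t] by (simp add: algebra_simps)
  qed
  define F where "F = (\<lambda>s. integral B (\<lambda>y. f (y + s *\<^sub>R b)))"
  have F: "F s = integral\<^sup>L lborel f" if s: "s \<in> {-1..1}" for s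
  proof -
    have "f (y + s *\<^sub>R b) = 0" if y: "y \<notin> B" for y
    proof (rule supp)
      have "norm y \<le> norm (y + s *\<^sub>R b) + norm (s *\<^sub>R b)"
        by (metis add_diff_cancel_right' norm_triangle_ineq4)
      moreover have "norm (s *\<^sub>R b) \<le> 1 * norm b"
        unfolding norm_scaleR by (rule mult_right_mono) (use s in auto)
      ultimately show "norm (y + s *\<^sub>R b) > R" using B[OF y] unfolding r_def by simp
    qed
    then have "F s = (\<integral>y. f (y + s *\<^sub>R b) \<partial>lborel)"
      unfolding F_def B_def
      by (intro lebesgue_integral_eq_integral_cbox(2)[symmetric] continuous_on_compose2[OF cont(1)] continuous_intros)
        (auto simp: B_def)
    also have "\<dots> = integral\<^sup>L lborel f"
    proof -
      have "(\<integral>y. f (y + s *\<^sub>R b) \<partial>lborel) = (\<integral>y. f (s *\<^sub>R b + y) \<partial>lborel)"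
        by (subst add.commute) (rule refl)
      also have "\<dots> = integral\<^sup>L (distr lborel borel ((+) (s *\<^sub>R b))) f"
        by (rule integral_distr[symmetric]) (simp_all add: borel_measurable_continuous_onI[OF cont(1)])
      finally show ?thesis unfolding lborel_distr_plus .
    qed
    finally show ?thesis .
  qed
  have "(F has_field_derivative integral B (\<lambda>y. f' (y + 0 *\<^sub>R b))) (at 0 within {-1<..<1})"
    unfolding F_def B_def
  proof (rule leibniz_rule_field_derivative)
    show "continuous_on ({- 1<..<1} \<times> cbox (- r *\<^sub>R One) (r *\<^sub>R One)) (\<lambda>(x, t). f' (t + x *\<^sub>R b))"
      unfolding case_prod_beta by (intro continuous_on_compose2[OF cont(2)] continuous_intros) auto
    show "(\<lambda>y. f (y + x *\<^sub>R b)) integrable_on cbox (- r *\<^sub>R One) (r *\<^sub>R One)" for x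
      by (intro integrable_continuous continuous_on_compose2[OF cont(1)] continuous_intros) auto
  qed (auto intro: has_field_derivative_at_within der')
  then have "(F has_field_derivative integral B f') (at 0)"
    by (simp add: at_within_open[of 0 "{-1<..<1::real}"])
  moreover have "(F has_field_derivative 0) (at 0)"
    by (rule has_field_derivative_transform_within_open[where S="{-1<..<1}" and f="\<lambda>_. integral\<^sup>L lborel f"])
      (auto simp: F)
  ultimately have "integral B f' = 0" by (rule DERIV_unique)
  then show "integral\<^sup>L lborel f' = 0" using i' by simp
qed

text \<open>\<open>f\<close> is dominated by the sum over all n of \<open>c n\<close> times the
  indicator of the n-th ball. The balls may overlap, since at each point a single term already
  suffices.\<close>

lemma nn_integral_le_suminf_balls:
  fixes f :: "'a::euclidean_space \<Rightarrow> ennreal" and c R :: "nat \<Rightarrow> real"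
  assumes f: "\<And>y. f y \<noteq> 0 \<Longrightarrow> \<exists>n. norm y < R n \<and> f y \<le> c n"
    and nonneg: "\<And>n. 0 \<le> c n" "\<And>n. 0 \<le> R n"
    and summ: "summable (\<lambda>n. c n * R n ^ DIM('a))"
  shows "(\<integral>\<^sup>+y. f y \<partial>lborel) < \<infinity>"
proof -
  let ?V = "unit_ball_vol (DIM('a))"
  have V: "0 \<le> ?V" by simp
  have "(\<integral>\<^sup>+y. f y \<partial>lborel) \<le> (\<integral>\<^sup>+y. (\<Sum>n. ennreal (c n) * indicator (ball (0::'a) (R n)) y) \<partial>lborel)"
  proof (rule nn_integral_mono)
    fix y :: 'a
    show "f y \<le> (\<Sum>n. ennreal (c n) * indicator (ball 0 (R n)) y)"
    proof (cases "f y = 0")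
      case False
      then obtain n where n: "norm y < R n" "f y \<le> c n" using f by blast
      let ?g = "\<lambda>n. ennreal (c n) * indicator (ball 0 (R n)) y"
      have "f y \<le> sum ?g {n}" using n by simp
      also have "\<dots> \<le> suminf ?g" by (rule sum_le_suminf) auto
      finally show ?thesis .
    qed simp
  qed
  also have "\<dots> = (\<Sum>n. ennreal (c n) * emeasure lborel (ball (0::'a) (R n)))"
    by (subst nn_integral_suminf) (auto simp: nn_integral_cmult_indicator intro!: borel_measurable_times_ennreal borel_measurable_indicator)
  also have "\<dots> = (\<Sum>n. ennreal (?V * (c n * R n ^ DIM('a))))"
    by (simp add: emeasure_ball nonneg ennreal_mult'[symmetric] mult_ac)
  also have "\<dots> = ennreal (\<Sum>n. ?V * (c n * R n ^ DIM('a)))"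
    by (rule suminf_ennreal2) (auto simp: nonneg summ intro!: summable_mult)
  finally show ?thesis by (simp add: le_less_trans)
qed

text \<open>The dyadic shells r/2^(n+1) <= |y| < r/2^n give a geometric series of ratio 2^(k - DIM),
  convergent because k is below the dimension.\<close>

lemma nn_integral_norm_powr_ball:
  fixes k r :: real
  assumes k: "0 \<le> k" "k < DIM('a::euclidean_space)" 
  shows "(\<integral>\<^sup>+y. ennreal (norm (y::'a) powr - k) * indicator (ball 0 r) y \<partial>lborel) < \<infinity>"
proof (cases "r > 0")
  case r: True
  show ?thesis
  proof (rule nn_integral_le_suminf_balls[where R="\<lambda>n. r / 2 ^ n" and c="\<lambda>n. (r / 2 ^ Suc n) powr -k"])
    fix y :: 'a
    assume "ennreal (norm y powr - k) * indicator (ball 0 r) y \<noteq> 0"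
    \<comment> \<open>The origin drops out because \<open>0 powr a = 0\<close>.\<close>
    then have y: "norm y > 0" "norm y < r"
      by (auto simp: indicator_def split: if_splits)
    obtain n where "(1/2) ^ n < norm y / r"
      using real_arch_pow_inv[of "norm y / r" "1/2"] divide_pos_pos[OF y(1) r] by auto
    then have "r / 2 ^ n \<le> norm y"
      using r y by (simp add: field_simps)
    moreover have "r / 2 ^ Suc n \<le> r / 2 ^ n"
      using r by (simp add: field_simps)
    ultimately have "r / 2 ^ Suc n \<le> norm y" by linarith
    define n where "n = (LEAST n. r / 2 ^ Suc n \<le> norm y)"
    have n: "r / 2 ^ Suc n \<le> norm y" unfolding n_def by (rule LeastI) fact
    have n': "norm y < r / 2 ^ n"
    proof (cases n)
      case (Suc m)
      then have "\<not> (r / 2 ^ Suc m \<le> norm y)"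
        using not_less_Least[of m "\<lambda>n. r / 2 ^ Suc n \<le> norm y"] unfolding n_def by simp
      then show ?thesis using Suc by simp
    qed (use y in simp)
    have "norm y powr - k \<le> (r / 2 ^ Suc n) powr -k"
      by (rule powr_mono2') (use k n r in auto)
    then show "\<exists>n. norm y < r / 2 ^ n \<and> ennreal (norm y powr - k) * indicator (ball 0 r) y \<le> ennreal ((r / 2 ^ Suc n) powr - k)"
      using n' y by (intro exI[of _ n]) (auto simp: ennreal_leI)
  next
    have "(r / 2 ^ Suc n) powr - k * (r / 2 ^ n) ^ DIM('a)
      = ((r / 2) powr - k * r ^ DIM('a)) * (2 powr (k - DIM('a))) ^ n" for n
    proof -
      have "(r / 2 ^ Suc n) powr - k = (r / 2) powr - k * (2 powr k) ^ n"
        using r by (simp add: powr_divide powr_minus powr_mult field_simps powr_power powr_realpow[symmetric] powr_powr)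
      moreover have "(2 powr (k - DIM('a))) ^ n = (2 powr k) ^ n / (2 ^ n) ^ DIM('a)"
        by (simp add: powr_diff power_divide powr_realpow power_mult[symmetric] mult.commute)
      ultimately show ?thesis by (simp add: power_divide)
    qed
    moreover have "2 powr (k - DIM('a)) < 1"
      using k by (simp add: powr_less_one)
    ultimately show "summable (\<lambda>n. (r / 2 ^ Suc n) powr - k * (r / 2 ^ n) ^ DIM('a))"
      by (simp add: summable_mult summable_geometric)
  qed (use r in auto)
next
  case False
  then have e: "ball (0::'a) r = {}" by (simp add: ball_empty)
  show ?thesis unfolding e by simp
qed

text \<open>Dyadic balls growing outward, with ratio 2^(DIM - k). The factor 2^k in the coefficients
  pays for having |y| >= 2^(n-1) rather than 2^n, and it also covers n = 0.\<close>

lemma nn_integral_one_plus_norm_powr: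
  fixes k :: real
  assumes k: "k > DIM('a::euclidean_space)"
  shows "(\<integral>\<^sup>+y. ennreal ((1 + (norm (y::'a))\<^sup>2) powr (- k / 2)) \<partial>lborel) < \<infinity>"
proof (rule nn_integral_le_suminf_balls[where R="\<lambda>n. 2 ^ n" and c="\<lambda>n. 2 powr k * (2 ^ n) powr -k"])
  fix y :: 'a
  have k0: "k > 0" using k by (rule le_less_trans[rotated]) simp
  define n where "n = (LEAST n. norm y < 2 ^ n)"
  obtain n0 where "norm y < 2 ^ n0" using real_arch_pow[of 2 "norm y"] by auto
  then have n: "norm y < 2 ^ n" unfolding n_def by (rule LeastI)
  have "(1 + (norm y)\<^sup>2) powr (- k / 2) \<le> 2 powr k * (2 ^ n) powr -k"
  proof (cases n)
    case 0
    have "(1 + (norm y)\<^sup>2) powr (- k / 2) \<le> 1"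
      using powr_mono2'[of "- k/2" 1 "1 + (norm y)\<^sup>2"] k0 by simp
    also have "\<dots> \<le> 2 powr k" using k0 by (simp add: ge_one_powr_ge_zero)
    finally show ?thesis using 0 by simp
  next
    case (Suc m)
    then have "\<not> norm y < 2 ^ m"
      using not_less_Least[of m "\<lambda>n. norm y < 2 ^ n"] unfolding n_def by simp
    then have m: "2 ^ m \<le> norm y" by simp
    have "(1 + (norm y)\<^sup>2) powr (- k / 2) \<le> ((2 ^ m)\<^sup>2) powr (- k / 2)"
      using powr_mono2'[of "-k/2" "(2 ^ m)\<^sup>2" "1 + (norm y)\<^sup>2"] k0 m
      by (simp add: add_increasing power_mono)
    also have "\<dots> = (2 ^ m) powr - k"
      by (simp add: powr_realpow[symmetric] powr_powr del: powr_realpow)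
    also have "\<dots> = 2 powr k * (2 ^ n) powr -k"
      using Suc by (simp add: powr_mult powr_minus)
    finally show ?thesis .
  qed
  then show "\<exists>n. norm y < 2 ^ n \<and> ennreal ((1 + (norm y)\<^sup>2) powr (- k / 2)) \<le> ennreal (2 powr k * (2 ^ n) powr - k)"
    using n by (intro exI[of _ n]) (auto simp: ennreal_leI)
next
  have "2 powr k * (2 ^ n) powr - k * (2 ^ n) ^ DIM('a) = 2 powr k * (2 powr (DIM('a) - k)) ^ n" for n :: nat
    by (simp add: powr_diff power_divide powr_minus powr_realpow power_mult[symmetric] mult.commute
      powr_power powr_powr field_simps flip: powr_realpow)
  moreover have "2 powr (DIM('a) - k) < 1"
    using k by (simp add: powr_less_one)
  ultimately show "summable (\<lambda>n. 2 powr k * (2 ^ n) powr - k * (2 ^ n) ^ DIM('a))"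
    by (simp only: summable_mult summable_geometric real_norm_def abs_of_nonneg powr_ge_zero)
qed auto

subsection \<open>Kirchhoff's formula\<close>

text \<open>The derivative is split into time component and spatial gradient, the form in which
  currents and divergences are computed. The filter is kept general because points of the initial
  slice only have derivatives within \<open>future\<close>.\<close>

definition has_gradient :: "(real \<times> 'a::real_inner \<Rightarrow> real) \<Rightarrow> real \<Rightarrow> 'a \<Rightarrow> (real \<times> 'a) filter \<Rightarrow> bool" where
  "has_gradient f a b F \<longleftrightarrow> (f has_derivative (\<lambda>h. a * fst h + b \<bullet> snd h)) F"

lemma has_gradient_along_curve:
  assumes f: "has_gradient f a b (at (\<tau> s, \<xi> s) within S)"
    and \<tau>: "(\<tau> has_real_derivative \<tau>') (at s within T)"
    and \<xi>: "(\<xi> has_vector_derivative \<xi>') (at s within T)"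
    and S: "\<And>s. s \<in> T \<Longrightarrow> (\<tau> s, \<xi> s) \<in> S"
  shows "((\<lambda>s. f (\<tau> s, \<xi> s)) has_real_derivative (a * \<tau>' + b \<bullet> \<xi>')) (at s within T)"
proof -
  have "((\<lambda>s. (\<tau> s, \<xi> s)) has_derivative (\<lambda>h. (\<tau>' * h, h *\<^sub>R \<xi>'))) (at s within T)"
    using \<tau> \<xi> unfolding has_field_derivative_def has_vector_derivative_def
    by (rule has_derivative_Pair)
  moreover have "(f has_derivative (\<lambda>h. a * fst h + b \<bullet> snd h)) (at (\<tau> s, \<xi> s) within (\<lambda>s. (\<tau> s, \<xi> s)) ` T)"
    using f S unfolding has_gradient_def by (auto intro: has_derivative_subset)
  ultimately have "((\<lambda>s. f (\<tau> s, \<xi> s)) has_derivative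
      (\<lambda>h. a * fst (\<tau>' * h, h *\<^sub>R \<xi>') + b \<bullet> snd (\<tau>' * h, h *\<^sub>R \<xi>'))) (at s within T)"
    by (rule has_derivative_in_compose)
  moreover have "(\<lambda>h. a * fst (\<tau>' * h, h *\<^sub>R \<xi>') + b \<bullet> snd (\<tau>' * h, h *\<^sub>R \<xi>')) = (*) (a * \<tau>' + b \<bullet> \<xi>')"
    by (simp add: fun_eq_iff algebra_simps)
  ultimately show ?thesis
    unfolding has_field_derivative_def by simp
qed

lemma integral_lborel_scale:
  fixes f :: "'a::euclidean_space \<Rightarrow> real"
  assumes c: "c > 0" and f: "f \<in> borel_measurable borel"
  shows "integral\<^sup>L lborel f = c ^ DIM('a) * (\<integral>z. f (c *\<^sub>R z) \<partial>lborel)"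
proof -
  have "integral\<^sup>L lborel f
      = integral\<^sup>L (density (distr lborel borel (\<lambda>x. 0 + c *\<^sub>R x)) (\<lambda>_. ennreal (\<bar>c\<bar> ^ DIM('a)))) f"
    using c by (subst lborel_affine[of c 0]) auto
  also have "\<dots> = c ^ DIM('a) * (\<integral>z. f (c *\<^sub>R z) \<partial>lborel)"
    using c f by (subst integral_density) (auto simp: integral_distr)
  finally show ?thesis .
qed

lemma borel_measurable_norm_powr [measurable]:
  "(\<lambda>y::'a::euclidean_space. norm y powr k) \<in> borel_measurable borel"
  by measurable

lemma integrable_norm_powr_ball:
  fixes k r :: real
  assumes k: "0 \<le> k" "k < DIM('a::euclidean_space)" 
  shows "integrable lborel (\<lambda>y::'a. indicator (ball 0 r) y * norm y powr - k)"
proof (rule integrableI_bounded)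
  have "(\<integral>\<^sup>+ y. ennreal (norm (indicator (ball 0 r) y * norm (y::'a) powr - k)) \<partial>lborel)
     = (\<integral>\<^sup>+y. ennreal (norm (y::'a) powr - k) * indicator (ball 0 r) y \<partial>lborel)"
    by (rule nn_integral_cong) (auto simp: indicator_def)
  then show "(\<integral>\<^sup>+ y. ennreal (norm (indicator (ball 0 r) y * norm (y::'a) powr - k)) \<partial>lborel) < \<infinity>"
    using nn_integral_norm_powr_ball[OF k, of r] by simp
qed (auto intro!: borel_measurable_times borel_measurable_indicator)

text \<open>The value is 4 pi, since the radial integral of 3 r^2 (1 + r^2)^(-5/2) is 1; the proof
  carries it as a positive symbol.\<close>

definition kirchhoff_const :: real where
  "kirchhoff_const = (\<integral>z. 3 * (1 + (norm (z::real^3))\<^sup>2) powr (- 5 / 2) \<partial>lborel)"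

lemma integrable_kirchhoff_kernel:
  "integrable lborel (\<lambda>z::real^3. 3 * (1 + (norm z)\<^sup>2) powr (- 5 / 2))"
proof (rule integrable_mult_right, rule integrableI_bounded)
  show "(\<integral>\<^sup>+ z. ennreal (norm ((1 + (norm (z::real^3))\<^sup>2) powr (- 5 / 2))) \<partial>lborel) < \<infinity>"
    using nn_integral_one_plus_norm_powr[where 'a="real^3", of 5] by simp
qed measurable

lemma kirchhoff_const_pos: "kirchhoff_const > 0"
proof -
  let ?k = "\<lambda>z::real^3. 3 * (1 + (norm z)\<^sup>2) powr (- 5 / 2)"
  have pos: "?k z > 0" for z
    using add_pos_nonneg[OF zero_less_one, of "(norm z)\<^sup>2"] by simp
  have "emeasure lborel {z \<in> space lborel. ?k z \<noteq> 0} \<noteq> 0"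
    using pos by (simp add: less_imp_neq[THEN not_sym])
  then have "\<not> (AE z in lborel. ?k z = 0)"
    by (subst AE_iff_measurable[OF _ refl]) (auto intro: measurable_sets)
  then have "kirchhoff_const \<noteq> 0"
    unfolding kirchhoff_const_def
    by (subst integral_nonneg_eq_0_iff_AE[OF integrable_kirchhoff_kernel]) (simp_all add: pos less_imp_le)
  moreover have "kirchhoff_const \<ge> 0"
    unfolding kirchhoff_const_def by (rule Bochner_Integration.integral_nonneg) (simp add: pos less_imp_le)
  ultimately show ?thesis by simp
qed

text \<open>The null cone is replaced by the smooth spacelike hyperboloid \<open>t - sqrt (\<bar>y\<bar>\<^sup>2 + \<epsilon>\<^sup>2)\<close>; on it the
  wave operator divided by \<open>\<rho>\<close> is a divergence up to terms that concentrate at the vertex.\<close>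

context
  fixes \<psi> \<psi>t \<psi>tt :: "real \<times> (real^3) \<Rightarrow> real" and \<psi>x \<psi>tx :: "real \<times> (real^3) \<Rightarrow> real^3"
    and \<psi>xx :: "3 \<Rightarrow> real \<times> (real^3) \<Rightarrow> real^3" and c :: real
  assumes d0: "\<And>z. has_gradient \<psi> (\<psi>t z) (\<psi>x z) (at z)"
    and dt: "\<And>z. has_gradient \<psi>t (\<psi>tt z) (\<psi>tx z) (at z)"
    and dx: "\<And>z i. has_gradient (\<lambda>z. \<psi>x z $ i) (\<psi>tx z $ i) (\<psi>xx i z) (at z)"
    and cont: "continuous_on UNIV \<psi>tt" "\<And>i. continuous_on UNIV (\<psi>xx i)"
    and past: "\<And>z. fst z \<le> c \<Longrightarrow> \<psi> z = 0" "\<And>z. fst z \<le> c \<Longrightarrow> \<psi>t z = 0"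
      "\<And>z. fst z \<le> c \<Longrightarrow> \<psi>x z = 0" "\<And>z. fst z \<le> c \<Longrightarrow> \<psi>tt z = 0"
      "\<And>z i. fst z \<le> c \<Longrightarrow> \<psi>xx i z = 0"
begin

private lemma has_gradient_imp_continuous_on:
  assumes "\<And>z. has_gradient F (a z) (b z) (at z)"
  shows "continuous_on UNIV F"
  using assms unfolding has_gradient_def
  by (meson continuous_at_imp_continuous_on has_derivative_continuous)

private lemma cont0: "continuous_on UNIV \<psi>" "continuous_on UNIV \<psi>t" "continuous_on UNIV (\<lambda>z. \<psi>x z $ i)"
  by (rule has_gradient_imp_continuous_on, rule d0 dt dx)+

private definition "wave = (\<lambda>z. \<psi>tt z - (\<Sum>i\<in>UNIV. \<psi>xx i z $ i))"
private definition "rho = (\<lambda>\<epsilon> (y::real^3). sqrt ((norm y)\<^sup>2 + \<epsilon>\<^sup>2))"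
private definition "hyp = (\<lambda>t x \<epsilon> (y::real^3). (t - rho \<epsilon> y, x + y))"

private lemma rho_pos: "\<epsilon> > 0 \<Longrightarrow> rho \<epsilon> y > 0"
  unfolding rho_def by (simp add: add_nonneg_pos)

private lemma rho_ge: "rho \<epsilon> y \<ge> norm y"
  unfolding rho_def by (rule real_le_rsqrt) simp

private lemma rho_ge_eps: "\<epsilon> > 0 \<Longrightarrow> rho \<epsilon> y \<ge> \<epsilon>"
  unfolding rho_def by (rule real_le_rsqrt) simp

private lemma rho_sq: "(rho \<epsilon> y)\<^sup>2 = (norm y)\<^sup>2 + \<epsilon>\<^sup>2"
  unfolding rho_def by simp

private lemma cont_wave: "continuous_on UNIV wave"
  unfolding wave_def by (intro continuous_intros cont)

private lemma cont_rho [continuous_intros]: "continuous_on S (rho \<epsilon>)"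
  unfolding rho_def by (intro continuous_intros)

private lemma cont_hyp [continuous_intros]: "continuous_on S (hyp t x \<epsilon>)"
  unfolding hyp_def by (intro continuous_intros)

text \<open>Vanishing before time c cuts each backward hyperboloid down to a ball, so that all
  integrands below have compact support.\<close>

private lemma hyp_past: "norm y > \<bar>t - c\<bar> \<Longrightarrow> fst (hyp t x \<epsilon> y) \<le> c"
  using rho_ge[of y \<epsilon>] unfolding hyp_def by auto

private lemma wave_past: "fst z \<le> c \<Longrightarrow> wave z = 0"
  unfolding wave_def by (simp add: past)

text \<open>\<open>X'\<close> is the i-th partial derivative of the field component \<open>X\<close>
  defined in the proof. The weights 1/rho, y_i/rho^2 and y_i/rho^3 are chosen so that the mixed
  derivatives \<open>\<psi>tx\<close> and the terms in \<open>\<psi>x\<close> cancel.\<close>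

private lemma divergence_component:
  fixes t :: real and x :: "real^3" and i :: 3
  assumes e: "\<epsilon> > 0"
  defines "r \<equiv> rho \<epsilon>" and "z \<equiv> hyp t x \<epsilon>"
  defines "q \<equiv> \<lambda>y. 1 / r y"
  defines "X' \<equiv> \<lambda>y. \<psi>xx i (z y) $ i * q y - \<psi>tt (z y) * (y $ i)\<^sup>2 * q y ^ 3
      + \<psi>t (z y) * ((q y)\<^sup>2 - 3 * (y $ i)\<^sup>2 * q y ^ 4) + \<psi> (z y) * (q y ^ 3 - 3 * (y $ i)\<^sup>2 * q y ^ 5)"
  shows "integrable lborel X'" "integral\<^sup>L lborel X' = 0"
proof -
  define X where "X = (\<lambda>y. \<psi>x (z y) $ i * q y + \<psi>t (z y) * y $ i * (q y)\<^sup>2 + \<psi> (z y) * y $ i * q y ^ 3)"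
  have r: "r y > 0" for y unfolding r_def using e by (rule rho_pos)
  have der: "((\<lambda>s. X (y + s *\<^sub>R axis i 1)) has_real_derivative X' y) (at 0)" for y
  proof -
    have dr: "((\<lambda>s. r (y + s *\<^sub>R axis i 1)) has_real_derivative y $ i / r y) (at 0)"
    proof -
      have eq: "r (y + s *\<^sub>R axis i 1) = sqrt ((norm y)\<^sup>2 + 2 * s * y $ i + s\<^sup>2 + \<epsilon>\<^sup>2)" for s
        unfolding r_def rho_def power2_norm_eq_inner
        by (simp add: inner_add_left inner_add_right inner_axis inner_commute[of "axis i 1"] power2_eq_square algebra_simps)
      have "(norm y)\<^sup>2 + \<epsilon>\<^sup>2 > 0" using e by (simp add: add_nonneg_pos)
      then show ?thesis
        unfolding eq by (auto intro!: derivative_eq_intros simp: r_def rho_def field_simps)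
    qed
    have dz: "((\<lambda>s. F (z (y + s *\<^sub>R axis i 1))) has_real_derivative b $ i - a * y $ i * q y) (at 0)"
      if F: "has_gradient F a b (at (z y))" for F a b
    proof -
      have "((\<lambda>s. F (t - r (y + s *\<^sub>R axis i 1), x + (y + s *\<^sub>R axis i 1))) has_real_derivative
          a * (- (y $ i / r y)) + b \<bullet> axis i 1) (at 0)"
      proof (rule has_gradient_along_curve[where S=UNIV])
        show "has_gradient F a b (at (t - r (y + 0 *\<^sub>R axis i 1), x + (y + 0 *\<^sub>R axis i 1)))"
          using F by (simp add: z_def hyp_def r_def)
        show "((\<lambda>s. t - r (y + s *\<^sub>R axis i 1)) has_real_derivative - (y $ i / r y)) (at 0)"
          by (auto intro!: derivative_eq_intros dr)
        show "((\<lambda>s. x + (y + s *\<^sub>R axis i 1)) has_vector_derivative axis i 1) (at (0::real))"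
          by (auto intro!: derivative_eq_intros)
      qed auto
      then show ?thesis by (simp add: z_def hyp_def r_def q_def inner_axis)
    qed
    have dy: "((\<lambda>s. (y + s *\<^sub>R axis i 1) $ i) has_real_derivative 1) (at 0)"
      by (auto intro!: derivative_eq_intros)
    have dq: "((\<lambda>s. q (y + s *\<^sub>R axis i 1)) has_real_derivative - (y $ i * q y ^ 3)) (at 0)"
      unfolding q_def using r[of y]
      by (auto intro!: derivative_eq_intros dr simp: field_simps power2_eq_square power3_eq_cube)
    show ?thesis
      unfolding X_def
      by (rule derivative_eq_intros dq dz[OF d0] dz[OF dt] dz[OF dx] dy refl | assumption)+
        (simp add: X'_def algebra_simps power2_eq_square numeral_eq_Suc)
  qed
  have cz: "continuous_on UNIV z" unfolding z_def by (intro continuous_intros)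
  have cr: "continuous_on UNIV r" unfolding r_def by (intro continuous_intros)
  have cF: "continuous_on UNIV (\<lambda>y. F (z y))" if "continuous_on UNIV F" for F :: "real \<times> (real^3) \<Rightarrow> real"
    using continuous_on_compose2[OF that cz] by simp
  have cq: "continuous_on UNIV q"
    unfolding q_def by (intro continuous_intros cr) (use r in \<open>simp add: less_imp_neq[THEN not_sym]\<close>)
  have cX: "continuous_on UNIV X"
    unfolding X_def
    by (intro continuous_intros cF[of "\<lambda>z. \<psi>x z $ i"] cF[of \<psi>t] cF[of \<psi>] cq cont0)
  have cX': "continuous_on UNIV X'"
    unfolding X'_def
    by (intro continuous_intros cF[of "\<lambda>z. \<psi>xx i z $ i"] cF[of \<psi>tt] cF[of \<psi>t] cF[of \<psi>] cq cont0 cont)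
  have supp: "X y = 0" if "norm y > \<bar>t - c\<bar>" for y
    using past(1-3)[OF hyp_past[OF that]] by (simp add: X_def z_def)
  show "integrable lborel X'" "integral\<^sup>L lborel X' = 0"
    using integral_directional_derivative_eq_0[OF der cX cX' supp] by auto
qed

text \<open>Sum the three components of \<open>divergence_component\<close> and insert |y|^2 = rho^2
  - \<epsilon>^2: the terms free of \<epsilon> collapse to -\<open>wave\<close>/rho.\<close>

private lemma hyperboloid_identity:
  assumes e: "\<epsilon> > 0"
  shows "(\<integral>y. wave (hyp t x \<epsilon> y) / rho \<epsilon> y \<partial>lborel) =
    (\<integral>y. \<epsilon>\<^sup>2 * (\<psi>tt (hyp t x \<epsilon> y) / rho \<epsilon> y ^ 3 + 3 * \<psi>t (hyp t x \<epsilon> y) / rho \<epsilon> y ^ 4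
      + 3 * \<psi> (hyp t x \<epsilon> y) / rho \<epsilon> y ^ 5) \<partial>lborel)" (is "?L = integral\<^sup>L lborel ?R")
proof -
  let ?z = "hyp t x \<epsilon>" and ?r = "rho \<epsilon>"
  let ?q = "\<lambda>y. 1 / ?r y"
  let ?X = "\<lambda>i y. \<psi>xx i (?z y) $ i * ?q y - \<psi>tt (?z y) * (y $ i)\<^sup>2 * ?q y ^ 3
      + \<psi>t (?z y) * ((?q y)\<^sup>2 - 3 * (y $ i)\<^sup>2 * ?q y ^ 4) + \<psi> (?z y) * (?q y ^ 3 - 3 * (y $ i)\<^sup>2 * ?q y ^ 5)"
  have int0: "(\<integral>y. (\<Sum>i\<in>UNIV. ?X i y) \<partial>lborel) = 0"
    by (subst Bochner_Integration.integral_sum)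
      (simp_all only: divergence_component[OF e] sum.neutral_const)
  have r0: "?r y \<noteq> 0" for y using rho_pos[OF e, of y] by simp
  have cF: "continuous_on UNIV (\<lambda>y. F (?z y))" if "continuous_on UNIV F" for F :: "real \<times> (real^3) \<Rightarrow> real"
    using continuous_on_compose2[OF that cont_hyp] by simp
  have iR: "integrable lborel ?R"
  proof (rule lebesgue_integral_eq_integral_cbox(1))
    show "continuous_on UNIV ?R"
      by (intro continuous_intros cF[of \<psi>tt] cF[of \<psi>t] cF[of \<psi>] cont0 cont) (auto simp: r0)
    fix y :: "real^3" assume "y \<notin> cbox (- \<bar>t - c\<bar> *\<^sub>R One) (\<bar>t - c\<bar> *\<^sub>R One)"
    then have "norm y > \<bar>t - c\<bar>" using cball_subset_cbox_One[of "\<bar>t - c\<bar>"] by (force simp: not_le)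
    then show "?R y = 0" using past[OF hyp_past[of t y x \<epsilon>]] by simp
  qed
  have eq: "?R y - (\<Sum>i\<in>UNIV. ?X i y) = wave (?z y) / ?r y" for y
  proof -
    have n: "(y$1)\<^sup>2 + (y$2)\<^sup>2 + (y$3)\<^sup>2 = (?r y)\<^sup>2 - \<epsilon>\<^sup>2"
      unfolding rho_sq power2_norm_eq_inner by (simp add: inner_vec_def sum_3 power2_eq_square)
    define q where "q = 1 / ?r y"
    \<comment> \<open>Instances of \<epsilon>^2 + |y|^2 = rho^2, which trade each \<epsilon>^2 for
      terms that occur in the divergence.\<close>
    have q: "\<epsilon>\<^sup>2 * q ^ Suc (Suc k) = q ^ k - ((y$1)\<^sup>2 + (y$2)\<^sup>2 + (y$3)\<^sup>2) * q ^ Suc (Suc k)" for k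
    proof -
      have "(\<epsilon>\<^sup>2 + ((y$1)\<^sup>2 + (y$2)\<^sup>2 + (y$3)\<^sup>2)) * q\<^sup>2 = 1"
        unfolding n q_def using r0[of y] by (simp add: power_divide)
      then have "(\<epsilon>\<^sup>2 + ((y$1)\<^sup>2 + (y$2)\<^sup>2 + (y$3)\<^sup>2)) * q\<^sup>2 * q ^ k = q ^ k" by simp
      then show ?thesis by (simp add: algebra_simps power2_eq_square)
    qed
    have q3: "\<epsilon>\<^sup>2 * q ^ 3 = q - ((y$1)\<^sup>2 + (y$2)\<^sup>2 + (y$3)\<^sup>2) * q ^ 3"
      and q4: "\<epsilon>\<^sup>2 * q ^ 4 = q\<^sup>2 - ((y$1)\<^sup>2 + (y$2)\<^sup>2 + (y$3)\<^sup>2) * q ^ 4"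
      and q5: "\<epsilon>\<^sup>2 * q ^ 5 = q ^ 3 - ((y$1)\<^sup>2 + (y$2)\<^sup>2 + (y$3)\<^sup>2) * q ^ 5"
      using q[of 1] q[of 2] q[of 3] by (simp_all add: numeral_eq_Suc)
    have q': "inverse (?r y) = q" by (simp add: q_def inverse_eq_divide)
    have "?R y = \<psi>tt (?z y) * (\<epsilon>\<^sup>2 * q ^ 3) + 3 * \<psi>t (?z y) * (\<epsilon>\<^sup>2 * q ^ 4) + 3 * \<psi> (?z y) * (\<epsilon>\<^sup>2 * q ^ 5)"
      unfolding q_def by (simp add: power_divide algebra_simps)
    then show ?thesis
      unfolding q_def[symmetric] q3 q4 q5 sum_3 wave_def
      by (simp only: divide_inverse q') (simp add: algebra_simps)
  qed
  have "?L = (\<integral>y. ?R y - (\<Sum>i\<in>UNIV. ?X i y) \<partial>lborel)"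
    unfolding eq ..
  also have "\<dots> = integral\<^sup>L lborel ?R - 0"
    unfolding int0[symmetric]
    by (rule Bochner_Integration.integral_diff[OF iR], rule Bochner_Integration.integrable_sum)
      (simp only: divergence_component[OF e])
  finally show ?thesis by simp
qed

text \<open>Uniformity in \<epsilon>: the hyperboloids below (t, x) meet the times after c in one
  compact set. This supplies the majorants for the limits. The extra 1 lets the open ball contain
  the closed ball of radius |t - c|.\<close>

private lemma hyp_bounded:
  fixes F :: "real \<times> (real^3) \<Rightarrow> real"
  assumes F: "continuous_on UNIV F" "\<And>z. fst z \<le> c \<Longrightarrow> F z = 0"
  obtains M where "\<And>\<epsilon> y. 0 \<le> \<epsilon> \<Longrightarrow> \<epsilon> \<le> 1 \<Longrightarrow> \<bar>F (hyp t x \<epsilon> y)\<bar> \<le> M * indicator (ball 0 (\<bar>t - c\<bar> + 1)) y" "M \<ge> 0"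
proof -
  let ?K = "{c..t} \<times> cball x (\<bar>t - c\<bar>)"
  have "compact (F ` ?K)"
    by (intro compact_continuous_image continuous_on_subset[OF F(1)] compact_Times) auto
  then have "bounded (F ` ?K)" by (rule compact_imp_bounded)
  then obtain M where M: "\<forall>v\<in>F ` ?K. norm v \<le> M" unfolding bounded_iff by blast
  have M: "\<bar>F z\<bar> \<le> M" if "z \<in> ?K" for z
    using M imageI[OF that, of F] by (metis real_norm_def)
  show ?thesis
  proof (rule that[of "\<bar>M\<bar>"])
    fix \<epsilon> :: real and y :: "real^3" assume e: "0 \<le> \<epsilon>" "\<epsilon> \<le> 1"
    show "\<bar>F (hyp t x \<epsilon> y)\<bar> \<le> \<bar>M\<bar> * indicator (ball 0 (\<bar>t - c\<bar> + 1)) y"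
    proof (cases "fst (hyp t x \<epsilon> y) \<le> c")
      case False
      then have "norm y \<le> \<bar>t - c\<bar>" using hyp_past[of t y] by force
      moreover have "rho \<epsilon> y \<ge> 0" unfolding rho_def by simp
      ultimately have "\<bar>F (hyp t x \<epsilon> y)\<bar> \<le> M"
        using False by (intro M) (auto simp: hyp_def dist_norm)
      with \<open>norm y \<le> _\<close> show ?thesis by simp
    qed (simp add: F(2))
  qed simp
qed

private lemma integrable_hyp:
  fixes F :: "real \<times> (real^3) \<Rightarrow> real"
  assumes F: "continuous_on UNIV F" "\<And>z. fst z \<le> c \<Longrightarrow> F z = 0" and e: "\<epsilon> > 0"
  shows "integrable lborel (\<lambda>y. F (hyp t x \<epsilon> y) / rho \<epsilon> y ^ k)"
proof (rule lebesgue_integral_eq_integral_cbox(1))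
  show "continuous_on UNIV (\<lambda>y. F (hyp t x \<epsilon> y) / rho \<epsilon> y ^ k)"
    by (intro continuous_intros continuous_on_compose2[OF F(1)] ballI power_not_zero)
      (use rho_pos[OF e] in \<open>auto simp: less_imp_neq[THEN not_sym]\<close>)
  fix y :: "real^3" assume "y \<notin> cbox (- \<bar>t - c\<bar> *\<^sub>R One) (\<bar>t - c\<bar> *\<^sub>R One)"
  then have "norm y > \<bar>t - c\<bar>" using cball_subset_cbox_One[of "\<bar>t - c\<bar>"] by (force simp: not_le)
  then show "F (hyp t x \<epsilon> y) / rho \<epsilon> y ^ k = 0" using F(2)[OF hyp_past[of t y x \<epsilon>]] by simp
qed

section \<open>Passage from hyperboloids to the null cone\<close>

private definition "eps = (\<lambda>n. 1 / real (Suc n))"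

private lemma eps: "eps n > 0" "eps n \<le> 1" "eps \<longlonglongrightarrow> 0"
  unfolding eps_def using LIMSEQ_inverse_real_of_nat by (simp_all add: inverse_eq_divide)

private lemma tendsto_rho: "(\<lambda>n. rho (eps n) y) \<longlonglongrightarrow> norm y"
proof -
  have "(\<lambda>n. rho (eps n) y) \<longlonglongrightarrow> sqrt ((norm y)\<^sup>2 + 0\<^sup>2)"
    unfolding rho_def by (intro tendsto_intros eps)
  then show ?thesis by simp
qed

private lemma tendsto_hyp:
  fixes F :: "real \<times> (real^3) \<Rightarrow> real"
  assumes "continuous_on UNIV F"
  shows "(\<lambda>n. F (hyp t x (eps n) y)) \<longlonglongrightarrow> F (t - norm y, x + y)"
  unfolding hyp_def
  by (rule continuous_on_tendsto_compose[OF assms]) (auto intro!: tendsto_intros tendsto_rho)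

private lemma AE_nonzero: "AE y::real^3 in lborel. y \<noteq> 0"
  by (rule AE_lborel_singleton)

text \<open>Dominated convergence; rho >= |y| gives a multiple of 1/|y| on a ball as
  majorant.\<close>

private lemma limit_box:
  "(\<lambda>n. \<integral>y. wave (hyp t x (eps n) y) / rho (eps n) y \<partial>lborel)
     \<longlonglongrightarrow> (\<integral>y. wave (t - norm y, x + y) / norm y \<partial>lborel)"
proof -
  obtain M where M: "\<And>\<epsilon> y. 0 \<le> \<epsilon> \<Longrightarrow> \<epsilon> \<le> 1 \<Longrightarrow>
      \<bar>wave (hyp t x \<epsilon> y)\<bar> \<le> M * indicator (ball 0 (\<bar>t - c\<bar> + 1)) y" "M \<ge> 0"
    using hyp_bounded[OF cont_wave wave_past] by blast
  show ?thesis
  proof (rule integral_dominated_convergence)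
    show "integrable lborel (\<lambda>y::real^3. M * (indicator (ball 0 (\<bar>t - c\<bar> + 1)) y * norm y powr - 1))"
      by (rule integrable_mult_right, rule integrable_norm_powr_ball) auto
    have m: "(\<lambda>y. wave (hyp t x (eps n) y) / rho (eps n) y) \<in> borel_measurable lborel" for n
      using integrable_hyp[OF cont_wave wave_past eps(1)[of n], where t=t and x=x and k=1] by (auto dest: borel_measurable_integrable)
    then show "\<And>n. (\<lambda>y. wave (hyp t x (eps n) y) / rho (eps n) y) \<in> borel_measurable lborel" .
    have "(\<lambda>y. wave (t - norm y, x + y)) \<in> borel_measurable borel"
      by (intro borel_measurable_continuous_onI continuous_on_compose2[OF cont_wave] continuous_intros) auto
    then show "(\<lambda>y. wave (t - norm y, x + y) / norm y) \<in> borel_measurable lborel"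
      by measurable
    show "AE y in lborel. (\<lambda>n. wave (hyp t x (eps n) y) / rho (eps n) y) \<longlonglongrightarrow> wave (t - norm y, x + y) / norm y"
      using AE_nonzero
      by eventually_elim (intro tendsto_divide tendsto_hyp cont_wave tendsto_rho, simp)
    show "AE y in lborel. norm (wave (hyp t x (eps n) y) / rho (eps n) y)
        \<le> M * (indicator (ball 0 (\<bar>t - c\<bar> + 1)) y * norm y powr - 1)" for n
      using AE_nonzero
    proof eventually_elim
      case (elim y)
      have "norm (wave (hyp t x (eps n) y) / rho (eps n) y)
          \<le> M * indicator (ball 0 (\<bar>t - c\<bar> + 1)) y / norm y"
        unfolding real_norm_def abs_divide
        using M(1)[of "eps n" y] eps(1,2)[of n] rho_ge[of y "eps n"] elim M(2)
        by (intro frac_le) (auto simp: less_imp_le)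
      then show ?case using elim by (simp add: powr_minus divide_inverse)
    qed
  qed
qed

text \<open>From rho >= \<epsilon> and rho >= |y| one gets \<epsilon>^2/rho^3 <= 1/|y| and
  \<epsilon>^2/rho^4 <= 1/|y|^2, both locally integrable in R^3, while off the vertex the terms tend
  to 0 pointwise.\<close>

private lemma limit_lower_order:
  "(\<lambda>n. \<integral>y. (eps n)\<^sup>2 * (\<psi>tt (hyp t x (eps n) y) / rho (eps n) y ^ 3
      + 3 * \<psi>t (hyp t x (eps n) y) / rho (eps n) y ^ 4) \<partial>lborel) \<longlonglongrightarrow> 0"
proof -
  let ?R = "\<bar>t - c\<bar> + 1"
  obtain M where M: "\<And>\<epsilon> y. 0 \<le> \<epsilon> \<Longrightarrow> \<epsilon> \<le> 1 \<Longrightarrow> \<bar>\<psi>tt (hyp t x \<epsilon> y)\<bar> \<le> M * indicator (ball 0 ?R) y" "M \<ge> 0"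
    using hyp_bounded[OF cont(1) past(4)] by blast
  obtain N where N: "\<And>\<epsilon> y. 0 \<le> \<epsilon> \<Longrightarrow> \<epsilon> \<le> 1 \<Longrightarrow> \<bar>\<psi>t (hyp t x \<epsilon> y)\<bar> \<le> N * indicator (ball 0 ?R) y" "N \<ge> 0"
    using hyp_bounded[OF cont0(2) past(2)] by blast
  let ?f = "\<lambda>n y. (eps n)\<^sup>2 * (\<psi>tt (hyp t x (eps n) y) / rho (eps n) y ^ 3
      + 3 * \<psi>t (hyp t x (eps n) y) / rho (eps n) y ^ 4)"
  let ?w = "\<lambda>y::real^3. M * (indicator (ball 0 ?R) y * norm y powr - 1)
      + 3 * N * (indicator (ball 0 ?R) y * norm y powr - 2)"
  have "(\<lambda>n. integral\<^sup>L lborel (?f n)) \<longlonglongrightarrow> integral\<^sup>L lborel (\<lambda>_::real^3. 0::real)"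
  proof (rule integral_dominated_convergence)
    show "integrable lborel ?w"
      by (intro Bochner_Integration.integrable_add integrable_mult_right integrable_norm_powr_ball) auto
    show "?f n \<in> borel_measurable lborel" for n
      using borel_measurable_integrable[OF integrable_hyp[OF cont(1) past(4) eps(1)[of n], where t=t and x=x and k=3]]
        borel_measurable_integrable[OF integrable_hyp[OF cont0(2) past(2) eps(1)[of n], where t=t and x=x and k=4]]
      by (auto simp: times_divide_eq_right[symmetric] simp del: times_divide_eq_right)
    show "AE y in lborel. (\<lambda>n. ?f n y) \<longlonglongrightarrow> 0"
      using AE_nonzero
    proof eventually_elim
      case (elim y)
      then have "(\<lambda>n. ?f n y) \<longlonglongrightarrow> 0\<^sup>2 * (\<psi>tt (t - norm y, x + y) / norm y ^ 3 + 3 * \<psi>t (t - norm y, x + y) / norm y ^ 4)"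
        by (intro tendsto_intros eps tendsto_hyp cont cont0 tendsto_rho) auto
      then show ?case by simp
    qed
    show "AE y in lborel. norm (?f n y) \<le> ?w y" for n
      using AE_nonzero
    proof eventually_elim
      case (elim y)
      let ?r = "rho (eps n) y"
      have r: "?r > 0" "?r \<ge> norm y" "?r \<ge> eps n" "norm y > 0"
        using rho_pos[OF eps(1)] rho_ge rho_ge_eps[OF eps(1)] elim by auto
      have e2: "(eps n)\<^sup>2 \<le> ?r\<^sup>2" using r eps(1)[of n] by (intro power_mono) auto
      have "(eps n)\<^sup>2 / ?r ^ 3 \<le> ?r\<^sup>2 / ?r ^ 3" using e2 zero_le_power[OF less_imp_le[OF r(1)]] by (rule divide_right_mono)
      also have "\<dots> = 1 / ?r" using r by (simp add: power2_eq_square power3_eq_cube)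
      also have "\<dots> \<le> 1 / norm y" using r by (intro frac_le) auto
      finally have 1: "(eps n)\<^sup>2 / ?r ^ 3 \<le> norm y powr - 1" using r by (simp add: powr_minus divide_inverse)
      have "(eps n)\<^sup>2 / ?r ^ 4 \<le> ?r\<^sup>2 / ?r ^ 4" using e2 zero_le_power[OF less_imp_le[OF r(1)]] by (rule divide_right_mono)
      also have "\<dots> = 1 / ?r\<^sup>2" using r by (simp add: power2_eq_square numeral_eq_Suc)
      also have "\<dots> \<le> 1 / (norm y)\<^sup>2" using r by (intro frac_le power_mono) auto
      finally have 2: "(eps n)\<^sup>2 / ?r ^ 4 \<le> norm y powr - 2"
        using r by (simp add: powr_minus divide_inverse powr_numeral)
      have q3: "(eps n)\<^sup>2 / ?r ^ 3 \<ge> 0" and q4: "(eps n)\<^sup>2 / ?r ^ 4 \<ge> 0"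
        using r(1) by (simp_all add: less_imp_le)
      have "norm (?f n y) = \<bar>\<psi>tt (hyp t x (eps n) y) * ((eps n)\<^sup>2 / ?r ^ 3) + 3 * \<psi>t (hyp t x (eps n) y) * ((eps n)\<^sup>2 / ?r ^ 4)\<bar>"
        by (simp add: algebra_simps)
      also have "\<dots> \<le> \<bar>\<psi>tt (hyp t x (eps n) y)\<bar> * ((eps n)\<^sup>2 / ?r ^ 3) + 3 * \<bar>\<psi>t (hyp t x (eps n) y)\<bar> * ((eps n)\<^sup>2 / ?r ^ 4)"
        by (rule order.trans[OF abs_triangle_ineq]) 
          (simp only: abs_mult abs_of_nonneg[OF q3] abs_of_nonneg[OF q4] abs_numeral order_refl)
      also have "\<dots> \<le> (M * indicator (ball 0 ?R) y) * norm y powr - 1 + 3 * (N * indicator (ball 0 ?R) y) * norm y powr - 2"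
        using M N eps(1,2)[of n] 1 2 r by (intro add_mono mult_mono) (auto simp: less_imp_le)
      finally show ?case by (simp add: algebra_simps)
    qed
  qed auto
  then show ?thesis by simp
qed

text \<open>Here the analogous majorant 1/|y|^3 is not integrable, and the term does concentrate at
  the vertex: after y = \<epsilon> z the powers of \<epsilon> cancel, 3 + 2 - 5 = 0, and the kernel
  becomes the fixed integrable function 3 (1 + |z|^2)^(-5/2).\<close>

private lemma limit_main:
  "(\<lambda>n. \<integral>y. (eps n)\<^sup>2 * (3 * \<psi> (hyp t x (eps n) y) / rho (eps n) y ^ 5) \<partial>lborel)
     \<longlonglongrightarrow> kirchhoff_const * \<psi> (t, x)"
proof -
  obtain M where M: "\<And>\<epsilon> y. 0 \<le> \<epsilon> \<Longrightarrow> \<epsilon> \<le> 1 \<Longrightarrow>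
      \<bar>\<psi> (hyp t x \<epsilon> y)\<bar> \<le> M * indicator (ball 0 (\<bar>t - c\<bar> + 1)) y" "M \<ge> 0"
    using hyp_bounded[OF cont0(1) past(1)] by blast
  let ?k = "\<lambda>z::real^3. 3 * (1 + (norm z)\<^sup>2) powr (- 5 / 2)"
  let ?g = "\<lambda>n z. ?k z * \<psi> (hyp t x (eps n) (eps n *\<^sub>R z))"
  have scale: "(\<integral>y. (eps n)\<^sup>2 * (3 * \<psi> (hyp t x (eps n) y) / rho (eps n) y ^ 5) \<partial>lborel) = integral\<^sup>L lborel (?g n)" for n
  proof -
    have "(\<lambda>y. (eps n)\<^sup>2 * (3 * \<psi> (hyp t x (eps n) y) / rho (eps n) y ^ 5)) \<in> borel_measurable borel"
      using borel_measurable_integrable[OF integrable_hyp[OF cont0(1) past(1) eps(1)[of n], where t=t and x=x and k=5]]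
      by (auto simp: times_divide_eq_right[symmetric] simp del: times_divide_eq_right)
    from integral_lborel_scale[OF eps(1)[of n] this]
    have "(\<integral>y. (eps n)\<^sup>2 * (3 * \<psi> (hyp t x (eps n) y) / rho (eps n) y ^ 5) \<partial>lborel)
      = eps n ^ 3 * (\<integral>z. (eps n)\<^sup>2 * (3 * \<psi> (hyp t x (eps n) (eps n *\<^sub>R z)) / rho (eps n) (eps n *\<^sub>R z) ^ 5) \<partial>lborel)"
      by simp
    also have "\<dots> = (\<integral>z. eps n ^ 3 * ((eps n)\<^sup>2 * (3 * \<psi> (hyp t x (eps n) (eps n *\<^sub>R z)) / rho (eps n) (eps n *\<^sub>R z) ^ 5)) \<partial>lborel)"
      by (rule integral_mult_right_zero[symmetric])
    also have "\<dots> = integral\<^sup>L lborel (?g n)"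
    proof (rule Bochner_Integration.integral_cong[OF refl])
      fix z :: "real^3"
      let ?q = "1 + (norm z)\<^sup>2"
      have q: "?q > 0" by (simp add: add_pos_nonneg)
      have "rho (eps n) (eps n *\<^sub>R z) = sqrt ((eps n)\<^sup>2 * ?q)"
        unfolding rho_def by (simp add: power_mult_distrib algebra_simps)
      also have "\<dots> = eps n * ?q powr (1/2)"
        using eps(1)[of n] q by (simp add: real_sqrt_mult powr_half_sqrt)
      finally have "rho (eps n) (eps n *\<^sub>R z) ^ 5 = eps n ^ 5 * ?q powr (5 / 2)"
        using q by (simp add: power_mult_distrib powr_power)
      then show "eps n ^ 3 * ((eps n)\<^sup>2 * (3 * \<psi> (hyp t x (eps n) (eps n *\<^sub>R z)) / rho (eps n) (eps n *\<^sub>R z) ^ 5)) = ?g n z"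
        using eps(1)[of n] q by (simp add: powr_minus divide_simps)
    qed
    finally show ?thesis .
  qed
  have "(\<lambda>n. integral\<^sup>L lborel (?g n)) \<longlonglongrightarrow> (\<integral>z. ?k z * \<psi> (t, x) \<partial>lborel)"
  proof (rule integral_dominated_convergence)
    show "integrable lborel (\<lambda>z. ?k z * M)"
      by (intro integrable_mult_left integrable_kirchhoff_kernel)
    show "?g n \<in> borel_measurable lborel" for n
    proof -
      have "continuous_on UNIV (\<lambda>z. \<psi> (hyp t x (eps n) (eps n *\<^sub>R z)))"
        by (intro continuous_on_compose2[OF cont0(1)] continuous_on_compose2[OF cont_hyp] continuous_intros) auto
      then have "(\<lambda>z. \<psi> (hyp t x (eps n) (eps n *\<^sub>R z))) \<in> borel_measurable borel"
        by (rule borel_measurable_continuous_onI)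
      then show ?thesis by measurable
    qed
    show "(\<lambda>z. ?k z * \<psi> (t, x)) \<in> borel_measurable lborel" by measurable
    show "AE z in lborel. (\<lambda>n. ?g n z) \<longlonglongrightarrow> ?k z * \<psi> (t, x)"
    proof (rule AE_I2, rule tendsto_mult_left)
      fix z :: "real^3"
      have "(\<lambda>n. (t - rho (eps n) (eps n *\<^sub>R z), x + eps n *\<^sub>R z)) \<longlonglongrightarrow> (t - sqrt ((norm ((0::real) *\<^sub>R z))\<^sup>2 + 0\<^sup>2), x + 0 *\<^sub>R z)"
        unfolding rho_def by (intro tendsto_intros eps)
      then show "(\<lambda>n. \<psi> (hyp t x (eps n) (eps n *\<^sub>R z))) \<longlonglongrightarrow> \<psi> (t, x)"
        unfolding hyp_def by (intro continuous_on_tendsto_compose[OF cont0(1)]) auto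
    qed
    show "AE z in lborel. norm (?g n z) \<le> ?k z * M" for n
    proof (rule AE_I2)
      fix z :: "real^3"
      have "\<bar>\<psi> (hyp t x (eps n) (eps n *\<^sub>R z))\<bar> \<le> M * indicator (ball 0 (\<bar>t - c\<bar> + 1)) (eps n *\<^sub>R z)"
        using M eps(1,2)[of n] by auto
      also have "\<dots> \<le> M * 1" using M(2) by (intro mult_left_mono) (auto simp: indicator_def)
      finally show "norm (?g n z) \<le> ?k z * M"
        by (simp add: abs_mult mult_left_mono)
    qed
  qed
  then show ?thesis
    unfolding scale kirchhoff_const_def by simp
qed

text \<open>The limit \<epsilon> -> 0 of \<open>hyperboloid_identity\<close>: the retarded potential
  for a function without past, as an integral over the cone projected to R^3.\<close>

lemma kirchhoff_formula:
  "kirchhoff_const * \<psi> (t, x) =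
     (\<integral>y. (\<psi>tt (t - norm y, x + y) - (\<Sum>i\<in>UNIV. \<psi>xx i (t - norm y, x + y) $ i)) / norm y \<partial>lborel)"
proof -
  let ?A = "\<lambda>n y. (eps n)\<^sup>2 * (\<psi>tt (hyp t x (eps n) y) / rho (eps n) y ^ 3
      + 3 * \<psi>t (hyp t x (eps n) y) / rho (eps n) y ^ 4)"
  let ?B = "\<lambda>n y. (eps n)\<^sup>2 * (3 * \<psi> (hyp t x (eps n) y) / rho (eps n) y ^ 5)"
  have A: "integrable lborel (?A n)" for n
    using integrable_hyp[OF cont(1) past(4) eps(1)[of n], where t=t and x=x and k=3] integrable_hyp[OF cont0(2) past(2) eps(1)[of n], where t=t and x=x and k=4]
    by (auto simp: times_divide_eq_right[symmetric] simp del: times_divide_eq_right)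
  have B: "integrable lborel (?B n)" for n
    using integrable_hyp[OF cont0(1) past(1) eps(1)[of n], where t=t and x=x and k=5]
    by (auto simp: times_divide_eq_right[symmetric] simp del: times_divide_eq_right)
  have "(\<integral>y. wave (hyp t x (eps n) y) / rho (eps n) y \<partial>lborel) = integral\<^sup>L lborel (?A n) + integral\<^sup>L lborel (?B n)" for n
    unfolding hyperboloid_identity[OF eps(1)] Bochner_Integration.integral_add[OF A B, symmetric]
    by (simp add: algebra_simps)
  then have "(\<lambda>n. integral\<^sup>L lborel (?A n) + integral\<^sup>L lborel (?B n))
      \<longlonglongrightarrow> (\<integral>y. wave (t - norm y, x + y) / norm y \<partial>lborel)"
    using limit_box[of t x] by simp
  moreover have "(\<lambda>n. integral\<^sup>L lborel (?A n) + integral\<^sup>L lborel (?B n)) \<longlonglongrightarrow> 0 + kirchhoff_const * \<psi> (t, x)"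
    by (intro tendsto_add limit_lower_order limit_main)
  ultimately show ?thesis
    unfolding wave_def by (auto dest: LIMSEQ_unique)
qed

end

subsection \<open>Energy flux through hyperboloids\<close>

lemma integral_cbox_directional_derivative_eq_0:
  fixes f f' :: "'a::euclidean_space \<Rightarrow> real"
  assumes "\<And>y. ((\<lambda>s. f (y + s *\<^sub>R b)) has_real_derivative f' y) (at 0)"
    and "continuous_on UNIV f" "continuous_on UNIV f'"
    and "\<And>y. norm y > R \<Longrightarrow> f y = 0"
  shows "integral (cbox (- R *\<^sub>R One) (R *\<^sub>R One)) f' = 0"
proof -
  note * = integral_directional_derivative_eq_0[OF assms]
  have "norm y > R" if "y \<notin> cbox (- R *\<^sub>R One) (R *\<^sub>R One)" for y :: 'a
    using that cball_subset_cbox_One[of R] by (force simp: not_le)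
  then show ?thesis
    using lebesgue_integral_eq_integral_cbox(2)[of f' "- R *\<^sub>R One" "R *\<^sub>R One"] * assms(3) by auto
qed

text \<open>The graphs of 1 + l (\<theta> - 1), for l from 0 to 1, deform the initial slice into the
  graph of \<theta>. The l-derivative of the flux density is (\<theta> - 1) times the spacetime
  divergence of the current, minus a spatial divergence that integrates to 0. Hence the flux does
  not increase with l.\<close>

lemma flux_monotone:
  fixes J0 J0t :: "real \<times> (real^3) \<Rightarrow> real" and J0x J Jt :: "real \<times> (real^3) \<Rightarrow> real^3"
    and Jx :: "3 \<Rightarrow> real \<times> (real^3) \<Rightarrow> real^3" and \<theta> :: "real^3 \<Rightarrow> real" and \<theta>' :: "real^3 \<Rightarrow> real^3"
  assumes d0: "\<And>z. z \<in> future \<Longrightarrow> has_gradient J0 (J0t z) (J0x z) (at z within future)"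
    and dJ: "\<And>z i. z \<in> future \<Longrightarrow> has_gradient (\<lambda>z. J z $ i) (Jt z $ i) (Jx i z) (at z within future)"
    and cont: "continuous_on future J0t" "continuous_on future Jt" "\<And>i. continuous_on future (Jx i)"
    and div: "\<And>z. fst z > 1 \<Longrightarrow> J0t z + (\<Sum>i\<in>UNIV. Jx i z $ i) \<le> 0"
    and \<theta>: "\<And>y. \<theta> y \<ge> 1" "continuous_on UNIV \<theta>" "continuous_on UNIV \<theta>'"
      "\<And>y i. ((\<lambda>s. \<theta> (y + s *\<^sub>R axis i 1)) has_real_derivative \<theta>' y $ i) (at 0)"
    and supp: "\<And>y \<tau>. norm y > R \<Longrightarrow> 1 \<le> \<tau> \<Longrightarrow> \<tau> \<le> \<theta> y \<Longrightarrow> \<theta> y = 1 \<or> J (\<tau>, y) = 0"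
  defines "B \<equiv> cbox (- R *\<^sub>R One) (R *\<^sub>R One :: real^3)"
  shows "integral B (\<lambda>y. J0 (\<theta> y, y) - \<theta>' y \<bullet> J (\<theta> y, y)) \<le> integral B (\<lambda>y. J0 (1, y))"
proof -
  define \<Theta> where "\<Theta> = (\<lambda>l y. 1 + l * (\<theta> y - 1))"
  define e where "e = (\<lambda>l y. J0 (\<Theta> l y, y) - l * (\<Sum>i\<in>UNIV. \<theta>' y $ i * J (\<Theta> l y, y) $ i))"
  define e' where "e' = (\<lambda>l y. J0t (\<Theta> l y, y) * (\<theta> y - 1) - (\<Sum>i\<in>UNIV. \<theta>' y $ i * J (\<Theta> l y, y) $ i)
      - l * (\<Sum>i\<in>UNIV. \<theta>' y $ i * (Jt (\<Theta> l y, y) $ i * (\<theta> y - 1))))"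
  \<comment> \<open>The current swept sideways while the graph moves; the sum of its partial
    derivatives \<open>F'\<close> is the spatial divergence to be discarded.\<close>
  define F where "F = (\<lambda>l i y. (\<theta> y - 1) * J (\<Theta> l y, y) $ i)"
  define F' where "F' = (\<lambda>l i y. \<theta>' y $ i * J (\<Theta> l y, y) $ i
      + (\<theta> y - 1) * (Jt (\<Theta> l y, y) $ i * (l * \<theta>' y $ i) + Jx i (\<Theta> l y, y) $ i))"
  have \<Theta>1: "\<Theta> l y \<ge> 1" if "l \<in> {0..1}" for l y
    using that \<theta>(1)[of y] unfolding \<Theta>_def by simp
  have fut: "(\<Theta> l y, y) \<in> future" if "l \<in> {0..1}" for l y
    using \<Theta>1[OF that] by simp
  have cJ: "continuous_on future J0" "continuous_on future (\<lambda>z. J z $ i)" for i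
    using d0 dJ unfolding has_gradient_def
    by (meson continuous_on_eq_continuous_within has_derivative_continuous)+
  have cJt: "continuous_on future (\<lambda>z. Jt z $ i)" "continuous_on future (\<lambda>z. Jx i z $ j)" for i j
    by (intro continuous_intros cont)+
  have cG: "continuous_on ({0..1} \<times> UNIV) (\<lambda>p. G (\<Theta> (fst p) (snd p), snd p))"
    if "continuous_on future G" for G :: "real \<times> (real^3) \<Rightarrow> real"
    using fut unfolding \<Theta>_def
    by (intro continuous_on_compose2[OF that] continuous_intros continuous_on_compose2[OF \<theta>(2)]) auto
  have c\<theta>: "continuous_on ({0..1::real} \<times> UNIV) (\<lambda>p. \<theta> (snd p))" "continuous_on ({0..1::real} \<times> UNIV) (\<lambda>p. \<theta>' (snd p))"
    by (intro continuous_on_compose2[OF \<theta>(2)] continuous_on_compose2[OF \<theta>(3)] continuous_intros; auto)+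
  have ce': "continuous_on ({0..1} \<times> UNIV) (\<lambda>p. e' (fst p) (snd p))"
    unfolding e'_def by (intro continuous_intros cG[OF cont(1)] cG[OF cJ(2)] cG[OF cJt(1)] c\<theta>)
  have ce: "continuous_on ({0..1} \<times> UNIV) (\<lambda>p. e (fst p) (snd p))"
    unfolding e_def by (intro continuous_intros cG[OF cJ(1)] cG[OF cJ(2)] c\<theta>)
  have cF: "continuous_on ({0..1} \<times> UNIV) (\<lambda>p. F (fst p) i (snd p))" for i
    unfolding F_def by (intro continuous_intros cG[OF cJ(2)] c\<theta>)
  have cF': "continuous_on ({0..1} \<times> UNIV) (\<lambda>p. F' (fst p) i (snd p))" for i
    unfolding F'_def by (intro continuous_intros cG[OF cJ(2)] cG[OF cJt(1)] cG[OF cJt(2)] c\<theta>)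
  have slice: "continuous_on UNIV (G l)" if "continuous_on ({0..1} \<times> UNIV) (\<lambda>p. G (fst p) (snd p))" "l \<in> {0..1}"
    for G :: "real \<Rightarrow> real^3 \<Rightarrow> real" and l
  proof -
    have "continuous_on UNIV (\<lambda>y. (\<lambda>p. G (fst p) (snd p)) (l, y))"
      by (rule continuous_on_compose2[OF that(1)]) (use that(2) in \<open>auto intro!: continuous_intros\<close>)
    then show ?thesis by simp
  qed
  have de: "((\<lambda>l. e l y) has_real_derivative e' l y) (at l within {0..1})" if l: "l \<in> {0..1}" for l y
  proof -
    have G: "((\<lambda>l. G (\<Theta> l y, y)) has_real_derivative a * (\<theta> y - 1)) (at l within {0..1})"
      if "has_gradient G a b (at (\<Theta> l y, y) within future)" for G a b
    proof -
      have "((\<lambda>l. G (\<Theta> l y, y)) has_real_derivative a * (\<theta> y - 1) + b \<bullet> 0) (at l within {0..1})"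
        by (rule has_gradient_along_curve[where S=future and \<xi>="\<lambda>_. y"])
          (use that fut in \<open>auto simp: \<Theta>_def intro!: derivative_eq_intros\<close>)
      then show ?thesis by simp
    qed
    show ?thesis
      unfolding e_def e'_def
      by (rule derivative_eq_intros G[OF d0] G[OF dJ] fut l refl | simp)+
        (simp add: algebra_simps sum.distrib sum_distrib_left)
  qed
  have dF: "((\<lambda>s. F l i (y + s *\<^sub>R axis i 1)) has_real_derivative F' l i y) (at 0)" if l: "l \<in> {0..1}" for l i y
  proof -
    let ?c = "\<lambda>s. (\<Theta> l (y + s *\<^sub>R axis i 1), y + s *\<^sub>R axis i 1)"
    have t: "((\<lambda>s. \<Theta> l (y + s *\<^sub>R axis i 1)) has_real_derivative l * \<theta>' y $ i) (at 0)"
      unfolding \<Theta>_def by (auto intro!: derivative_eq_intros \<theta>(4))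
    have "((\<lambda>s. J (?c s) $ i) has_real_derivative
        Jt (?c 0) $ i * (l * \<theta>' y $ i) + Jx i (?c 0) \<bullet> axis i 1) (at 0 within UNIV)"
      by (rule has_gradient_along_curve[where S=future, OF dJ[OF fut[OF l]] t _ fut[OF l]]) (auto intro!: derivative_eq_intros)
    then show ?thesis
      unfolding F_def F'_def
      by (auto intro!: derivative_eq_intros \<theta>(4) simp: inner_axis algebra_simps)
  qed
  have F0: "F l i y = 0" if "l \<in> {0..1}" "norm y > R" for l i y
  proof -
    have "\<Theta> l y \<le> 1 + 1 * (\<theta> y - 1)"
      unfolding \<Theta>_def using that(1) \<theta>(1)[of y] by (intro add_left_mono mult_right_mono) auto
    then show ?thesis using supp[OF that(2) \<Theta>1[OF that(1)], of y] unfolding F_def by auto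
  qed
  have intF: "integral B (F' l i) = 0" if l: "l \<in> {0..1}" for l i
    unfolding B_def
    by (rule integral_cbox_directional_derivative_eq_0[OF dF[OF l] slice[OF cF l] slice[OF cF' l] F0[OF l]])
  have iB: "G integrable_on B" if "continuous_on UNIV G" for G :: "real^3 \<Rightarrow> real"
    unfolding B_def using that by (intro integrable_continuous) (auto intro: continuous_on_subset)
  define g where "g = (\<lambda>l. integral B (e l))"
  have dg: "(g has_real_derivative integral B (e' l)) (at l within {0..1})" if "l \<in> {0..1}" for l
    unfolding g_def B_def
  proof (rule leibniz_rule_field_derivative[OF _ _ _ that])
    show "continuous_on ({0..1} \<times> cbox (- R *\<^sub>R One) (R *\<^sub>R One)) (\<lambda>(x, t). e' x t)"
      using ce' unfolding case_prod_beta by (auto intro: continuous_on_subset)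
  qed (use de iB[OF slice[OF ce]] in \<open>auto simp: B_def\<close>)
  have neg: "integral B (e' l) \<le> 0" if l: "0 < l" "l < 1" for l
  proof -
    have l': "l \<in> {0..1}" using l by simp
    have "integral B (e' l) = integral B (e' l) + (\<Sum>i\<in>UNIV. integral B (F' l i))"
      by (simp add: intF[OF l'])
    also have "\<dots> = integral B (e' l) + integral B (\<lambda>y. \<Sum>i\<in>UNIV. F' l i y)"
      by (subst integral_sum) (auto intro!: iB slice[OF cF' l'])
    also have "\<dots> = integral B (\<lambda>y. e' l y + (\<Sum>i\<in>UNIV. F' l i y))"
      by (intro Henstock_Kurzweil_Integration.integral_add[symmetric] integrable_sum iB slice[OF cF' l'] slice[OF ce' l']) auto
    also have "\<dots> \<le> integral B (\<lambda>y. 0)"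
    proof (rule integral_le)
      show "(\<lambda>y. e' l y + (\<Sum>i\<in>UNIV. F' l i y)) integrable_on B"
        by (intro integrable_add integrable_sum iB slice[OF cF' l'] slice[OF ce' l']) auto
      fix y
      have "e' l y + (\<Sum>i\<in>UNIV. F' l i y) = (\<theta> y - 1) * (J0t (\<Theta> l y, y) + (\<Sum>i\<in>UNIV. Jx i (\<Theta> l y, y) $ i))"
        unfolding e'_def F'_def by (simp add: sum_3 algebra_simps)
      also have "\<dots> \<le> 0"
      proof (cases "\<theta> y = 1")
        case False
        then have "\<theta> y > 1" using \<theta>(1)[of y] by simp
        then have "\<Theta> l y > 1" unfolding \<Theta>_def using l by simp
        with div[of "(\<Theta> l y, y)"] \<open>\<theta> y > 1\<close> show ?thesis by (simp add: mult_nonneg_nonpos)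
      qed simp
      finally show "e' l y + (\<Sum>i\<in>UNIV. F' l i y) \<le> 0" .
    qed (rule iB, simp)
    finally show ?thesis by simp
  qed
  have "g 1 \<le> g 0"
  \<comment> \<open>Only the open interval is used: at l = 0 the graph lies in the slice t = 1,
    where no sign of the divergence is assumed.\<close>
  proof (rule DERIV_nonpos_imp_decreasing_open[of 0 1])
    fix l :: real assume l: "0 < l" "l < 1"
    then have "at l within {0..1} = at l" by (intro at_within_interior) simp
    with dg[of l] neg[OF l] l show "\<exists>y. DERIV g l :> y \<and> y \<le> 0" by auto
  next
    show "continuous_on {0..1} g"
      using dg DERIV_continuous unfolding continuous_on_eq_continuous_within by blast
  qed auto
  then show ?thesis
    unfolding g_def e_def \<Theta>_def by (simp add: inner_vec_def)
qed

text \<open>A smooth version of \<open>max 1\<close>, equal to it outside the interval of radius \<open>\<eta>\<close> around \<open>1\<close>.\<close>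

definition soft_max :: "real \<Rightarrow> real \<Rightarrow> real" where
  "soft_max \<eta> z = 1 + ((max (z - (1 - \<eta>)) 0)\<^sup>2 - (max (z - (1 + \<eta>)) 0)\<^sup>2) / (4 * \<eta>)"

definition soft_max' :: "real \<Rightarrow> real \<Rightarrow> real" where
  "soft_max' \<eta> z = (max (z - (1 - \<eta>)) 0 - max (z - (1 + \<eta>)) 0) / (2 * \<eta>)"

text \<open>From the second power on, a truncated power is differentiable at its knot, where the
  difference quotient is the next lower truncated power. Both \<open>soft_max\<close> and the spline
  cutoff rest on this.\<close>

lemma DERIV_max0_power:
  "((\<lambda>z::real. max z 0 ^ Suc (Suc n)) has_real_derivative real (Suc (Suc n)) * max z 0 ^ Suc n) (at z)"
  for z :: real
proof (cases z "0::real" rule: linorder_cases)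
  case less
  have "((\<lambda>z::real. 0) has_real_derivative 0) (at z)" by simp
  then show ?thesis
    by (rule has_field_derivative_transform_within_open[where S="{..<0}" ,THEN DERIV_cong]) (use less in auto)
next
  case greater
  have "((\<lambda>z::real. z ^ Suc (Suc n)) has_real_derivative Suc (Suc n) * z ^ Suc n) (at z)"
    by (rule DERIV_cong[OF DERIV_pow]) simp
  then show ?thesis
    by (rule has_field_derivative_transform_within_open[where S="{0<..}", THEN DERIV_cong]) (use greater in auto)
next
  case equal
  have "((\<lambda>h. max h 0 ^ Suc (Suc n) / h) \<longlongrightarrow> 0) (at (0::real))"
  proof (rule tendsto_cong[THEN iffD1])
    have "((\<lambda>h. max h 0 ^ Suc n) \<longlongrightarrow> max 0 0 ^ Suc n) (at (0::real))"
      by (intro tendsto_intros)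
    then show "((\<lambda>h. max h 0 ^ Suc n) \<longlongrightarrow> 0) (at (0::real))" by simp
    show "\<forall>\<^sub>F h in at (0::real). max h 0 ^ Suc n = max h 0 ^ Suc (Suc n) / h"
      by (auto simp: eventually_at max_def intro!: exI[of _ 1])
  qed
  then show ?thesis using equal by (simp add: DERIV_def)
qed

lemma DERIV_soft_max: "\<eta> > 0 \<Longrightarrow> (soft_max \<eta> has_real_derivative soft_max' \<eta> z) (at z)"
proof -
  have sq: "((\<lambda>z. (max (z - a) 0)\<^sup>2) has_real_derivative 2 * max (z - a) 0) (at z)" for a z :: real
  proof -
    have "((\<lambda>z. z - a) has_real_derivative 1) (at z)" by (auto intro!: derivative_eq_intros)
    from DERIV_chain2[where f="\<lambda>z. max z 0 ^ Suc (Suc 0)" and g="\<lambda>z. z - a", OF DERIV_max0_power this]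
    show ?thesis by (simp add: numeral_2_eq_2)
  qed
  assume "\<eta> > 0"
  then show ?thesis
    unfolding soft_max_def[abs_def] soft_max'_def
    by (intro DERIV_cong[OF DERIV_add[OF DERIV_const DERIV_cdivide[OF DERIV_diff[OF sq sq]]]])
      (simp add: divide_simps)
qed

lemma soft_max'_bounds: "\<eta> > 0 \<Longrightarrow> 0 \<le> soft_max' \<eta> z" "\<eta> > 0 \<Longrightarrow> soft_max' \<eta> z \<le> 1"
  unfolding soft_max'_def by (auto simp: max_def divide_simps)

lemma soft_max_eq_1: "\<eta> > 0 \<Longrightarrow> z \<le> 1 - \<eta> \<Longrightarrow> soft_max \<eta> z = 1"
  "\<eta> > 0 \<Longrightarrow> z \<le> 1 - \<eta> \<Longrightarrow> soft_max' \<eta> z = 0"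
  unfolding soft_max_def soft_max'_def by (auto simp: max_def)

lemma soft_max_eq_id: "\<eta> > 0 \<Longrightarrow> z \<ge> 1 + \<eta> \<Longrightarrow> soft_max \<eta> z = z"
  "\<eta> > 0 \<Longrightarrow> z \<ge> 1 + \<eta> \<Longrightarrow> soft_max' \<eta> z = 1"
  unfolding soft_max_def soft_max'_def by (auto simp: max_def field_simps power2_eq_square)

lemma soft_max_ge_1: "\<eta> > 0 \<Longrightarrow> soft_max \<eta> z \<ge> 1"
  unfolding soft_max_def by (auto simp: max_def intro!: divide_nonneg_pos power_mono)

lemma soft_max_le: "\<eta> > 0 \<Longrightarrow> soft_max \<eta> z \<le> max 1 z + \<eta>"
proof -
  assume e: "\<eta> > 0"
  consider "z \<le> 1 - \<eta>" | "z \<ge> 1 + \<eta>" | "1 - \<eta> < z" "z < 1 + \<eta>" by linarith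
  then show ?thesis
  proof cases
    case 3
    have "(z - (1 - \<eta>))\<^sup>2 \<le> (2 * \<eta>)\<^sup>2" using 3 by (intro power_mono) auto
    then have "(z - (1 - \<eta>))\<^sup>2 / (4 * \<eta>) \<le> \<eta>" using e by (simp add: field_simps power2_eq_square)
    then show ?thesis using 3 unfolding soft_max_def by simp
  qed (use e soft_max_eq_1(1)[OF e] soft_max_eq_id(1)[OF e] in auto)
qed

lemma continuous_on_soft_max:
  "\<eta> > 0 \<Longrightarrow> continuous_on S (soft_max \<eta>)" "\<eta> > 0 \<Longrightarrow> continuous_on S (soft_max' \<eta>)"
  unfolding soft_max_def[abs_def] soft_max'_def[abs_def] by (intro continuous_intros; simp)+

text \<open>\<open>flux_monotone\<close> for a backward hyperboloid centred at (t0, x0) that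
  \<open>soft_max\<close> bends into the slice t = 1. The smoothing keeps the graph C^1 where the
  two surfaces meet, and |\<xi>| <= 1 says that it is nowhere timelike, as the dominant energy
  condition requires.\<close>

lemma hyperboloid_flux:
  fixes J0 J0t :: "real \<times> (real^3) \<Rightarrow> real" and J0x J Jt :: "real \<times> (real^3) \<Rightarrow> real^3"
    and Jx :: "3 \<Rightarrow> real \<times> (real^3) \<Rightarrow> real^3" and x0 :: "real^3" and t0 :: real
  assumes d0: "\<And>z. z \<in> future \<Longrightarrow> has_gradient J0 (J0t z) (J0x z) (at z within future)"
    and dJ: "\<And>z i. z \<in> future \<Longrightarrow> has_gradient (\<lambda>z. J z $ i) (Jt z $ i) (Jx i z) (at z within future)"
    and cont: "continuous_on future J0t" "continuous_on future Jt" "\<And>i. continuous_on future (Jx i)"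
    and div: "\<And>z. fst z > 1 \<Longrightarrow> J0t z + (\<Sum>i\<in>UNIV. Jx i z $ i) \<le> 0"
    and pos: "\<epsilon> > 0" "\<eta> > 0"
  defines "\<rho> \<equiv> \<lambda>y. sqrt ((norm (y - x0))\<^sup>2 + \<epsilon>\<^sup>2)"
  defines "\<theta> \<equiv> \<lambda>y. soft_max \<eta> (t0 - \<rho> y)"
  defines "\<xi> \<equiv> \<lambda>y. (soft_max' \<eta> (t0 - \<rho> y) / \<rho> y) *\<^sub>R (y - x0)"
  assumes supp: "\<And>y \<tau>. norm y > R \<Longrightarrow> 1 \<le> \<tau> \<Longrightarrow> \<tau> \<le> \<theta> y \<Longrightarrow> \<theta> y = 1 \<or> J (\<tau>, y) = 0"
  defines "B \<equiv> cbox (- R *\<^sub>R One) (R *\<^sub>R One :: real^3)"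
  shows "continuous_on UNIV (\<lambda>y. J0 (\<theta> y, y) + \<xi> y \<bullet> J (\<theta> y, y))"
    and "norm (\<xi> y) \<le> 1"
    and "integral B (\<lambda>y. J0 (\<theta> y, y) + \<xi> y \<bullet> J (\<theta> y, y)) \<le> integral B (\<lambda>y. J0 (1, y))"
proof -
  have r: "\<rho> y > 0" "\<rho> y \<ge> norm (y - x0)" for y
    unfolding \<rho>_def using pos by (auto intro!: real_le_rsqrt simp: add_nonneg_pos)
  have c\<rho>: "continuous_on UNIV \<rho>" unfolding \<rho>_def by (intro continuous_intros)
  have c\<theta>: "continuous_on UNIV \<theta>"
    unfolding \<theta>_def by (intro continuous_intros continuous_on_compose2[OF continuous_on_soft_max(1)[OF pos(2)]] c\<rho>) auto
  have c\<xi>: "continuous_on UNIV \<xi>"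
    unfolding \<xi>_def using r(1)
    by (intro continuous_intros continuous_on_compose2[OF continuous_on_soft_max(2)[OF pos(2)]] c\<rho>)
      (auto simp: less_imp_neq[THEN not_sym])
  have fut: "(\<theta> y, y) \<in> future" for y unfolding \<theta>_def using soft_max_ge_1[OF pos(2)] by simp
  have cJ: "continuous_on future J0" "continuous_on future (\<lambda>z. J z $ i)" for i
    using d0 dJ unfolding has_gradient_def
    by (meson continuous_on_eq_continuous_within has_derivative_continuous)+
  have "continuous_on UNIV (\<lambda>y. J0 (\<theta> y, y))" "continuous_on UNIV (\<lambda>y. J (\<theta> y, y) $ i)" for i
    using fut by (intro continuous_on_compose2[OF cJ(1)] continuous_on_compose2[OF cJ(2)] continuous_intros c\<theta>; auto)+
  then show "continuous_on UNIV (\<lambda>y. J0 (\<theta> y, y) + \<xi> y \<bullet> J (\<theta> y, y))"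
    unfolding inner_vec_def inner_real_def
    by (intro continuous_on_add continuous_on_sum continuous_on_mult) (auto intro: continuous_on_component[OF c\<xi>])
  have "norm (\<xi> y) = soft_max' \<eta> (t0 - \<rho> y) * (norm (y - x0) / \<rho> y)"
    unfolding \<xi>_def using r(1)[of y] soft_max'_bounds(1)[OF pos(2)] by simp
  also have "\<dots> \<le> 1 * 1"
    using r[of y] soft_max'_bounds[OF pos(2)] by (intro mult_mono) (auto simp: divide_simps)
  finally show "norm (\<xi> y) \<le> 1" by simp
  have d\<theta>: "((\<lambda>s. \<theta> (y + s *\<^sub>R axis i 1)) has_real_derivative (- \<xi> y) $ i) (at 0)" for y i
  proof -
    have eq: "\<rho> (y + s *\<^sub>R axis i 1) = sqrt ((norm (y - x0))\<^sup>2 + 2 * s * (y - x0) $ i + s\<^sup>2 + \<epsilon>\<^sup>2)" for s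
      unfolding \<rho>_def power2_norm_eq_inner
      by (simp add: inner_add_left inner_add_right inner_diff_left inner_diff_right inner_axis
        inner_commute[of "axis i 1"] power2_eq_square algebra_simps)
    have "(norm (y - x0))\<^sup>2 + \<epsilon>\<^sup>2 > 0" using pos by (simp add: add_nonneg_pos)
    then have "((\<lambda>s. \<rho> (y + s *\<^sub>R axis i 1)) has_real_derivative (y - x0) $ i / \<rho> y) (at 0)"
      unfolding eq by (auto intro!: derivative_eq_intros simp: \<rho>_def add.commute divide_simps)
    then have "((\<lambda>s. t0 - \<rho> (y + s *\<^sub>R axis i 1)) has_real_derivative - ((y - x0) $ i / \<rho> y)) (at 0)"
      by (auto intro!: derivative_eq_intros)
    from DERIV_chain2[OF DERIV_soft_max[OF pos(2)] this]
    show ?thesis unfolding \<theta>_def \<xi>_def by simp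
  qed
  have "integral B (\<lambda>y. J0 (\<theta> y, y) - (- \<xi> y) \<bullet> J (\<theta> y, y)) \<le> integral B (\<lambda>y. J0 (1, y))"
    unfolding B_def
    by (rule flux_monotone[OF d0 dJ cont div, where \<theta>'="\<lambda>y. - \<xi> y"])
      (use fut c\<theta> c\<xi> d\<theta> supp in \<open>auto intro!: continuous_intros\<close>)
  then show "integral B (\<lambda>y. J0 (\<theta> y, y) + \<xi> y \<bullet> J (\<theta> y, y)) \<le> integral B (\<lambda>y. J0 (1, y))"
    by simp
qed

subsection \<open>Conformal geometry of backward null cones\<close>

text \<open>The push-forward of |det g'| dy from \<open>S\<close> under an injective map is at most
  Lebesgue measure. For upper bounds the inequality suffices, so the image of \<open>S\<close> never
  has to be described.\<close>

lemma nn_integral_change_of_variables_le: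
  fixes g :: "real^'n::{finite,wellorder} \<Rightarrow> real^'n::_" and w :: "real^'n::_ \<Rightarrow> real" and f :: "real^'n::_ \<Rightarrow> ennreal"
  assumes S: "S \<in> sets borel"
    and der: "\<And>y. y \<in> S \<Longrightarrow> (g has_derivative g' y) (at y)"
    and inj: "inj_on g S"
    and w: "\<And>y. y \<in> S \<Longrightarrow> w y = \<bar>det (matrix (g' y))\<bar>"
    and meas: "g \<in> borel_measurable borel" "w \<in> borel_measurable borel" "f \<in> borel_measurable borel"
  shows "(\<integral>\<^sup>+y. f (g y) * (ennreal (w y) * indicator S y) \<partial>lborel) \<le> (\<integral>\<^sup>+z. f z \<partial>lborel)"
proof -
  note [measurable] = meas S
  let ?M = "distr (density lborel (\<lambda>y. ennreal (w y) * indicator S y)) lborel g"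
  have "?M \<le> lborel"
  proof (subst le_measure)
    show "\<forall>B\<in>sets ?M. emeasure ?M B \<le> emeasure lborel B"
    proof
      fix B assume "B \<in> sets ?M"
      then have B[measurable]: "B \<in> sets borel" by simp
      define T where "T = S \<inter> g -` B"
      have T: "T \<in> sets borel"
        using measurable_sets[OF meas(1) B] unfolding T_def by (auto intro: sets.Int S)
      show "emeasure ?M B \<le> emeasure lborel B"
      \<comment> \<open>Sets of infinite measure are trivial; otherwise the image formula for
        differentiable injective maps applies to the part \<open>T\<close> of \<open>S\<close> that
        is mapped into \<open>B\<close>.\<close>
      proof (cases "emeasure lborel B = \<infinity>")
        case False
        have Tl: "T \<in> sets lebesgue" using T by simp
        have dT: "(g has_derivative g' y) (at y within T)" if "y \<in> T" for y
          using der that unfolding T_def by (auto intro: has_derivative_at_withinI)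
        have iT: "inj_on g T" using inj unfolding T_def by (rule inj_on_subset) auto
        have gT: "g ` T \<in> sets lebesgue"
          by (rule differentiable_image_in_sets_lebesgue[OF Tl])
            (use dT in \<open>auto simp: differentiable_on_def differentiable_def\<close>)
        have fB: "B \<in> lmeasurable"
          using False by (auto simp: fmeasurable_def less_top)
        have gB: "g ` T \<subseteq> B" unfolding T_def by auto
        have gTm: "g ` T \<in> lmeasurable" by (rule fmeasurableI2[OF fB gB gT])
        then have hi: "((\<lambda>y. \<bar>det (matrix (g' y))\<bar>) has_integral measure lebesgue (g ` T)) T"
          using has_measure_differentiable_image[OF Tl dT iT] by blast
        have "emeasure ?M B = (\<integral>\<^sup>+y. ennreal (w y) * indicator S y * indicator (g -` B) y \<partial>lborel)"
          using measurable_sets[OF meas(1) B] by (simp add: emeasure_distr emeasure_density)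
        also have "\<dots> = (\<integral>\<^sup>+y. ennreal \<bar>det (matrix (g' y))\<bar> * indicator T y \<partial>lborel)"
          by (rule nn_integral_cong) (auto simp: T_def indicator_def w)
        also have "\<dots> = ennreal (measure lebesgue (g ` T))"
          by (rule nn_integral_has_integral_lebesgue'[OF _ hi]) simp
        also have "\<dots> \<le> ennreal (measure lebesgue B)"
          using measure_mono_fmeasurable[OF gB gT fB] by (simp add: ennreal_leI)
        also have "\<dots> = emeasure lborel B"
          using emeasure_eq_measure2[OF fB] emeasure_completion[of B lborel] B by simp
        finally show ?thesis .
      qed simp
    qed
  qed simp
  then have "(\<integral>\<^sup>+z. f z \<partial>?M) \<le> (\<integral>\<^sup>+z. f z \<partial>lborel)"
    by (intro nn_integral_mono_measure) auto
  also have "(\<integral>\<^sup>+z. f z \<partial>?M) = (\<integral>\<^sup>+y. (ennreal (w y) * indicator S y) * f (g y) \<partial>lborel)"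
    by (simp add: nn_integral_distr nn_integral_density)
  finally show ?thesis by (simp add: mult.commute)
qed

text \<open>The matrix determinant lemma for a I - c b^T in dimension three.\<close>

lemma det_scalar_minus_rank_one:
  fixes A :: "real^3^3"
  assumes A: "\<And>i j. A $ i $ j = (if i = j then a else 0) - c $ i * b $ j"
  shows "det A = a ^ 3 - a\<^sup>2 * (b \<bullet> c)"
proof -
  have "det A = (a - c$1 * b$1) * (a - c$2 * b$2) * (a - c$3 * b$3)
     + (c$1 * b$2) * (c$2 * b$3) * - (c$3 * b$1) + (c$1 * b$3) * (c$2 * b$1) * - (c$3 * b$2)
     - (a - c$1 * b$1) * (c$2 * b$3) * (c$3 * b$2) - (c$1 * b$2) * (c$2 * b$1) * (a - c$3 * b$3)
     - (c$1 * b$3) * (a - c$2 * b$2) * (c$3 * b$1)"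
    unfolding det_3 A by simp
  also have "\<dots> = a ^ 3 - a\<^sup>2 * (b$1 * c$1 + b$2 * c$2 + b$3 * c$3)"
    by algebra
  finally show ?thesis by (simp add: inner_vec_def sum_3)
qed

section \<open>Inversion restricted to a backward null cone\<close>

definition mink :: "real \<Rightarrow> real^3 \<Rightarrow> real" where
  "mink t x = t\<^sup>2 - (norm x)\<^sup>2"

text \<open>Retarded time: the backward cone of (t, x) is the graph of
  \<open>ret t x\<close>.\<close>

definition ret :: "real \<Rightarrow> real^3 \<Rightarrow> real^3 \<Rightarrow> real" where
  "ret t x y = t - norm (y - x)"

text \<open>The conformal Killing field \<open>(t\<^sup>2 + \<bar>x\<bar>\<^sup>2) \<partial>\<^sub>t + 2 t x \<cdot> \<partial>\<^sub>x\<close> paired with the normal of the backward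
  null cone of \<open>(t, x)\<close>.\<close>

definition cone_wt :: "real \<Rightarrow> real^3 \<Rightarrow> real^3 \<Rightarrow> real" where
  "cone_wt t x y = (ret t x y)\<^sup>2 + (norm y)\<^sup>2 - 2 * ret t x y * (y \<bullet> (x - y)) / norm (x - y)"

text \<open>The part of the cone inside the forward light cone of the origin, where the inversion is
  regular. The vertex is removed because \<open>ret\<close> is not differentiable there.\<close>

definition cone_dom :: "real \<Rightarrow> real^3 \<Rightarrow> (real^3) set" where
  "cone_dom t x = {y. y \<noteq> x \<and> norm y < ret t x y}"

text \<open>The Euclidean distance between \<open>x\<close> and \<open>y\<close> after the conformal inversion
  \<open>(t, x) \<mapsto> (t, x) / (t\<^sup>2 - \<bar>x\<bar>\<^sup>2)\<close>.\<close>

definition conf_dist :: "real \<Rightarrow> real^3 \<Rightarrow> real^3 \<Rightarrow> real" where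
  "conf_dist t x y = norm (y - x) * cone_wt t x y / (mink t x * mink (ret t x y) y)"

lemma measurable_cone [measurable]:
  "ret t x \<in> borel_measurable borel" "(\<lambda>y. mink (ret t x y) y) \<in> borel_measurable borel"
  "cone_wt t x \<in> borel_measurable borel" "conf_dist t x \<in> borel_measurable borel"
  "cone_dom t x \<in> sets borel"
proof -
  show [measurable]: "ret t x \<in> borel_measurable borel" unfolding ret_def[abs_def] by measurable
  then show [measurable]: "(\<lambda>y. mink (ret t x y) y) \<in> borel_measurable borel" unfolding mink_def by measurable
  show [measurable]: "cone_wt t x \<in> borel_measurable borel" unfolding cone_wt_def[abs_def] by measurable
  show "conf_dist t x \<in> borel_measurable borel" unfolding conf_dist_def[abs_def] by measurable
  show "cone_dom t x \<in> sets borel" unfolding cone_dom_def by measurable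
qed

lemma mink_pos: "norm x < t \<Longrightarrow> mink t x > 0"
  unfolding mink_def by (simp add: power_strict_mono)

lemma cone_dom_imp_norm_less: "y \<in> cone_dom t x \<Longrightarrow> norm x < t"
  unfolding cone_dom_def ret_def using norm_triangle_ineq[of y "x - y"] by (auto simp: norm_minus_commute)

text \<open>By Cauchy-Schwarz the weight is at least (ret - |y|)^2.\<close>

lemma cone_wt_pos:
  assumes "y \<in> cone_dom t x" shows "cone_wt t x y > 0"
proof -
  have y: "norm (x - y) > 0" "norm y < ret t x y" using assms unfolding cone_dom_def by auto
  have "y \<bullet> (x - y) / norm (x - y) \<le> norm y"
    using norm_cauchy_schwarz[of y "x - y"] y(1) by (simp add: divide_simps)
  then have "2 * ret t x y * (y \<bullet> (x - y) / norm (x - y)) \<le> 2 * ret t x y * norm y"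
    using y norm_ge_zero[of y] by (intro mult_left_mono) linarith+
  then have "(ret t x y - norm y)\<^sup>2 \<le> cone_wt t x y"
    unfolding cone_wt_def by (simp add: power2_diff)
  moreover have "(ret t x y - norm y)\<^sup>2 > 0" using y by simp
  ultimately show ?thesis by linarith
qed

lemma conf_dist_pos:
  assumes "y \<in> cone_dom t x" shows "conf_dist t x y > 0"
proof -
  have "norm (y - x) > 0" "mink (ret t x y) y > 0" using assms unfolding cone_dom_def by (auto intro: mink_pos)
  with cone_wt_pos[OF assms] mink_pos[OF cone_dom_imp_norm_less[OF assms]] show ?thesis
    unfolding conf_dist_def by simp
qed

text \<open>The inversion preserves null separation, so the spatial distance of two images on a cone
  is their time difference. It has this sign because the inversion reverses time.\<close>

lemma conf_dist_eq_time_difference: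
  assumes "y \<in> cone_dom t x"
  shows "conf_dist t x y = ret t x y / mink (ret t x y) y - t / mink t x"
proof -
  let ?\<tau> = "ret t x y" and ?s = "mink (ret t x y) y" and ?r = "norm (x - y)"
  have r: "?r > 0" and s: "?s > 0" and P: "mink t x > 0"
    using assms cone_dom_imp_norm_less[OF assms] unfolding cone_dom_def by (auto intro: mink_pos)
  have t: "t = ?\<tau> + ?r" unfolding ret_def by (simp add: norm_minus_commute)
  have "(norm x)\<^sup>2 = (norm y)\<^sup>2 + 2 * (y \<bullet> (x - y)) + ?r\<^sup>2"
    unfolding power2_norm_eq_inner by (simp add: inner_diff_left inner_diff_right inner_commute algebra_simps)
  moreover have "t\<^sup>2 = (?\<tau> + ?r)\<^sup>2" by (rule arg_cong[OF t])
  ultimately have mP: "mink t x = ?\<tau>\<^sup>2 + 2 * ?\<tau> * ?r - (norm y)\<^sup>2 - 2 * (y \<bullet> (x - y))"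
    unfolding mink_def by (simp add: power2_sum)
  have W: "?r * cone_wt t x y = ?r * (?\<tau>\<^sup>2 + (norm y)\<^sup>2) - 2 * ?\<tau> * (y \<bullet> (x - y))"
    unfolding cone_wt_def using r by (simp add: field_simps)
  have "?\<tau> * mink t x - (?\<tau> + ?r) * ?s = ?r * cone_wt t x y"
    unfolding mP W unfolding mink_def by (simp add: algebra_simps power2_eq_square)
  then have "?\<tau> * mink t x - t * ?s = norm (y - x) * cone_wt t x y"
    unfolding t[symmetric] by (simp only: norm_minus_commute)
  then show ?thesis
    unfolding conf_dist_def using s P by (simp add: divide_simps mult.commute)
qed

text \<open>Given \<open>conf_dist_eq_time_difference\<close>, it remains to see that the images are
  null separated, which comes from (t - ret)^2 = |y - x|^2.\<close>

lemma norm_inversion_diff: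
  assumes "y \<in> cone_dom t x"
  shows "norm (y /\<^sub>R mink (ret t x y) y - x /\<^sub>R mink t x) = conf_dist t x y"
proof (rule power2_eq_imp_eq)
  let ?\<tau> = "ret t x y" and ?s = "mink (ret t x y) y" and ?p = "mink t x"
  have s: "?s > 0" and P: "?p > 0"
    using assms cone_dom_imp_norm_less[OF assms] unfolding cone_dom_def by (auto intro: mink_pos)
  have "(t - ?\<tau>)\<^sup>2 = (norm (y - x))\<^sup>2" unfolding ret_def by simp
  then have yx: "2 * (y \<bullet> x) = 2 * t * ?\<tau> - ?p - ?s"
    unfolding mink_def power2_norm_eq_inner
    by (simp add: inner_diff_left inner_diff_right inner_commute algebra_simps power2_eq_square)
  have "(norm (y /\<^sub>R ?s - x /\<^sub>R ?p))\<^sup>2 = (norm y)\<^sup>2 / ?s\<^sup>2 - 2 * (y \<bullet> x) / (?s * ?p) + (norm x)\<^sup>2 / ?p\<^sup>2"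
    unfolding power2_norm_eq_inner
    using s P by (simp add: inner_diff_left inner_diff_right inner_commute divide_simps power2_eq_square)
      (simp add: algebra_simps)
  also have "\<dots> = (?\<tau>\<^sup>2 - ?s) / ?s\<^sup>2 - (2 * t * ?\<tau> - ?p - ?s) / (?s * ?p) + (t\<^sup>2 - ?p) / ?p\<^sup>2"
    unfolding yx by (simp add: mink_def)
  also have "\<dots> = (?\<tau> / ?s - t / ?p)\<^sup>2"
    using s P by (simp add: divide_simps) (simp add: algebra_simps power2_eq_square)
  finally show "(norm (y /\<^sub>R ?s - x /\<^sub>R ?p))\<^sup>2 = (conf_dist t x y)\<^sup>2"
    unfolding conf_dist_eq_time_difference[OF assms] .
qed (use conf_dist_pos[OF assms] in auto)

text \<open>The image of y determines its distance to the image of x, hence the inverted time, hence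
  1/s as the Lorentz square of the image, where s is that of y, and hence y itself.\<close>

lemma inj_on_inversion: "inj_on (\<lambda>y. y /\<^sub>R mink (ret t x y) y) (cone_dom t x)"
proof (rule inj_onI)
  fix y y' assume y: "y \<in> cone_dom t x" "y' \<in> cone_dom t x"
    and eq: "y /\<^sub>R mink (ret t x y) y = y' /\<^sub>R mink (ret t x y') y'"
  let ?T = "\<lambda>y. ret t x y / mink (ret t x y) y" and ?Y = "\<lambda>y. y /\<^sub>R mink (ret t x y) y"
  have "?T y = ?T y'"
    using norm_inversion_diff[OF y(1)] norm_inversion_diff[OF y(2)]
    unfolding eq conf_dist_eq_time_difference[OF y(1)] conf_dist_eq_time_difference[OF y(2)] by simp
  moreover have inv: "1 / mink (ret t x y) y = (?T y)\<^sup>2 - (norm (?Y y))\<^sup>2" and s: "mink (ret t x y) y > 0"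
    if "y \<in> cone_dom t x" for y
  proof -
    show s: "mink (ret t x y) y > 0" using that unfolding cone_dom_def by (auto intro: mink_pos)
    have "(?T y)\<^sup>2 - (norm (?Y y))\<^sup>2 = mink (ret t x y) y / (mink (ret t x y) y)\<^sup>2"
      using s by (simp add: power_divide power_mult_distrib divide_inverse power_inverse)
        (simp add: mink_def algebra_simps)
    then show "1 / mink (ret t x y) y = (?T y)\<^sup>2 - (norm (?Y y))\<^sup>2"
      using s by (simp add: power2_eq_square)
  qed
  ultimately have "1 / mink (ret t x y) y = 1 / mink (ret t x y') y'"
    by (simp only: inv[OF y(1)] inv[OF y(2)] eq)
  then have "mink (ret t x y) y = mink (ret t x y') y'" by simp
  with eq s[OF y(1)] show "y = y'" by simp
qed

text \<open>Change of variables to inverted coordinates. With s the Lorentz square on the cone, the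
  Jacobian matrix of y -> y/s is 1/s times the identity plus a rank-one matrix, with determinant
  \<open>cone_wt\<close>/s^4. Functions of \<open>conf_dist\<close> become radial about the image of
  x.\<close>

lemma nn_integral_conf_dist_le:
  assumes f[measurable]: "f \<in> borel_measurable borel"
  shows "(\<integral>\<^sup>+y. f (conf_dist t x y) * (ennreal (cone_wt t x y / mink (ret t x y) y ^ 4) * indicator (cone_dom t x) y) \<partial>lborel)
    \<le> (\<integral>\<^sup>+z. f (norm (z::real^3)) \<partial>lborel)"
proof -
  let ?\<tau> = "ret t x" and ?s = "\<lambda>y. mink (ret t x y) y"
  let ?v = "\<lambda>y. (2 * ?\<tau> y / norm (x - y)) *\<^sub>R (x - y) - 2 *\<^sub>R y"
  let ?g' = "\<lambda>y h. h /\<^sub>R ?s y - ((?v y \<bullet> h) / (?s y)\<^sup>2) *\<^sub>R y"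
  have s: "?s y > 0" if "y \<in> cone_dom t x" for y
    using that unfolding cone_dom_def by (auto intro: mink_pos)
  have der: "((\<lambda>y. y /\<^sub>R ?s y) has_derivative ?g' y) (at y)" if y: "y \<in> cone_dom t x" for y
  proof -
    have "y - x \<noteq> 0" using y unfolding cone_dom_def by auto
    then have d\<tau>: "(?\<tau> has_derivative (\<lambda>h. ((x - y) \<bullet> h) / norm (x - y))) (at y)"
    proof -
      have "((\<lambda>y. y - x) has_derivative (\<lambda>h. h)) (at y)"
        by (auto intro!: derivative_eq_intros)
      from has_derivative_compose[OF this has_derivative_norm[OF \<open>y - x \<noteq> 0\<close>]]
      have "((\<lambda>y. t - norm (y - x)) has_derivative (\<lambda>h. 0 - h \<bullet> sgn (y - x))) (at y)"
        by (intro has_derivative_diff has_derivative_const)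
      moreover have "(\<lambda>h. 0 - h \<bullet> sgn (y - x)) = (\<lambda>h. ((x - y) \<bullet> h) / norm (x - y))"
        by (simp add: fun_eq_iff sgn_div_norm inner_diff_left inner_diff_right inner_commute norm_minus_commute[of y x]
          divide_inverse algebra_simps)
      ultimately show ?thesis unfolding ret_def[abs_def] by simp
    qed
    have ds: "(?s has_derivative (\<lambda>h. ?v y \<bullet> h)) (at y)"
      unfolding mink_def power2_norm_eq_inner
      by (auto intro!: derivative_eq_intros d\<tau> simp: fun_eq_iff inner_diff_left inner_commute power2_eq_square algebra_simps add_divide_distrib diff_divide_distrib)
    have "((\<lambda>y. inverse (?s y)) has_derivative (\<lambda>h. - (inverse (?s y) * (?v y \<bullet> h) * inverse (?s y)))) (at y)"
      by (rule Deriv.has_derivative_inverse[OF _ ds]) (use s[OF y] in simp)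
    from has_derivative_scaleR[OF this has_derivative_ident]
    show ?thesis
      by (rule has_derivative_eq_rhs) (simp add: fun_eq_iff power2_eq_square divide_inverse mult_ac)
  qed
  have w: "cone_wt t x y / ?s y ^ 4 = \<bar>det (matrix (?g' y))\<bar>" if y: "y \<in> cone_dom t x" for y
  proof -
    define q where "q = inverse (?s y)"
    define v where "v = ?v y"
    have "det (matrix (?g' y)) = q ^ 3 - q\<^sup>2 * ((q\<^sup>2 *\<^sub>R v) \<bullet> y)"
    proof (rule det_scalar_minus_rank_one)
      show "matrix (?g' y) $ i $ j = (if i = j then q else 0) - y $ i * (q\<^sup>2 *\<^sub>R v) $ j" for i j
      proof -
        have e: "axis j (1::real) $ i = (if i = j then 1 else 0)" by (simp add: axis_def)
        show ?thesis
          unfolding matrix_def v_def[symmetric] q_def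
          by (simp add: e inner_axis divide_inverse power_inverse)
      qed
    qed
    also have "\<dots> = (?s y * q) * q ^ 3 - q ^ 4 * (v \<bullet> y)"
      using s[OF y] by (simp add: q_def mult.assoc[symmetric] power_add[symmetric])
    also have "\<dots> = (?s y - v \<bullet> y) * q ^ 4"
      by algebra
    also have "?s y - v \<bullet> y = cone_wt t x y"
      unfolding v_def cone_wt_def mink_def power2_norm_eq_inner
      by (simp add: inner_diff_left inner_diff_right inner_commute algebra_simps add_divide_distrib diff_divide_distrib)
    finally have "det (matrix (?g' y)) = cone_wt t x y / ?s y ^ 4"
      unfolding q_def by (simp add: divide_inverse power_inverse)
    then show ?thesis using cone_wt_pos[OF y] s[OF y] by simp
  qed
  have meas: "(\<lambda>y. y /\<^sub>R ?s y) \<in> borel_measurable borel" "(\<lambda>y. cone_wt t x y / ?s y ^ 4) \<in> borel_measurable borel"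
    by measurable
  have fm: "(\<lambda>z. f (norm (z - x /\<^sub>R mink t x))) \<in> borel_measurable borel" by measurable
  have "(\<integral>\<^sup>+y. f (conf_dist t x y) * (ennreal (cone_wt t x y / ?s y ^ 4) * indicator (cone_dom t x) y) \<partial>lborel)
    = (\<integral>\<^sup>+y. f (norm (y /\<^sub>R ?s y - x /\<^sub>R mink t x)) * (ennreal (cone_wt t x y / ?s y ^ 4) * indicator (cone_dom t x) y) \<partial>lborel)"
    by (rule nn_integral_cong) (auto simp: indicator_def norm_inversion_diff)
  also have "\<dots> \<le> (\<integral>\<^sup>+z. f (norm (z - x /\<^sub>R mink t x)) \<partial>lborel)"
    by (rule nn_integral_change_of_variables_le[OF measurable_cone(5) der inj_on_inversion w meas fm])
  also have "\<dots> = (\<integral>\<^sup>+z. f (norm (- (x /\<^sub>R mink t x) + z)) \<partial>lborel)" by simp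
  also have "\<dots> = (\<integral>\<^sup>+z. f (norm z) \<partial>distr lborel borel ((+) (- (x /\<^sub>R mink t x))))"
    by (rule nn_integral_distr[symmetric]) measurable
  also have "\<dots> = (\<integral>\<^sup>+z. f (norm (z::real^3)) \<partial>lborel)" unfolding lborel_distr_plus ..
  finally show ?thesis .
qed

subsection \<open>Gradients and the conformal current\<close>

named_theorems has_gradient_intros

lemma has_gradient_eq:
  "has_gradient f a b F \<Longrightarrow> a = a' \<Longrightarrow> b = b' \<Longrightarrow> has_gradient f a' b' F"
  by simp

lemma has_gradient_const [has_gradient_intros]: "has_gradient (\<lambda>_. c) 0 0 F"
  unfolding has_gradient_def by simp

lemma has_gradient_fst [has_gradient_intros]: "has_gradient fst 1 0 (at z within S)"
  unfolding has_gradient_def by (auto intro!: derivative_eq_intros)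

lemma has_gradient_snd_nth [has_gradient_intros]:
  "has_gradient (\<lambda>z::real \<times> (real^'n). snd z $ i) 0 (axis i 1) (at z within S)"
  unfolding has_gradient_def
  by (auto intro!: derivative_eq_intros bounded_linear.has_derivative[OF bounded_linear_vec_nth] simp: inner_axis')

lemma has_gradient_add [has_gradient_intros]:
  "has_gradient f a b F \<Longrightarrow> has_gradient g c d F \<Longrightarrow> has_gradient (\<lambda>z. f z + g z) (a + c) (b + d) F"
  unfolding has_gradient_def
  by (drule (1) has_derivative_add) (simp add: algebra_simps)

lemma has_gradient_diff [has_gradient_intros]:
  "has_gradient f a b F \<Longrightarrow> has_gradient g c d F \<Longrightarrow> has_gradient (\<lambda>z. f z - g z) (a - c) (b - d) F"
  unfolding has_gradient_def
  by (drule (1) has_derivative_diff) (simp add: algebra_simps)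

lemma has_gradient_minus [has_gradient_intros]:
  "has_gradient f a b F \<Longrightarrow> has_gradient (\<lambda>z. - f z) (- a) (- b) F"
  unfolding has_gradient_def
  by (drule has_derivative_minus) (simp add: algebra_simps)

lemma has_gradient_mult [has_gradient_intros]:
  "has_gradient f a b (at z within S) \<Longrightarrow> has_gradient g c d (at z within S) \<Longrightarrow>
    has_gradient (\<lambda>z. f z * g z) (a * g z + f z * c) (g z *\<^sub>R b + f z *\<^sub>R d) (at z within S)"
  unfolding has_gradient_def
  by (drule (1) has_derivative_mult) (simp add: algebra_simps)

lemma has_gradient_sum [has_gradient_intros]:
  assumes "\<And>i. i \<in> I \<Longrightarrow> has_gradient (f i) (a i) (b i) F"
  shows "has_gradient (\<lambda>z. \<Sum>i\<in>I. f i z) (\<Sum>i\<in>I. a i) (\<Sum>i\<in>I. b i) F"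
  using assms unfolding has_gradient_def
  by (drule_tac has_derivative_sum) (simp_all add: sum.distrib sum_distrib_right inner_sum_left)

lemma has_gradient_compose:
  assumes "(h has_real_derivative h') (at (f z))" "has_gradient f a b (at z within S)"
  shows "has_gradient (\<lambda>z. h (f z)) (h' * a) (h' *\<^sub>R b) (at z within S)"
  using has_derivative_compose[OF assms(2)[unfolded has_gradient_def] assms(1)[unfolded has_field_derivative_def]]
  unfolding has_gradient_def by (simp add: algebra_simps)

lemma has_gradient_unique_future:
  fixes f :: "real \<times> (real^3) \<Rightarrow> real"
  assumes "has_gradient f a b (at z within future)" "z \<in> future"
  shows "dt f z = a" "dx i f z = b $ i"
  using partial_within_future_eqI[OF assms(1)[unfolded has_gradient_def] assms(2)]
  unfolding dt_def dx_def by (simp_all add: inner_axis)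

lemma has_gradient_future:
  assumes f: "f differentiable_on future" and z: "z \<in> future"
  shows "has_gradient f (dt f z) (\<chi> i. dx i f z) (at z within future)"
proof -
  from f z obtain f' where f': "(f has_derivative f') (at z within future)"
    unfolding differentiable_on_def differentiable_def by blast
  have L: "linear f'" using f' by (rule has_derivative_linear)
  have "f' h = dt f z * fst h + (\<chi> i. dx i f z) \<bullet> snd h" for h
  proof -
    have "h = fst h *\<^sub>R (1, 0) + (\<Sum>i\<in>UNIV. (snd h $ i) *\<^sub>R (0, axis i 1))"
    proof (rule prod_eqI)
      show "snd h = snd (fst h *\<^sub>R (1, 0) + (\<Sum>i\<in>UNIV. (snd h $ i) *\<^sub>R (0, axis i 1)))"
        using basis_expansion[of "snd h"] by (simp add: snd_sum scalar_mult_eq_scaleR)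
    qed (simp add: fst_sum)
    then have "f' h = f' (fst h *\<^sub>R (1, 0) + (\<Sum>i\<in>UNIV. (snd h $ i) *\<^sub>R (0, axis i 1)))"
      by (rule arg_cong)
    also have "\<dots> = fst h * f' (1, 0) + (\<Sum>i\<in>UNIV. (snd h $ i) * f' (0, axis i 1))"
      by (simp only: linear_add[OF L] linear_sum[OF L] linear_scale[OF L] real_scaleR_def)
    finally have "f' h = fst h * f' (1, 0) + (\<Sum>i\<in>UNIV. (snd h $ i) * f' (0, axis i 1))" .
    then show ?thesis
      unfolding dt_def dx_def partial_within_future_eqI[OF f' z] by (simp add: inner_vec_def mult.commute)
  qed
  then have "f' = (\<lambda>h. dt f z * fst h + (\<chi> i. dx i f z) \<bullet> snd h)" by blast
  then show ?thesis using f' unfolding has_gradient_def by simp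
qed

lemma C_k_on_Suc_future:
  assumes "C_k_on (Suc k) future f"
  shows "f differentiable_on future" "C_k_on k future (dt f)" "C_k_on k future (dx i f)"
proof -
  have "(1, 0) \<in> (Basis :: (real \<times> (real^3)) set)" "(0, axis i 1) \<in> (Basis :: (real \<times> (real^3)) set)"
    by (auto simp: Basis_prod_def axis_in_Basis_iff)
  then show "f differentiable_on future" "C_k_on k future (dt f)" "C_k_on k future (dx i f)"
    using assms unfolding dt_def dx_def by auto
qed

text \<open>Schwarz's theorem: the mean value theorem, applied in both orders to the second
  difference over a small parallelogram, yields equal values of \<open>gab\<close> and
  \<open>gba\<close> at two points close to z.\<close>

lemma mixed_partials_eq:
  fixes f :: "'a::real_normed_vector \<Rightarrow> real"
  assumes U: "open U" "z \<in> U"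
    and fa: "\<And>w. w \<in> U \<Longrightarrow> ((\<lambda>s. f (w + s *\<^sub>R a)) has_real_derivative ga w) (at 0)"
    and fb: "\<And>w. w \<in> U \<Longrightarrow> ((\<lambda>s. f (w + s *\<^sub>R b)) has_real_derivative gb w) (at 0)"
    and fab: "\<And>w. w \<in> U \<Longrightarrow> ((\<lambda>s. ga (w + s *\<^sub>R b)) has_real_derivative gab w) (at 0)"
    and fba: "\<And>w. w \<in> U \<Longrightarrow> ((\<lambda>s. gb (w + s *\<^sub>R a)) has_real_derivative gba w) (at 0)"
    and cont: "continuous_on U gab" "continuous_on U gba"
  shows "gab z = gba z"
proof -
  have shift: "((\<lambda>s. F (w + s *\<^sub>R c)) has_real_derivative F' (w + t *\<^sub>R c)) (at t)"
    if "\<And>w. w \<in> U \<Longrightarrow> ((\<lambda>s. F (w + s *\<^sub>R c)) has_real_derivative F' w) (at 0)" "w + t *\<^sub>R c \<in> U"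
    for F F' :: "'a \<Rightarrow> real" and w c :: 'a and t
  proof -
    have "((\<lambda>s. F ((w + t *\<^sub>R c) + s *\<^sub>R c)) has_real_derivative F' (w + t *\<^sub>R c)) (at (0::real))"
      by (rule that)+
    then show ?thesis
      using DERIV_shift[of "\<lambda>s. F (w + s *\<^sub>R c)" "F' (w + t *\<^sub>R c)" 0 t] by (simp add: algebra_simps)
  qed
  have second_difference: "\<exists>\<xi> \<eta>. 0 < \<xi> \<and> \<xi> < h \<and> 0 < \<eta> \<and> \<eta> < h \<and>
      f (z + h *\<^sub>R a + h *\<^sub>R b) - f (z + h *\<^sub>R a) - f (z + h *\<^sub>R b) + f z = h\<^sup>2 * Gab (z + \<xi> *\<^sub>R a + \<eta> *\<^sub>R b)"
    if h: "h > 0" and sq: "\<And>s t. 0 \<le> s \<Longrightarrow> s \<le> h \<Longrightarrow> 0 \<le> t \<Longrightarrow> t \<le> h \<Longrightarrow> z + s *\<^sub>R a + t *\<^sub>R b \<in> U"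
      and fa: "\<And>w. w \<in> U \<Longrightarrow> ((\<lambda>s. f (w + s *\<^sub>R a)) has_real_derivative Ga w) (at 0)"
      and fab: "\<And>w. w \<in> U \<Longrightarrow> ((\<lambda>s. Ga (w + s *\<^sub>R b)) has_real_derivative Gab w) (at 0)"
    for h a b Ga Gab
  proof -
    have "((\<lambda>s. f (z + h *\<^sub>R b + s *\<^sub>R a) - f (z + s *\<^sub>R a)) has_real_derivative
        Ga (z + h *\<^sub>R b + s *\<^sub>R a) - Ga (z + s *\<^sub>R a)) (at s)" if "0 \<le> s" "s \<le> h" for s
      using sq[of s h] sq[of s 0] that h
      by (intro DERIV_diff shift[where F'=Ga] fa) (auto simp: algebra_simps)
    then obtain \<xi> where \<xi>: "0 < \<xi>" "\<xi> < h" and 1: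
      "f (z + h *\<^sub>R b + h *\<^sub>R a) - f (z + h *\<^sub>R a) - (f (z + h *\<^sub>R b + 0 *\<^sub>R a) - f (z + 0 *\<^sub>R a))
       = (h - 0) * (Ga (z + h *\<^sub>R b + \<xi> *\<^sub>R a) - Ga (z + \<xi> *\<^sub>R a))"
      using MVT2[OF h, of "\<lambda>s. f (z + h *\<^sub>R b + s *\<^sub>R a) - f (z + s *\<^sub>R a)"
        "\<lambda>s. Ga (z + h *\<^sub>R b + s *\<^sub>R a) - Ga (z + s *\<^sub>R a)"] by blast
    have "((\<lambda>t. Ga (z + \<xi> *\<^sub>R a + t *\<^sub>R b)) has_real_derivative Gab (z + \<xi> *\<^sub>R a + t *\<^sub>R b)) (at t)"
      if "0 \<le> t" "t \<le> h" for t
      using sq[of \<xi> t] that \<xi> by (intro shift[where F'=Gab] fab) auto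
    then obtain \<eta> where \<eta>: "0 < \<eta>" "\<eta> < h" and 2:
      "Ga (z + \<xi> *\<^sub>R a + h *\<^sub>R b) - Ga (z + \<xi> *\<^sub>R a + 0 *\<^sub>R b) = (h - 0) * Gab (z + \<xi> *\<^sub>R a + \<eta> *\<^sub>R b)"
      using MVT2[OF h, of "\<lambda>t. Ga (z + \<xi> *\<^sub>R a + t *\<^sub>R b)" "\<lambda>t. Gab (z + \<xi> *\<^sub>R a + t *\<^sub>R b)"] by blast
    have comm: "z + h *\<^sub>R b + s *\<^sub>R a = z + s *\<^sub>R a + h *\<^sub>R b" for s by (simp add: algebra_simps)
    show ?thesis
      using 1 2 \<xi> \<eta> unfolding comm by (intro exI[of _ \<xi>] exI[of _ \<eta>]) (simp add: power2_eq_square)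
  qed
  have "\<bar>gab z - gba z\<bar> < e" if e: "e > 0" for e
  proof -
    have "isCont gab z" "isCont gba z"
      using cont U by (auto simp: continuous_on_eq_continuous_at)
    then obtain d1 d2 where d: "d1 > 0" "\<And>w. dist w z < d1 \<Longrightarrow> \<bar>gab w - gab z\<bar> < e / 2"
        "d2 > 0" "\<And>w. dist w z < d2 \<Longrightarrow> \<bar>gba w - gba z\<bar> < e / 2"
      using e unfolding continuous_at_eps_delta dist_real_def by (metis half_gt_zero)
    obtain d3 where d3: "d3 > 0" "\<And>w. dist w z < d3 \<Longrightarrow> w \<in> U"
      using U unfolding open_dist by blast
    define d where "d = min d1 (min d2 d3)"
    \<comment> \<open>Small enough that the parallelogram with sides h a and h b stays within d of
      z; the added 1 covers vanishing a and b.\<close>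
    define h where "h = d / (2 * (norm a + norm b + 1))"
    have N: "norm a + norm b + 1 > 0" using norm_ge_zero[of a] norm_ge_zero[of b] by linarith
    have dpos: "d > 0" unfolding d_def using d d3 by simp
    then have h: "h > 0" unfolding h_def using N by simp
    have close: "dist (z + s *\<^sub>R a + t *\<^sub>R b) z < d" if "0 \<le> s" "s \<le> h" "0 \<le> t" "t \<le> h" for s t
    proof -
      have "dist (z + s *\<^sub>R a + t *\<^sub>R b) z \<le> norm (s *\<^sub>R a) + norm (t *\<^sub>R b)"
        using norm_triangle_ineq[of "s *\<^sub>R a" "t *\<^sub>R b"] by (simp add: dist_norm add.assoc del: norm_scaleR)
      also have "\<dots> \<le> h * norm a + h * norm b"
        using that by (auto intro!: add_mono mult_right_mono)
      also have "\<dots> \<le> h * (norm a + norm b + 1)" using h by (simp add: algebra_simps)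
      also have "\<dots> = d / 2" unfolding h_def using N by (simp add: field_simps)
      also have "\<dots> < d" using dpos by simp
      finally show ?thesis .
    qed
    have sq: "z + s *\<^sub>R a + t *\<^sub>R b \<in> U" if "0 \<le> s" "s \<le> h" "0 \<le> t" "t \<le> h" for s t
      using close[OF that] d3(2) unfolding d_def by simp
    have sq': "z + s *\<^sub>R b + t *\<^sub>R a \<in> U" if "0 \<le> s" "s \<le> h" "0 \<le> t" "t \<le> h" for s t
      using sq[of t s] that by (simp add: algebra_simps)
    obtain \<xi> \<eta> where 1: "0 < \<xi>" "\<xi> < h" "0 < \<eta>" "\<eta> < h"
      "f (z + h *\<^sub>R a + h *\<^sub>R b) - f (z + h *\<^sub>R a) - f (z + h *\<^sub>R b) + f z = h\<^sup>2 * gab (z + \<xi> *\<^sub>R a + \<eta> *\<^sub>R b)"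
      using second_difference[OF h sq fa fab] by blast
    obtain \<xi>' \<eta>' where 2: "0 < \<xi>'" "\<xi>' < h" "0 < \<eta>'" "\<eta>' < h"
      "f (z + h *\<^sub>R b + h *\<^sub>R a) - f (z + h *\<^sub>R b) - f (z + h *\<^sub>R a) + f z = h\<^sup>2 * gba (z + \<xi>' *\<^sub>R b + \<eta>' *\<^sub>R a)"
      using second_difference[OF h sq' fb fba] by blast
    have comm: "z + h *\<^sub>R b + h *\<^sub>R a = z + h *\<^sub>R a + h *\<^sub>R b" by (simp add: algebra_simps)
    have "h\<^sup>2 * gab (z + \<xi> *\<^sub>R a + \<eta> *\<^sub>R b) = h\<^sup>2 * gba (z + \<xi>' *\<^sub>R b + \<eta>' *\<^sub>R a)"
      using 1(5) 2(5) unfolding comm by linarith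
    then have eq: "gab (z + \<xi> *\<^sub>R a + \<eta> *\<^sub>R b) = gba (z + \<eta>' *\<^sub>R a + \<xi>' *\<^sub>R b)"
      using h by (simp add: algebra_simps)
    have "dist (z + \<xi> *\<^sub>R a + \<eta> *\<^sub>R b) z < d1" "dist (z + \<eta>' *\<^sub>R a + \<xi>' *\<^sub>R b) z < d2"
      using close[of \<xi> \<eta>] close[of \<eta>' \<xi>'] 1 2 unfolding d_def by auto
    from d(2)[OF this(1)] d(4)[OF this(2)] show ?thesis
      unfolding eq by linarith
  qed
  from this[of "\<bar>gab z - gba z\<bar>"] show ?thesis by force
qed

text \<open>Dominant energy condition: the components \<open>w0\<close>, \<open>w\<close> of the energy-momentum tensor contracted with
  \<open>(k0, k)\<close> satisfy \<open>w0\<^sup>2 - \<bar>w\<bar>\<^sup>2 = (a\<^sup>2 - \<bar>b\<bar>\<^sup>2)\<^sup>2 (k0\<^sup>2 - \<bar>k\<bar>\<^sup>2) / 4\<close>.\<close>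

lemma energy_flux_nonneg:
  fixes b k \<xi> :: "'a::real_inner" and a k0 :: real
  assumes k: "norm k \<le> k0" and \<xi>: "norm \<xi> \<le> 1"
  shows "0 \<le> k0 * (a\<^sup>2 + b \<bullet> b) / 2 + a * (k \<bullet> b)
    + \<xi> \<bullet> (((b \<bullet> b - a\<^sup>2) / 2) *\<^sub>R k - (k0 * a + k \<bullet> b) *\<^sub>R b)"
proof -
  define w0 where "w0 = k0 * (a\<^sup>2 + b \<bullet> b) / 2 + a * (k \<bullet> b)"
  define w where "w = ((b \<bullet> b - a\<^sup>2) / 2) *\<^sub>R k - (k0 * a + k \<bullet> b) *\<^sub>R b"
  have k0: "k0 \<ge> 0" using k norm_ge_zero[of k] by linarith
  have "\<bar>a * (k \<bullet> b)\<bar> \<le> \<bar>a\<bar> * (norm k * norm b)"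
    unfolding abs_mult by (intro mult_left_mono Cauchy_Schwarz_ineq2) auto
  also have "\<dots> \<le> \<bar>a\<bar> * (k0 * norm b)"
    using k by (intro mult_left_mono mult_right_mono) auto
  also have "\<dots> \<le> k0 * (a\<^sup>2 + (norm b)\<^sup>2) / 2"
  proof -
    have "2 * (\<bar>a\<bar> * norm b) \<le> a\<^sup>2 + (norm b)\<^sup>2"
      using sum_squares_bound[of "\<bar>a\<bar>" "norm b"] by simp
    from mult_left_mono[OF this k0] show ?thesis by (simp add: algebra_simps)
  qed
  finally have "\<bar>a * (k \<bullet> b)\<bar> \<le> k0 * (a\<^sup>2 + (norm b)\<^sup>2) / 2" .
  then have w0: "w0 \<ge> 0" unfolding w0_def power2_norm_eq_inner by linarith
  have "w0\<^sup>2 - w \<bullet> w = (a\<^sup>2 - b \<bullet> b)\<^sup>2 / 4 * (k0\<^sup>2 - k \<bullet> k)"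
    unfolding w_def w0_def
    by (simp add: inner_diff_left inner_diff_right inner_commute[of b k] power2_eq_square algebra_simps add_divide_distrib diff_divide_distrib)
  also have "\<dots> \<ge> 0"
  proof -
    have "(norm k)\<^sup>2 \<le> k0\<^sup>2" using k by (intro power_mono) auto
    then show ?thesis unfolding power2_norm_eq_inner by (intro mult_nonneg_nonneg) auto
  qed
  finally have "(norm w)\<^sup>2 \<le> w0\<^sup>2" unfolding power2_norm_eq_inner by simp
  then have "norm w \<le> w0" using w0 by (rule power2_le_imp_le)
  moreover have "\<bar>\<xi> \<bullet> w\<bar> \<le> 1 * norm w"
    using Cauchy_Schwarz_ineq2[of \<xi> w] mult_right_mono[OF \<xi> norm_ge_zero[of w]] by linarith
  ultimately have "0 \<le> w0 + \<xi> \<bullet> w" by linarith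
  then show ?thesis unfolding w0_def w_def .
qed

text \<open>The kinetic part of the divergence of the conformal current. Here \<open>q\<close> stands for \<open>\<phi> / (t\<^sup>2 - \<bar>x\<bar>\<^sup>2)\<close>
  and \<open>\<sigma>\<close> for \<open>1 / (t\<^sup>2 - \<bar>x\<bar>\<^sup>2)\<close>; the last three assumptions express the wave equation and the equality
  of mixed partials.\<close>

lemma conformal_current_algebra:
  fixes t \<sigma> a a' N :: real and x b ax bt :: "real^3" and bx :: "3 \<Rightarrow> real^3"
  assumes \<sigma>: "\<sigma> * (t\<^sup>2 - (x$1)\<^sup>2 - (x$2)\<^sup>2 - (x$3)\<^sup>2) = 1"
    and at: "a' = bx 1 $ 1 + bx 2 $ 2 + bx 3 $ 3 + 2 * \<sigma> * (t * a + x$1 * b$1 + x$2 * b$2 + x$3 * b$3) - N"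
    and bt: "\<And>i. bt $ i = ax $ i - 2 * \<sigma> * (x$i * a + t * b$i)"
    and bx: "\<And>i j. bx i $ j - bx j $ i = 2 * \<sigma> * (x$j * b$i - x$i * b$j)"
  defines "k0 \<equiv> t\<^sup>2 + (x$1)\<^sup>2 + (x$2)\<^sup>2 + (x$3)\<^sup>2" and "k \<equiv> \<lambda>i. 2 * t * x$i"
    and "B \<equiv> (b$1)\<^sup>2 + (b$2)\<^sup>2 + (b$3)\<^sup>2"
    and "kb \<equiv> 2 * t * (x$1 * b$1 + x$2 * b$2 + x$3 * b$3)"
  shows "t * (a\<^sup>2 + B) + k0 * (a * a' + (b$1 * bt$1 + b$2 * bt$2 + b$3 * bt$3)) + a' * kb
      + a * (2 * (x$1 * b$1 + x$2 * b$2 + x$3 * b$3) + (k 1 * bt$1 + k 2 * bt$2 + k 3 * bt$3))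
    + (\<Sum>i\<in>UNIV. - (2 * x$i * a + k0 * ax$i + (2 * t * b$i + (k 1 * bx 1 $ i + k 2 * bx 2 $ i + k 3 * bx 3 $ i))) * b$i
        - (k0 * a + kb) * bx i $ i
        + t * (B - a\<^sup>2) + k i * ((b$1 * bx 1 $ i + b$2 * bx 2 $ i + b$3 * bx 3 $ i) - a * ax$i))
    = - N * (k0 * a + kb)"
proof -
  have b21: "bx 2 $ 1 = bx 1 $ 2 + 2 * \<sigma> * (x$1 * b$2 - x$2 * b$1)"
    and b31: "bx 3 $ 1 = bx 1 $ 3 + 2 * \<sigma> * (x$1 * b$3 - x$3 * b$1)"
    and b32: "bx 3 $ 2 = bx 2 $ 3 + 2 * \<sigma> * (x$2 * b$3 - x$3 * b$2)"
    using bx[of 2 1] bx[of 3 1] bx[of 3 2] by (simp_all add: algebra_simps)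
  have "?thesis \<longleftrightarrow> 2 * t * (a\<^sup>2 - B) * (\<sigma> * (t\<^sup>2 - (x$1)\<^sup>2 - (x$2)\<^sup>2 - (x$3)\<^sup>2) - 1) = 0"
    unfolding at bt b21 b31 b32 k0_def k_def B_def kb_def sum_3
    by (simp add: algebra_simps power2_eq_square)
  then show ?thesis using \<sigma> by simp
qed

subsection \<open>The nonlinear wave equation\<close>

lemma has_gradient_along_line:
  assumes "has_gradient f \<alpha> \<beta> (at w)"
  shows "((\<lambda>s. f (w + s *\<^sub>R c)) has_real_derivative (\<alpha> * fst c + \<beta> \<bullet> snd c)) (at 0)"
proof -
  have "((\<lambda>s. f (fst w + s * fst c, snd w + s *\<^sub>R snd c)) has_real_derivative (\<alpha> * fst c + \<beta> \<bullet> snd c)) (at 0)"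
    by (rule has_gradient_along_curve[where S=UNIV])
      (use assms in \<open>auto intro!: derivative_eq_intros\<close>)
  moreover have "w + s *\<^sub>R c = (fst w + s * fst c, snd w + s *\<^sub>R snd c)" for s
    by (simp add: prod_eq_iff)
  ultimately show ?thesis by simp
qed

text \<open>Away from 0 this is the power rule; at 0 the difference quotient is of order |h|^q,
  which tends to 0 because q > 0.\<close>

lemma DERIV_abs_powr:
  assumes "q > 0"
  shows "((\<lambda>u. \<bar>u\<bar> powr (q + 1) / (q + 1)) has_real_derivative u * \<bar>u\<bar> powr (q - 1)) (at (u::real))"
proof (cases u "0::real" rule: linorder_cases)
  case greater
  have "((\<lambda>u. u powr (q + 1) / (q + 1)) has_real_derivative u * \<bar>u\<bar> powr (q - 1)) (at u)"
    using greater assms by (auto intro!: derivative_eq_intros simp: powr_diff)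
  then show ?thesis
    by (rule has_field_derivative_transform_within_open[where S="{0<..}"]) (use greater in auto)
next
  case less
  have "((\<lambda>u. (- u) powr (q + 1) / (q + 1)) has_real_derivative u * \<bar>u\<bar> powr (q - 1)) (at u)"
    using less assms by (auto intro!: derivative_eq_intros simp: powr_diff)
  then show ?thesis
    by (rule has_field_derivative_transform_within_open[where S="{..<0}"]) (use less in auto)
next
  case equal
  have "((\<lambda>h. \<bar>h\<bar> powr (q + 1) / (q + 1) / h) \<longlongrightarrow> 0) (at (0::real))"
  proof (rule tendsto_rabs_zero_cancel, rule tendsto_sandwich[OF _ _ tendsto_const])
    show "\<forall>\<^sub>F h in at (0::real). \<bar>\<bar>h\<bar> powr (q + 1) / (q + 1) / h\<bar> \<le> \<bar>h\<bar> powr q / (q + 1)"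
    proof (intro always_eventually allI)
      fix h :: real
      have "\<bar>\<bar>h\<bar> powr (q + 1) / (q + 1) / h\<bar> = \<bar>h\<bar> powr q * (\<bar>h\<bar> / \<bar>h\<bar>) / (q + 1)"
        using assms by (simp add: powr_add abs_mult)
      also have "\<dots> \<le> \<bar>h\<bar> powr q / (q + 1)" using assms by (cases "h = 0") simp_all
      finally show "\<bar>\<bar>h\<bar> powr (q + 1) / (q + 1) / h\<bar> \<le> \<bar>h\<bar> powr q / (q + 1)" .
    qed
    have "((\<lambda>h::real. \<bar>h\<bar> powr q / (q + 1)) \<longlongrightarrow> \<bar>0\<bar> powr q / (q + 1)) (at 0)"
      by (intro tendsto_intros tendsto_powr') (use assms in auto)
    then show "((\<lambda>h::real. \<bar>h\<bar> powr q / (q + 1)) \<longlongrightarrow> 0) (at 0)" by simp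
  qed auto
  then show ?thesis using equal by (simp add: DERIV_def)
qed

text \<open>\<open>data\<close> records the support of the Cauchy data. Radius 1/2 at time 1 keeps
  the solution at distance 1/2 inside the light cone of the origin.\<close>

locale wave_solution =
  fixes p :: real and \<phi> :: "real \<times> (real^3) \<Rightarrow> real"
  assumes p: "3 \<le> p" "p < 5"
    and reg: "C_k_on 2 future \<phi>"
    and pde: "\<And>z. z \<in> future \<Longrightarrow> wave_op \<phi> z + \<phi> z * \<bar>\<phi> z\<bar> powr (p - 1) = 0"
    and data: "\<And>x. norm x \<ge> 1/2 \<Longrightarrow> \<phi> (1, x) = 0" "\<And>x. norm x \<ge> 1/2 \<Longrightarrow> dt \<phi> (1, x) = 0"
begin

definition "\<phi>t = dt \<phi>"
definition "\<phi>x z = (\<chi> i. dx i \<phi> z)"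
definition "\<phi>tt = dt (dt \<phi>)"
text \<open>The two orders of the mixed derivatives, \<open>\<phi>tx\<close> and
  \<open>\<phi>xt\<close>, are kept apart because \<open>mixed_partials\<close> identifies them only
  for t > 1.\<close>

definition "\<phi>tx z = (\<chi> i. dt (dx i \<phi>) z)"
definition "\<phi>xt z = (\<chi> i. dx i (dt \<phi>) z)"
definition "\<phi>xx i z = (\<chi> j. dx j (dx i \<phi>) z)"
definition "nonlin z = \<phi> z * \<bar>\<phi> z\<bar> powr (p - 1)"
definition "pot z = \<bar>\<phi> z\<bar> powr (p + 1) / (p + 1)"

lemma regularity:
  shows "\<phi> differentiable_on future" "dt \<phi> differentiable_on future" "dx i \<phi> differentiable_on future"
    and "continuous_on future (dt (dt \<phi>))" "continuous_on future (dx i (dt \<phi>))"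
    "continuous_on future (dt (dx i \<phi>))" "continuous_on future (dx j (dx i \<phi>))"
proof -
  have 0: "C_k_on (Suc (Suc 0)) future \<phi>" using reg by (simp add: numeral_2_eq_2)
  note 1 = C_k_on_Suc_future[OF 0]
  show "\<phi> differentiable_on future" by (rule 1)
  show "dt \<phi> differentiable_on future" "dx i \<phi> differentiable_on future"
    using C_k_on_Suc_future(1)[OF 1(2)] C_k_on_Suc_future(1)[OF 1(3)] by auto
  show "continuous_on future (dt (dt \<phi>))" "continuous_on future (dx i (dt \<phi>))"
    "continuous_on future (dt (dx i \<phi>))" "continuous_on future (dx j (dx i \<phi>))"
    using C_k_on_Suc_future(2,3)[OF 1(2)] C_k_on_Suc_future(2,3)[OF 1(3)] by auto
qed

lemma gradients [has_gradient_intros]: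
  assumes "z \<in> future"
  shows "has_gradient \<phi> (\<phi>t z) (\<phi>x z) (at z within future)"
    "has_gradient \<phi>t (\<phi>tt z) (\<phi>xt z) (at z within future)"
    "has_gradient (\<lambda>z. \<phi>x z $ i) (\<phi>tx z $ i) (\<phi>xx i z) (at z within future)"
  using has_gradient_future[OF regularity(1) assms] has_gradient_future[OF regularity(2) assms]
    has_gradient_future[OF regularity(3) assms, of i]
  unfolding \<phi>t_def \<phi>x_def \<phi>tt_def \<phi>tx_def \<phi>xt_def \<phi>xx_def by simp_all

lemma continuous [continuous_intros]:
  "continuous_on future \<phi>" "continuous_on future \<phi>t" "continuous_on future \<phi>x"
  "continuous_on future \<phi>tt" "continuous_on future \<phi>tx" "continuous_on future \<phi>xt" "continuous_on future (\<phi>xx i)"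
  using regularity differentiable_imp_continuous_on[OF regularity(1)]
    differentiable_imp_continuous_on[OF regularity(2)] differentiable_imp_continuous_on[OF regularity(3)]
  unfolding \<phi>t_def \<phi>x_def[abs_def] \<phi>tt_def \<phi>tx_def[abs_def] \<phi>xt_def[abs_def] \<phi>xx_def[abs_def]
  by (auto intro!: continuous_on_vec_lambda)

lemma at_within_future: "fst z > 1 \<Longrightarrow> at z within future = at z"
  by (rule at_within_interior) (auto simp: interior_Times mem_Times_iff)

lemma mixed_partials:
  assumes z: "fst z > 1"
  shows "\<phi>xt z = \<phi>tx z" "\<phi>xx i z $ j = \<phi>xx j z $ i"
proof -
  let ?U = "{1::real<..} \<times> (UNIV :: (real^3) set)"
  have U: "open ?U"
    by (intro open_Times open_greaterThan open_UNIV)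
  have zU: "z \<in> ?U" by (simp add: mem_Times_iff z)
  have fut: "w \<in> future" "fst w > 1" if "w \<in> ?U" for w :: "real \<times> (real^3)"
    using that by (auto simp: mem_Times_iff)
  have g: "has_gradient \<phi> (\<phi>t w) (\<phi>x w) (at w)"
    "has_gradient \<phi>t (\<phi>tt w) (\<phi>xt w) (at w)"
    "has_gradient (\<lambda>z. \<phi>x z $ i) (\<phi>tx w $ i) (\<phi>xx i w) (at w)" if "w \<in> ?U" for w i
    using gradients[OF fut(1)[OF that]] at_within_future[OF fut(2)[OF that]] by simp_all
  note l = g[THEN has_gradient_along_line]
  have c: "continuous_on ?U F" if "continuous_on future F" for F :: "real \<times> (real^3) \<Rightarrow> real"
    by (rule continuous_on_subset[OF that]) auto
  have cc: "continuous_on ?U (\<lambda>z. \<phi>xt z $ i)" "continuous_on ?U (\<lambda>z. \<phi>tx z $ i)"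
    "continuous_on ?U (\<lambda>z. \<phi>xx i z $ j)" for i j
    by (rule c, intro continuous_intros)+
  have "\<phi>xt z $ i = \<phi>tx z $ i" for i
    by (rule mixed_partials_eq[OF U zU, where f=\<phi> and a="(1, 0)" and b="(0, axis i 1)" and ga=\<phi>t and gb="\<lambda>z. \<phi>x z $ i"])
      (use l[where c="(1, 0)"] l[where c="(0, axis i 1)"] in
        \<open>auto simp: inner_axis intro!: cc\<close>)
  then show "\<phi>xt z = \<phi>tx z" by (simp add: vec_eq_iff)
  show "\<phi>xx i z $ j = \<phi>xx j z $ i"
    by (rule mixed_partials_eq[OF U zU, where f=\<phi> and a="(0, axis i 1)" and b="(0, axis j 1)"
        and ga="\<lambda>z. \<phi>x z $ i" and gb="\<lambda>z. \<phi>x z $ j"])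
      (use l[where c="(0, axis j 1)"] l[where c="(0, axis i 1)"] in
        \<open>auto simp: inner_axis intro!: cc\<close>)
qed

lemma wave_equation:
  assumes "z \<in> future"
  shows "\<phi>tt z - (\<Sum>i\<in>UNIV. \<phi>xx i z $ i) = - nonlin z"
  using pde[OF assms] unfolding wave_op_def \<phi>tt_def \<phi>xx_def nonlin_def by simp

lemma continuous_nonlin [continuous_intros]: "continuous_on future nonlin" "continuous_on future pot"
  unfolding nonlin_def[abs_def] pot_def[abs_def]
  using p by (auto intro!: continuous_intros continuous_on_powr')

lemma gradient_pot [has_gradient_intros]:
  assumes z: "z \<in> future"
  shows "has_gradient pot (nonlin z * \<phi>t z) (nonlin z *\<^sub>R \<phi>x z) (at z within future)"
  unfolding pot_def[abs_def] nonlin_def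
  by (rule has_gradient_compose[OF DERIV_abs_powr gradients(1)[OF z]]) (use p in auto)

lemma pot_nonneg: "pot z \<ge> 0"
  unfolding pot_def using p by simp

lemma initial_gradient:
  assumes y: "norm y > 1/2"
  shows "\<phi>x (1, y) = 0"
proof -
  have "\<phi>x (1, y) $ i = 0" for i
  proof -
    have "((\<lambda>s. \<phi> (1, y + s *\<^sub>R axis i 1)) has_real_derivative \<phi>t (1, y) * 0 + \<phi>x (1, y) \<bullet> axis i 1) (at 0)"
      by (rule has_gradient_along_curve[where S=future])
        (use gradients(1)[of "(1, y)"] in \<open>auto intro!: derivative_eq_intros\<close>)
    then have "((\<lambda>s. \<phi> (1, y + s *\<^sub>R axis i 1)) has_real_derivative \<phi>x (1, y) $ i) (at 0)"
      by (simp add: inner_axis)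
    moreover have "((\<lambda>s. \<phi> (1, y + s *\<^sub>R axis i 1)) has_real_derivative 0) (at 0)"
    proof (rule has_field_derivative_transform_within_open[where f="\<lambda>_. 0"])
      show "open {s::real. 1/2 < norm (y + s *\<^sub>R axis i 1)}"
        by (intro open_Collect_less continuous_intros)
    qed (use y data(1) in auto)
    ultimately show ?thesis by (rule DERIV_unique)
  qed
  then show ?thesis by (simp add: vec_eq_iff)
qed

section \<open>Energy current and finite speed of propagation\<close>

definition "en0 z = ((\<phi>t z)\<^sup>2 + (\<Sum>i\<in>UNIV. (\<phi>x z $ i)\<^sup>2)) / 2 + pot z"
definition "en z = - \<phi>t z *\<^sub>R \<phi>x z"
definition "en0_t z = \<phi>t z * \<phi>tt z + (\<Sum>i\<in>UNIV. \<phi>x z $ i * \<phi>tx z $ i) + nonlin z * \<phi>t z"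
definition "en0_x z = \<phi>t z *\<^sub>R \<phi>xt z + (\<Sum>i\<in>UNIV. \<phi>x z $ i *\<^sub>R \<phi>xx i z) + nonlin z *\<^sub>R \<phi>x z"
definition "en_t z = - \<phi>tt z *\<^sub>R \<phi>x z - \<phi>t z *\<^sub>R \<phi>tx z"
definition "en_x i z = - (\<phi>x z $ i) *\<^sub>R \<phi>xt z - \<phi>t z *\<^sub>R \<phi>xx i z"

lemma gradient_en:
  assumes z: "z \<in> future"
  shows "has_gradient en0 (en0_t z) (en0_x z) (at z within future)"
    and "has_gradient (\<lambda>z. en z $ i) (en_t z $ i) (en_x i z) (at z within future)"
proof -
  have "has_gradient (\<lambda>z. (1/2) * (\<phi>t z * \<phi>t z + (\<Sum>i\<in>UNIV. \<phi>x z $ i * \<phi>x z $ i)) + pot z) (en0_t z) (en0_x z) (at z within future)"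
    by (rule has_gradient_eq, (rule has_gradient_intros z)+)
      (simp add: en0_t_def sum_3 algebra_simps, simp add: en0_x_def vec_eq_iff sum_3 algebra_simps)
  then show "has_gradient en0 (en0_t z) (en0_x z) (at z within future)"
    unfolding en0_def[abs_def] by (simp add: power2_eq_square)
  have "has_gradient (\<lambda>z. - (\<phi>t z * \<phi>x z $ i)) (en_t z $ i) (en_x i z) (at z within future)"
    by (rule has_gradient_eq, (rule has_gradient_intros z)+) (simp_all add: en_t_def en_x_def)
  then show "has_gradient (\<lambda>z. en z $ i) (en_t z $ i) (en_x i z) (at z within future)"
    unfolding en_def by simp
qed

lemma continuous_en: "continuous_on future en0_t" "continuous_on future en_t" "continuous_on future (en_x i)"
    "continuous_on future en0"
  unfolding en0_t_def[abs_def] en_t_def[abs_def] en_x_def[abs_def] en0_def[abs_def] by (intro continuous_intros; simp)+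

lemma divergence_en:
  assumes z: "fst z > 1"
  shows "en0_t z + (\<Sum>i\<in>UNIV. en_x i z $ i) = 0"
proof -
  have "z \<in> future" using z by (simp add: mem_Times_iff)
  from wave_equation[OF this] have "\<phi>tt z + nonlin z = (\<Sum>i\<in>UNIV. \<phi>xx i z $ i)" by simp
  then have "\<phi>t z * (\<phi>tt z + nonlin z) = \<phi>t z * (\<Sum>i\<in>UNIV. \<phi>xx i z $ i)" by simp
  then show ?thesis
    unfolding en0_t_def en_x_def mixed_partials(1)[OF z]
    by (simp add: sum_3 algebra_simps)
qed

text \<open>The flux through a hyperboloid with tip (t0, x0) is compared with the flux through the
  initial slice. Where the two surfaces differ the data vanish, so the difference of the integrands
  is nonnegative. Its integral is nonpositive, hence by continuity it is zero everywhere on the box,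
  in particular at the tip.\<close>

lemma finite_speed_aux:
  assumes t0: "t0 > 1" and x0: "norm x0 > t0 - 1/2"
  shows "\<phi> (t0, x0) = 0"
proof -
  \<comment> \<open>The first bound puts the tip above 1 + \<eta>, where \<open>soft_max\<close> is
    the identity. The second keeps the base, of radius t0 - 1 + 2 \<eta> about x0, outside the ball
    of radius 1/2 that carries the data.\<close>
  define \<eta> where "\<eta> = min (t0 - 1) (norm x0 - t0 + 1/2) / 2"
  have \<eta>: "\<eta> > 0" "2 * \<eta> \<le> t0 - 1" "2 * \<eta> \<le> norm x0 - t0 + 1/2"
    using t0 x0 unfolding \<eta>_def by auto
  define \<rho> where "\<rho> = (\<lambda>y. sqrt ((norm (y - x0))\<^sup>2 + \<eta>\<^sup>2))"
  \<comment> \<open>The centre is raised to t0 + \<eta> because a hyperboloid with parameter \<eta>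
    has its tip \<eta> below its centre.\<close>
  define \<theta> where "\<theta> = (\<lambda>y. soft_max \<eta> (t0 + \<eta> - \<rho> y))"
  define \<xi> where "\<xi> = (\<lambda>y. (soft_max' \<eta> (t0 + \<eta> - \<rho> y) / \<rho> y) *\<^sub>R (y - x0))"
  define R where "R = norm x0 + 2 * t0"
  define B where "B = cbox (- R *\<^sub>R One) (R *\<^sub>R One :: real^3)"
  have \<rho>: "\<rho> y \<ge> norm (y - x0)" for y unfolding \<rho>_def by (rule real_le_rsqrt) simp
  have flat: "\<theta> y = 1" "\<xi> y = 0" if "norm (y - x0) \<ge> t0 - 1 + 2 * \<eta>" for y
    using soft_max_eq_1[OF \<eta>(1), of "t0 + \<eta> - \<rho> y"] \<rho>[of y] that unfolding \<theta>_def \<xi>_def by auto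
  have supp: "\<theta> y = 1 \<or> en (\<tau>, y) = 0" if "norm y > R" for y \<tau>
  proof -
    have "norm (y - x0) \<ge> t0 - 1 + 2 * \<eta>"
      using norm_triangle_ineq2[of y x0] that \<eta> unfolding R_def by linarith
    then show ?thesis using flat(1) by simp
  qed
  have supp': "soft_max \<eta> (t0 + \<eta> - sqrt ((norm (y - x0))\<^sup>2 + \<eta>\<^sup>2)) = 1 \<or> en (\<tau>, y) = 0" if "norm y > R" for y \<tau>
    using supp[OF that] unfolding \<theta>_def \<rho>_def .
  note fl = hyperboloid_flux[where ?J0.0=en0 and J=en and R=R, OF gradient_en continuous_en(1-3)
      eq_refl[OF divergence_en] \<eta>(1) \<eta>(1) supp']
  have cI: "continuous_on UNIV (\<lambda>y. en0 (\<theta> y, y) + \<xi> y \<bullet> en (\<theta> y, y))"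
    and \<xi>: "norm (\<xi> y) \<le> 1"
    and le: "integral B (\<lambda>y. en0 (\<theta> y, y) + \<xi> y \<bullet> en (\<theta> y, y)) \<le> integral B (\<lambda>y. en0 (1, y))" for y
    unfolding \<theta>_def \<xi>_def \<rho>_def B_def by (rule fl; assumption)+
  have c1: "continuous_on UNIV (\<lambda>y. en0 (1, y))"
    by (intro continuous_on_compose2[OF continuous_en(4)] continuous_intros) auto
  have dom: "en0 z + v \<bullet> en z \<ge> 0" if "norm v \<le> 1" for z v
    using energy_flux_nonneg[of 0 1 v "\<phi>t z" "\<phi>x z"] that pot_nonneg[of z]
    by (simp add: en0_def en_def inner_vec_def power2_eq_square)
  let ?I = "\<lambda>y. en0 (\<theta> y, y) + \<xi> y \<bullet> en (\<theta> y, y) - en0 (1, y)"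
  have en1: "en0 (1, y) = 0" if "norm (y - x0) < t0 - 1 + 2 * \<eta>" for y
  proof -
    have "norm y > 1/2"
      using that \<eta>(3) norm_triangle_ineq2[of x0 "x0 - y"] norm_minus_commute[of y x0] by simp
    then show ?thesis
      using data[of y] initial_gradient[of y] by (simp add: en0_def pot_def \<phi>t_def)
  qed
  have nonneg: "?I y \<ge> 0" for y
  proof (cases "norm (y - x0) \<ge> t0 - 1 + 2 * \<eta>")
    case False
    then show ?thesis using en1[of y] dom[OF \<xi>[of y], of "(\<theta> y, y)"] by simp
  qed (simp add: flat)
  have iB: "F integrable_on B" if "continuous_on UNIV F" for F :: "real^3 \<Rightarrow> real"
    unfolding B_def using that by (intro integrable_continuous) (auto intro: continuous_on_subset)
  have cI': "continuous_on UNIV ?I" by (intro continuous_intros cI c1)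
  have "integral B ?I \<le> 0"
    using le by (subst Henstock_Kurzweil_Integration.integral_diff) (auto intro: iB cI c1)
  moreover have "integral B ?I \<ge> 0"
    using nonneg by (intro Henstock_Kurzweil_Integration.integral_nonneg iB cI') auto
  ultimately have "integral B ?I = 0" by (rule order.antisym)
  then have "(?I has_integral 0) B"
    using integrable_integral[OF iB[OF cI']] by (simp only:)
  note hi = this
  have I0: "?I y = 0" if "y \<in> B" for y
  proof (rule has_integral_0_cbox_imp_0[of "- R *\<^sub>R One" "R *\<^sub>R One" ?I y])
    show "continuous_on (cbox (- R *\<^sub>R One) (R *\<^sub>R One)) ?I"
      using cI' by (rule continuous_on_subset) simp
    show "(?I has_integral 0) (cbox (- R *\<^sub>R One) (R *\<^sub>R One))"
      using hi unfolding B_def .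
    have "R > 0" unfolding R_def using t0 by (simp add: add_nonneg_pos)
    then show "box (- R *\<^sub>R One) (R *\<^sub>R One :: real^3) \<noteq> {}"
      unfolding box_ne_empty by simp
  qed (use nonneg that in \<open>auto simp: B_def\<close>)
  have "x0 \<in> cball 0 R" unfolding R_def using t0 by simp
  then have "x0 \<in> B" unfolding B_def by (rule subsetD[OF cball_subset_cbox_One])
  moreover have "\<theta> x0 = t0"
    unfolding \<theta>_def \<rho>_def using \<eta> by (simp add: soft_max_eq_id)
  moreover have "en0 (1, x0) = 0" using \<eta> by (intro en1) simp
  \<comment> \<open>At the tip the surface is horizontal, \<xi> x0 = 0, so the integrand is
    \<open>en0\<close> alone.\<close>
  ultimately have "en0 (t0, x0) = 0" using I0[of x0] unfolding \<xi>_def by simp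
  moreover have "en0 (t0, x0) \<ge> pot (t0, x0)" unfolding en0_def by (simp add: sum_nonneg)
  ultimately have "pot (t0, x0) = 0" using pot_nonneg[of "(t0, x0)"] by linarith
  then show ?thesis using p unfolding pot_def by simp
qed


text \<open>The point is approached by scaling x outward at fixed time. This enters the open
  exterior because x is nonzero: |x| >= t - 1/2 >= 1/2.\<close>

lemma vanish_on_boundary:
  fixes F :: "real \<times> (real^3) \<Rightarrow> real"
  assumes F: "continuous_on future F"
    and 0: "\<And>z. z \<in> future \<Longrightarrow> norm (snd z) > fst z - 1/2 \<Longrightarrow> F z = 0"
    and z: "z \<in> future" "norm (snd z) \<ge> fst z - 1/2"
  shows "F z = 0"
proof -
  let ?w = "\<lambda>n. (fst z, (1 + 1 / real (Suc n)) *\<^sub>R snd z)"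
  have "(\<lambda>n. 1 / real (Suc n)) \<longlonglongrightarrow> 0"
    using LIMSEQ_inverse_real_of_nat by (simp add: inverse_eq_divide)
  then have "?w \<longlonglongrightarrow> (fst z, (1 + 0) *\<^sub>R snd z)"
    by (intro tendsto_intros)
  then have "(\<lambda>n. F (?w n)) \<longlonglongrightarrow> F z"
    using z by (intro continuous_on_tendsto_compose[OF F]) (auto simp: mem_Times_iff)
  moreover have "F (?w n) = 0" for n
  proof (rule 0)
    show "?w n \<in> future" using z by (simp add: mem_Times_iff)
    have pos: "norm (snd z) > 0" using z by (auto simp: mem_Times_iff)
    have "fst z - 1/2 < norm (snd z) + norm (snd z) / real (Suc n)"
      using z(2) divide_pos_pos[OF pos, of "real (Suc n)"] by linarith
    also have "\<dots> = (1 + 1 / real (Suc n)) * norm (snd z)" by (simp add: algebra_simps)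
    also have "\<dots> = norm (snd (?w n))"
      by (simp only: snd_conv norm_scaleR) (simp add: abs_of_nonneg)
    finally show "norm (snd (?w n)) > fst (?w n) - 1/2" by simp
  qed
  ultimately show ?thesis by (simp add: LIMSEQ_const_iff)
qed

lemma outside_nbhd:
  fixes z :: "real \<times> (real^3)"
  assumes "fst z - 1/2 < norm (snd z)"
  obtains d where "d > 0" "\<And>w. dist w z < d \<Longrightarrow> fst w - 1/2 < norm (snd w)"
proof -
  have "open {w :: real \<times> (real^3). fst w - 1/2 < norm (snd w)}"
    by (intro open_Collect_less continuous_intros)
  then have "\<exists>d>0. \<forall>w. dist w z < d \<longrightarrow> w \<in> {w. fst w - 1/2 < norm (snd w)}"
    using assms unfolding open_dist by (elim bspec) simp
  then show thesis using that unfolding mem_Collect_eq by blast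
qed

text \<open>\<open>finite_speed_aux\<close> covers t > 1 with strict inequality, the data cover t =
  1. In the open exterior the derivatives vanish along with \<phi>, and continuity carries all three
  statements to its boundary.\<close>

lemma finite_speed:
  assumes z: "z \<in> future" "norm (snd z) \<ge> fst z - 1/2"
  shows "\<phi> z = 0" "\<phi>t z = 0" "\<phi>x z = 0"
proof -
  have strict: "\<phi> z = 0" if "z \<in> future" "norm (snd z) > fst z - 1/2" for z
    using finite_speed_aux[of "fst z" "snd z"] data(1)[of "snd z"] that
    by (cases "fst z = 1") (auto simp: mem_Times_iff, metis prod.collapse)
  show "\<phi> z = 0" by (rule vanish_on_boundary[OF continuous(1) strict z])
  have "\<phi>t z = 0 \<and> \<phi>x z $ i = 0" if z: "z \<in> future" "norm (snd z) > fst z - 1/2" for z i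
  proof -
    obtain d where d: "d > 0" "\<And>w. dist w z < d \<Longrightarrow> fst w - 1/2 < norm (snd w)"
      using outside_nbhd z(2) by blast
    have "has_gradient (\<lambda>_. 0) (\<phi>t z) (\<phi>x z) (at z within future)"
      using gradients(1)[OF z(1)] d strict unfolding has_gradient_def
      by (elim has_derivative_transform_within[where d=d]) (use z in auto)
    note u = has_gradient_unique_future[OF this z(1)] has_gradient_unique_future[OF has_gradient_const[where c=0] z(1)]
    show ?thesis using u(1,3) u(2)[of i] u(4)[of i] by simp
  qed
  then have 0: "\<phi>t z = 0" "\<phi>x z $ i = 0" if "z \<in> future" "norm (snd z) > fst z - 1/2" for z i
    using that by auto
  show "\<phi>t z = 0" by (rule vanish_on_boundary[OF continuous(2) 0(1) z])
  have "\<phi>x z $ i = 0" for i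
    by (rule vanish_on_boundary[OF _ 0(2) z]) (intro continuous_intros)
  then show "\<phi>x z = 0" by (simp add: vec_eq_iff)
qed

text \<open>\<open>sg\<close> has junk values on and outside the light cone. It is only multiplied with functions that vanish
  for \<open>\<bar>x\<bar> \<ge> t - 1/2\<close>, which makes the products smooth.\<close>

definition "sg z = 1 / mink (fst z) (snd z)"

text \<open>The relatively open sets |x| < t, where \<open>sg\<close> is continuous, and |x| > t -
  1/2, where the product vanishes, cover \<open>future\<close>.\<close>

lemma continuous_on_mult_sg:
  fixes F :: "real \<times> (real^3) \<Rightarrow> real"
  assumes F: "continuous_on future F"
    and 0: "\<And>z. z \<in> future \<Longrightarrow> norm (snd z) \<ge> fst z - 1/2 \<Longrightarrow> F z = 0"
  shows "continuous_on future (\<lambda>z. F z * sg z)"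
proof -
  let ?A = "{w :: real \<times> (real^3). norm (snd w) < fst w}" and ?V = "{w :: real \<times> (real^3). fst w - 1/2 < norm (snd w)}"
  have eq: "future = future \<inter> ?A \<union> future \<inter> ?V" by auto
  have "open ?A" "open ?V" by (intro open_Collect_less continuous_intros)+
  then have o: "openin (top_of_set (future \<inter> ?A \<union> future \<inter> ?V)) (future \<inter> ?A)"
    "openin (top_of_set (future \<inter> ?A \<union> future \<inter> ?V)) (future \<inter> ?V)"
    unfolding eq[symmetric] by (auto intro: openin_open_Int)
  have "continuous_on (future \<inter> ?A) (\<lambda>z. F z * sg z)"
    unfolding sg_def mink_def
    by (intro continuous_intros continuous_on_subset[OF F]) (auto simp: mem_Times_iff dest: mink_pos simp: mink_def)
  moreover have "continuous_on (future \<inter> ?V) (\<lambda>z. F z * sg z)"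
    by (rule continuous_on_eq[of _ "\<lambda>_. 0"]) (use 0 in auto)
  ultimately have "continuous_on (future \<inter> ?A \<union> future \<inter> ?V) (\<lambda>z. F z * sg z)"
    by (rule continuous_on_Un_local_open[OF o])
  then show ?thesis unfolding eq[symmetric] .
qed

text \<open>\<open>qt\<close> and \<open>qx\<close> are what the quotient rule gives. Every
  \<open>sg\<close> is attached to \<open>\<phi>\<close>, \<open>\<phi>t\<close> or
  \<open>\<phi>x\<close>, so that \<open>continuous_on_mult_sg\<close> applies, twice for the
  square.\<close>

definition "q z = \<phi> z * sg z"
definition "qt z = \<phi>t z * sg z - 2 * fst z * (\<phi> z * sg z * sg z)"
definition "qx z = sg z *\<^sub>R \<phi>x z + (2 * (\<phi> z * sg z * sg z)) *\<^sub>R snd z"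

lemma continuous_q [continuous_intros]:
  "continuous_on future q" "continuous_on future qt" "continuous_on future qx"
proof -
  have 1: "continuous_on future (\<lambda>z. \<phi> z * sg z)" "continuous_on future (\<lambda>z. \<phi>t z * sg z)"
    "continuous_on future (\<lambda>z. \<phi>x z $ i * sg z)" for i
    using finite_speed by (intro continuous_on_mult_sg continuous_intros; simp)+
  have 2: "continuous_on future (\<lambda>z. \<phi> z * sg z * sg z)"
    using finite_speed by (intro continuous_on_mult_sg 1; simp)
  show "continuous_on future q" "continuous_on future qt"
    unfolding q_def[abs_def] qt_def[abs_def] by (intro continuous_intros 1 2)+
  have "qx = (\<lambda>z. (\<chi> i. \<phi>x z $ i * sg z) + (2 * (\<phi> z * sg z * sg z)) *\<^sub>R snd z)"
    by (simp add: qx_def fun_eq_iff vec_eq_iff)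
  then show "continuous_on future qx"
    by (simp only:) (intro continuous_intros 1 2)
qed

text \<open>Inside the light cone this is the quotient rule; elsewhere the margin 1/2 in
  \<open>finite_speed\<close> makes q vanish near the point.\<close>

lemma gradient_q [has_gradient_intros]:
  assumes z: "z \<in> future"
  shows "has_gradient q (qt z) (qx z) (at z within future)"
proof (cases "norm (snd z) < fst z")
  case True
  then have m: "mink (fst z) (snd z) > 0" by (rule mink_pos)
  have mg: "has_gradient (\<lambda>z. fst z * fst z - (\<Sum>i\<in>UNIV. snd z $ i * snd z $ i)) (2 * fst z) (- 2 *\<^sub>R snd z) (at z within future)"
    by (rule has_gradient_eq, (rule has_gradient_intros)+)
      (simp_all add: vec_eq_iff sum_3 axis_def forall_3)
  have me: "(\<lambda>z. fst z * fst z - (\<Sum>i\<in>UNIV. snd z $ i * snd z $ i)) = (\<lambda>z. mink (fst z) (snd z))"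
    unfolding mink_def power2_norm_eq_inner inner_vec_def inner_real_def by (simp add: power2_eq_square)
  have "((\<lambda>u. 1 / u) has_real_derivative - (sg z * sg z)) (at (mink (fst z) (snd z)))"
    using m by (auto intro!: derivative_eq_intros simp: sg_def power2_eq_square)
  from has_gradient_compose[OF this mg[unfolded me]]
  have "has_gradient sg (- (sg z * sg z) * (2 * fst z)) (- (sg z * sg z) *\<^sub>R (- 2 *\<^sub>R snd z)) (at z within future)"
    unfolding sg_def[abs_def] .
  from has_gradient_mult[OF gradients(1)[OF z] this]
  show ?thesis
    unfolding q_def[abs_def] by (rule has_gradient_eq) (simp_all add: qt_def qx_def algebra_simps)
next
  case False
  from False have "fst z - 1/2 < norm (snd z)" by simp
  then obtain d where d: "d > 0" "\<And>w. dist w z < d \<Longrightarrow> fst w - 1/2 < norm (snd w)"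
    using outside_nbhd by blast
  have 0: "q w = 0" if "w \<in> future" "dist w z < d" for w
    using finite_speed(1)[of w] d(2)[of w] that by (simp add: q_def)
  have "((\<lambda>w. 0) has_derivative (\<lambda>h. 0)) (at z within future)" by simp
  then have "(q has_derivative (\<lambda>h. 0)) (at z within future)"
    by (rule has_derivative_transform_within[OF _ d(1) z]) (use 0 in auto)
  moreover have "qt z = 0" "qx z = 0"
    using finite_speed[OF z] False by (simp_all add: qt_def qx_def)
  ultimately show ?thesis unfolding has_gradient_def by simp
qed

text \<open>\<open>(ca, cb)\<close> is the gradient of \<open>\<Phi> = (t\<^sup>2 - \<bar>x\<bar>\<^sup>2) \<phi>\<close> divided by \<open>t\<^sup>2 - \<bar>x\<bar>\<^sup>2\<close>, and \<open>(J0, J)\<close> is the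
  current obtained by contracting its energy-momentum tensor with the conformal Killing field.
  A suffix \<open>_t\<close> or \<open>_x\<close> marks the time derivative and the spatial gradient.\<close>

definition "k0 z = fst z * fst z + (\<Sum>i\<in>UNIV. snd z $ i * snd z $ i)"
definition "ca z = \<phi>t z + 2 * fst z * q z"
definition "cb z = \<phi>x z - (2 * q z) *\<^sub>R snd z"
definition "ca_t z = \<phi>tt z + 2 * q z + 2 * fst z * qt z"
definition "ca_x z = \<phi>xt z + (2 * fst z) *\<^sub>R qx z"
definition "cb_t z = \<phi>tx z - (2 * qt z) *\<^sub>R snd z"
definition "cb_x i z = \<phi>xx i z - (2 * q z) *\<^sub>R axis i 1 - (2 * snd z $ i) *\<^sub>R qx z"
definition "cB z = (\<Sum>i\<in>UNIV. cb z $ i * cb z $ i)"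
definition "kb z = 2 * fst z * (\<Sum>i\<in>UNIV. snd z $ i * cb z $ i)"
definition "kb_t z = 2 * (\<Sum>i\<in>UNIV. snd z $ i * cb z $ i) + 2 * fst z * (\<Sum>i\<in>UNIV. snd z $ i * cb_t z $ i)"
definition "kb_x z = (2 * fst z) *\<^sub>R cb z + (2 * fst z) *\<^sub>R (\<Sum>i\<in>UNIV. snd z $ i *\<^sub>R cb_x i z)"
definition "J0 z = k0 z * ((ca z * ca z + cB z) * (1/2)) + ca z * kb z + k0 z * pot z"
definition "J z = - (k0 z * ca z + kb z) *\<^sub>R cb z + (fst z * (cB z - ca z * ca z) + 2 * fst z * pot z) *\<^sub>R snd z"
definition "J0_t z = fst z * (ca z * ca z + cB z) + k0 z * (ca z * ca_t z + (\<Sum>i\<in>UNIV. cb z $ i * cb_t z $ i))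
  + ca_t z * kb z + ca z * kb_t z + 2 * fst z * pot z + k0 z * (nonlin z * \<phi>t z)"
definition "J0_x z = (ca z * ca z + cB z) *\<^sub>R snd z + k0 z *\<^sub>R (ca z *\<^sub>R ca_x z + (\<Sum>i\<in>UNIV. cb z $ i *\<^sub>R cb_x i z))
  + kb z *\<^sub>R ca_x z + ca z *\<^sub>R kb_x z + (2 * pot z) *\<^sub>R snd z + (k0 z * nonlin z) *\<^sub>R \<phi>x z"
definition "J_t z = - (2 * fst z * ca z + k0 z * ca_t z + kb_t z) *\<^sub>R cb z - (k0 z * ca z + kb z) *\<^sub>R cb_t z
  + (cB z - ca z * ca z + 2 * fst z * ((\<Sum>i\<in>UNIV. cb z $ i * cb_t z $ i) - ca z * ca_t z)
     + 2 * pot z + 2 * fst z * (nonlin z * \<phi>t z)) *\<^sub>R snd z"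
definition "J_x i z = - (cb z $ i) *\<^sub>R ((2 * ca z) *\<^sub>R snd z + k0 z *\<^sub>R ca_x z + kb_x z) - (k0 z * ca z + kb z) *\<^sub>R cb_x i z
  + (fst z * (cB z - ca z * ca z) + 2 * fst z * pot z) *\<^sub>R axis i 1
  + (snd z $ i) *\<^sub>R ((2 * fst z) *\<^sub>R ((\<Sum>j\<in>UNIV. cb z $ j *\<^sub>R cb_x j z) - ca z *\<^sub>R ca_x z) + (2 * fst z * nonlin z) *\<^sub>R \<phi>x z)"

lemma continuous_conformal [continuous_intros]:
  "continuous_on future k0" "continuous_on future ca" "continuous_on future cb" "continuous_on future ca_t"
  "continuous_on future ca_x" "continuous_on future cb_t" "continuous_on future (cb_x i)" "continuous_on future cB"
  unfolding k0_def[abs_def] ca_def[abs_def] cb_def[abs_def] ca_t_def[abs_def] ca_x_def[abs_def] cb_t_def[abs_def]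
    cb_x_def[abs_def] cB_def[abs_def]
  by (intro continuous_intros)+

lemma continuous_kb [continuous_intros]:
  "continuous_on future kb" "continuous_on future kb_t" "continuous_on future kb_x"
  unfolding kb_def[abs_def] kb_t_def[abs_def] kb_x_def[abs_def] by (intro continuous_intros)+

lemma continuous_J: "continuous_on future J0" "continuous_on future J0_t" "continuous_on future J_t" "continuous_on future (J_x i)"
  unfolding J0_def[abs_def] J0_t_def[abs_def] J_t_def[abs_def] J_x_def[abs_def] by (intro continuous_intros)+

lemma gradient_conformal [has_gradient_intros]:
  assumes z: "z \<in> future"
  shows "has_gradient k0 (2 * fst z) (2 *\<^sub>R snd z) (at z within future)"
    "has_gradient ca (ca_t z) (ca_x z) (at z within future)"
    "has_gradient (\<lambda>z. cb z $ i) (cb_t z $ i) (cb_x i z) (at z within future)"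
proof -
  show "has_gradient k0 (2 * fst z) (2 *\<^sub>R snd z) (at z within future)"
    unfolding k0_def[abs_def]
    by (rule has_gradient_eq, (rule has_gradient_intros)+) (simp_all add: vec_eq_iff sum_3 axis_def forall_3)
  show "has_gradient ca (ca_t z) (ca_x z) (at z within future)"
    unfolding ca_def[abs_def]
    by (rule has_gradient_eq, (rule has_gradient_intros z)+) (simp_all add: ca_t_def ca_x_def)
  have "has_gradient (\<lambda>z. \<phi>x z $ i - 2 * q z * snd z $ i) (cb_t z $ i) (cb_x i z) (at z within future)"
    by (rule has_gradient_eq, (rule has_gradient_intros z)+) (simp_all add: cb_t_def cb_x_def algebra_simps)
  then show "has_gradient (\<lambda>z. cb z $ i) (cb_t z $ i) (cb_x i z) (at z within future)"
    unfolding cb_def by simp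
qed

lemma gradient_cB_kb [has_gradient_intros]:
  assumes z: "z \<in> future"
  shows "has_gradient cB (2 * (\<Sum>i\<in>UNIV. cb z $ i * cb_t z $ i)) (2 *\<^sub>R (\<Sum>i\<in>UNIV. cb z $ i *\<^sub>R cb_x i z)) (at z within future)"
    "has_gradient kb (kb_t z) (kb_x z) (at z within future)"
proof -
  show "has_gradient cB (2 * (\<Sum>i\<in>UNIV. cb z $ i * cb_t z $ i)) (2 *\<^sub>R (\<Sum>i\<in>UNIV. cb z $ i *\<^sub>R cb_x i z)) (at z within future)"
    unfolding cB_def[abs_def]
    by (rule has_gradient_eq, (rule has_gradient_intros z)+) (simp_all add: vec_eq_iff sum_3)
  show "has_gradient kb (kb_t z) (kb_x z) (at z within future)"
    unfolding kb_def[abs_def]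
    by (rule has_gradient_eq, (rule has_gradient_intros z)+)
      (simp_all add: kb_t_def kb_x_def vec_eq_iff sum_3 axis_def forall_3 algebra_simps)
qed

lemma gradient_J:
  assumes z: "z \<in> future"
  shows "has_gradient J0 (J0_t z) (J0_x z) (at z within future)"
    "has_gradient (\<lambda>z. J z $ i) (J_t z $ i) (J_x i z) (at z within future)"
proof -
  show "has_gradient J0 (J0_t z) (J0_x z) (at z within future)"
    unfolding J0_def[abs_def]
    by (rule has_gradient_eq, (rule has_gradient_intros z)+)
      (simp add: J0_t_def algebra_simps, simp add: J0_x_def vec_eq_iff algebra_simps)
  have "has_gradient (\<lambda>z. - (k0 z * ca z + kb z) * cb z $ i + (fst z * (cB z - ca z * ca z) + 2 * fst z * pot z) * snd z $ i)
      (J_t z $ i) (J_x i z) (at z within future)"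
    by (rule has_gradient_eq, (rule has_gradient_intros z)+)
      (simp add: J_t_def algebra_simps, simp add: J_x_def vec_eq_iff algebra_simps)
  then show "has_gradient (\<lambda>z. J z $ i) (J_t z $ i) (J_x i z) (at z within future)"
    unfolding J_def by simp
qed

lemma nonlin_times: "nonlin z * \<phi> z = (p + 1) * pot z"
proof -
  have "\<bar>\<phi> z\<bar> powr (p + 1) = \<bar>\<phi> z\<bar> powr (p - 1) * \<bar>\<phi> z\<bar>\<^sup>2"
  proof (cases "\<phi> z = 0")
    case False
    have e: "p + 1 = (p - 1) + 2" by simp
    have "\<bar>\<phi> z\<bar> powr (p + 1) = \<bar>\<phi> z\<bar> powr (p - 1) * \<bar>\<phi> z\<bar> powr 2"
      unfolding e by (rule powr_add)
    then show ?thesis using False by (simp add: powr_numeral)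
  qed simp
  then show ?thesis using p unfolding nonlin_def pot_def by (simp add: power2_eq_square)
qed

text \<open>The divergence equals -2 (p - 3) t \<open>pot\<close>, which has a sign for p >= 3. The
  kinetic part is \<open>conformal_current_algebra\<close>. The potential contributes 8 t
  \<open>pot\<close>, since the Killing field has divergence 2 t + 6 t, against -2 (p + 1) t
  \<open>pot\<close> from the nonlinearity.\<close>

lemma divergence_J:
  assumes z: "fst z > 1"
  shows "J0_t z + (\<Sum>i\<in>UNIV. J_x i z $ i) \<le> 0"
proof (cases "norm (snd z) < fst z")
  case False
  have "z \<in> future" using z by (simp add: mem_Times_iff)
  then have 0: "\<phi> z = 0" "\<phi>t z = 0" "\<phi>x z = 0"
    using finite_speed[of z] False by auto
  then have "q z = 0" "pot z = 0" "nonlin z = 0" "ca z = 0" "cb z = 0"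
    by (simp_all add: q_def pot_def nonlin_def ca_def cb_def)
  then show ?thesis
    unfolding J0_t_def J_x_def by (simp add: cB_def kb_def kb_x_def 0)
next
  case True
  have zf: "z \<in> future" using z by (simp add: mem_Times_iff)
  obtain t x where tx: "z = (t, x)" by force
  have m: "mink t x > 0" using True mink_pos unfolding tx by simp
  have sg: "sg z * (t\<^sup>2 - (x$1)\<^sup>2 - (x$2)\<^sup>2 - (x$3)\<^sup>2) = 1"
  proof -
    have "mink t x = t\<^sup>2 - (x$1)\<^sup>2 - (x$2)\<^sup>2 - (x$3)\<^sup>2"
      unfolding mink_def power2_norm_eq_inner by (simp add: inner_vec_def sum_3 power2_eq_square)
    then show ?thesis using m unfolding sg_def tx by simp
  qed
  have \<phi>q: "\<phi> z = q z * (t\<^sup>2 - (x$1)\<^sup>2 - (x$2)\<^sup>2 - (x$3)\<^sup>2)"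
    using sg unfolding q_def by (simp add: mult.assoc)
  have qsg: "q z = \<phi> z * sg z" by (rule q_def)
  have fz: "fst z = t" "snd z = x" using tx by simp_all
  have qt: "qt z = sg z * (\<phi>t z - 2 * t * q z)"
    unfolding qt_def qsg fz by (simp add: algebra_simps)
  have qx: "qx z $ i = sg z * (\<phi>x z $ i + 2 * x$i * q z)" for i
    unfolding qx_def qsg fz by (simp add: algebra_simps)
  have wave: "\<phi>tt z = \<phi>xx 1 z $ 1 + \<phi>xx 2 z $ 2 + \<phi>xx 3 z $ 3 - nonlin z"
    using wave_equation[OF zf] by (simp add: sum_3)
  have R1: "ca_t z = cb_x 1 z $ 1 + cb_x 2 z $ 2 + cb_x 3 z $ 3
      + 2 * sg z * (t * ca z + x$1 * cb z $ 1 + x$2 * cb z $ 2 + x$3 * cb z $ 3) - nonlin z"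
  proof -
    have "ca_t z - (cb_x 1 z $ 1 + cb_x 2 z $ 2 + cb_x 3 z $ 3
      + 2 * sg z * (t * ca z + x$1 * cb z $ 1 + x$2 * cb z $ 2 + x$3 * cb z $ 3) - nonlin z)
      = 8 * q z * (1 - sg z * (t\<^sup>2 - (x$1)\<^sup>2 - (x$2)\<^sup>2 - (x$3)\<^sup>2))"
      unfolding ca_t_def cb_x_def ca_def cb_def wave
      by (simp add: qt qx fz axis_def) (simp add: algebra_simps power2_eq_square)
    then show ?thesis using sg by simp
  qed
  have R2: "cb_t z $ i = ca_x z $ i - 2 * sg z * (x$i * ca z + t * cb z $ i)" for i
    unfolding cb_t_def ca_x_def ca_def cb_def mixed_partials(1)[OF z]
    by (simp add: qt qx fz) (simp add: algebra_simps)
  have R3: "cb_x i z $ j - cb_x j z $ i = 2 * sg z * (x$j * cb z $ i - x$i * cb z $ j)" for i j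
    unfolding cb_x_def cb_def
    using mixed_partials(2)[OF z, of i j] by (simp add: qx fz axis_def) (simp add: algebra_simps)
  note alg = conformal_current_algebra[OF sg R1 R2 R3]
  \<comment> \<open>The Killing field applied to \<phi>, in terms of \<open>ca\<close> and
    \<open>cb\<close>: the conformal factor in \<Phi> costs the zeroth-order term 2 t
    \<phi>.\<close>
  have pot: "k0 z * \<phi>t z + 2 * t * (x$1 * \<phi>x z $ 1 + x$2 * \<phi>x z $ 2 + x$3 * \<phi>x z $ 3)
      = k0 z * ca z + kb z - 2 * t * \<phi> z"
    unfolding \<phi>q k0_def kb_def ca_def cb_def fz by (simp add: sum_3) (simp add: algebra_simps power2_eq_square)
  have "J0_t z + (\<Sum>i\<in>UNIV. J_x i z $ i) = - nonlin z * (k0 z * ca z + kb z) + 8 * t * pot z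
      + nonlin z * (k0 z * \<phi>t z + 2 * t * (x$1 * \<phi>x z $ 1 + x$2 * \<phi>x z $ 2 + x$3 * \<phi>x z $ 3))"
    using alg unfolding J0_t_def J_x_def kb_t_def kb_x_def cB_def kb_def k0_def tx
    by (simp add: sum_3 axis_def power2_eq_square) (simp add: algebra_simps)
  also have "\<dots> = 8 * t * pot z - 2 * t * (nonlin z * \<phi> z)"
    unfolding pot by (simp add: algebra_simps)
  also have "\<dots> = - (2 * (p - 3)) * t * pot z"
    unfolding nonlin_times by (simp add: algebra_simps)
  also have "\<dots> \<le> 0"
    using p pot_nonneg[of z] z tx by (auto intro!: mult_nonpos_nonneg)
  finally show ?thesis .
qed

subsection \<open>Conformal energy on backward null cones\<close>

lemma J_outside:
  assumes "z \<in> future" "norm (snd z) \<ge> fst z - 1/2"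
  shows "J z = 0" "J0 z = 0" "pot z = 0"
proof -
  have 0: "\<phi> z = 0" "\<phi>t z = 0" "\<phi>x z = 0" using finite_speed[OF assms] by auto
  then have 1: "q z = 0" "pot z = 0" "ca z = 0" "cb z = 0"
    by (simp_all add: q_def pot_def ca_def cb_def)
  then show "J z = 0" "J0 z = 0" "pot z = 0"
    by (simp_all add: J_def J0_def cB_def kb_def)
qed

text \<open>The Killing field is causal, as 2 t |x| <= t^2 + |x|^2, so
  \<open>energy_flux_nonneg\<close> disposes of the quadratic terms and only the potential
  remains.\<close>

lemma J_dominates_pot:
  assumes z: "z \<in> future" and v: "norm v \<le> 1"
  shows "J0 z + v \<bullet> J z \<ge> (k0 z + 2 * fst z * (v \<bullet> snd z)) * pot z"
proof -
  have k0: "k0 z = (fst z)\<^sup>2 + (norm (snd z))\<^sup>2"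
    unfolding k0_def power2_norm_eq_inner inner_vec_def by (simp add: power2_eq_square)
  have cB: "cB z = cb z \<bullet> cb z" unfolding cB_def inner_vec_def by simp
  have kb: "kb z = ((2 * fst z) *\<^sub>R snd z) \<bullet> cb z" unfolding kb_def inner_vec_def by (simp add: sum_distrib_left mult.assoc)
  have "norm ((2 * fst z) *\<^sub>R snd z) \<le> k0 z"
    using z sum_squares_bound[of "fst z" "norm (snd z)"] unfolding k0 by (simp add: mem_Times_iff)
  from energy_flux_nonneg[OF this v, of "ca z" "cb z"]
  show ?thesis
    unfolding J0_def J_def cB kb by (simp add: inner_add_right inner_diff_right algebra_simps power2_eq_square add_divide_distrib diff_divide_distrib)
qed

definition "energy = (\<integral>y. J0 (1, y) \<partial>lborel)"

lemma energy_eq: "R \<ge> 1/2 \<Longrightarrow> integral (cbox (- R *\<^sub>R One) (R *\<^sub>R One)) (\<lambda>y. J0 (1, y)) = energy"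
  unfolding energy_def
proof (rule lebesgue_integral_eq_integral_cbox(2)[symmetric])
  show "continuous_on UNIV (\<lambda>y. J0 (1, y))"
    by (intro continuous_on_compose2[OF continuous_J(1)] continuous_intros) auto
  fix y :: "real^3" assume "R \<ge> 1/2" "y \<notin> cbox (- R *\<^sub>R One) (R *\<^sub>R One)"
  then have "norm y > 1/2" using cball_subset_cbox_One[of R] by (force simp: not_le)
  then show "J0 (1, y) = 0" by (intro J_outside) auto
qed

lemma energy_nonneg: "energy \<ge> 0"
proof -
  have "J0 (1, y) \<ge> 0" for y
    using J_dominates_pot[of "(1, y)" 0] pot_nonneg[of "(1, y)"]
    by (simp add: k0_def) (smt (verit, best) mult_nonneg_nonneg sum_nonneg zero_le_square)
  then show ?thesis unfolding energy_def by (intro Bochner_Integration.integral_nonneg)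
qed

text \<open>Continuity on \<open>future\<close> says nothing about earlier times, so measurability
  is claimed for the product with the indicator.\<close>

lemma measurable_on_future [measurable]:
  fixes F :: "real \<times> (real^3) \<Rightarrow> real"
  assumes "continuous_on future F"
  shows "(\<lambda>z. indicator future z * F z) \<in> borel_measurable (borel \<Otimes>\<^sub>M borel)"
proof -
  have "(\<lambda>z. indicator future z *\<^sub>R F z) \<in> borel_measurable borel"
    by (rule borel_measurable_continuous_on_indicator[OF _ assms]) (auto intro!: borel_closed closed_Times)
  then show ?thesis by (simp add: borel_prod)
qed

text \<open>With smoothing width 1/2 the surface agrees with the hyperboloid wherever the latter
  lies above 3/2, and the rest of the flux is nonnegative and is dropped. The threshold 3/2 is also
  where the cutoff of the representation formula reaches 1.\<close>

lemma hyperboloid_energy: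
  fixes x :: "real^3" and t :: real
  assumes \<epsilon>: "\<epsilon> > 0"
  defines "\<rho> \<equiv> \<lambda>y. sqrt ((norm (y - x))\<^sup>2 + \<epsilon>\<^sup>2)"
  defines "\<tau> \<equiv> \<lambda>y. t - \<rho> y"
  shows "(\<integral>\<^sup>+y. ennreal (((\<tau> y)\<^sup>2 + (norm y)\<^sup>2 + 2 * \<tau> y * ((y - x) \<bullet> y) / \<rho> y) * pot (\<tau> y, y))
      * indicator {y. \<tau> y > 3/2} y \<partial>lborel) \<le> ennreal energy"
proof -
  define \<theta> where "\<theta> = (\<lambda>y. soft_max (1/2) (t - \<rho> y))"
  define \<xi> where "\<xi> = (\<lambda>y. (soft_max' (1/2) (t - \<rho> y) / \<rho> y) *\<^sub>R (y - x))"
  \<comment> \<open>The surface stays below R + 1/2, so beyond radius R it lies where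
    \<open>J_outside\<close> applies.\<close>
  define R where "R = max 1 t"
  define B where "B = cbox (- R *\<^sub>R One) (R *\<^sub>R One :: real^3)"
  have \<rho>: "\<rho> y \<ge> 0" for y unfolding \<rho>_def by simp
  have half: "(1/2::real) > 0" by simp
  have \<theta>R: "\<theta> y \<le> R + 1/2" and \<theta>1: "\<theta> y \<ge> 1" for y
    using soft_max_le[OF half, of "t - \<rho> y"] soft_max_ge_1[OF half] \<rho>[of y] unfolding \<theta>_def R_def
    by (auto simp: max_def split: if_splits)
  have supp: "J (s, y) = 0" if "norm y > R" "1 \<le> s" "s \<le> \<theta> y" for y s
    using that \<theta>R[of y] by (intro J_outside) auto
  have supp': "soft_max (1/2) (t - sqrt ((norm (y - x))\<^sup>2 + \<epsilon>\<^sup>2)) = 1 \<or> J (s, y) = 0"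
    if "norm y > R" "1 \<le> s" "s \<le> soft_max (1/2) (t - sqrt ((norm (y - x))\<^sup>2 + \<epsilon>\<^sup>2))" for y s
    using supp[OF that(1,2)] that(3) unfolding \<theta>_def \<rho>_def by simp
  note fl = hyperboloid_flux[where ?J0.0=J0 and J=J and R=R, OF gradient_J continuous_J(2-4) divergence_J \<epsilon> half supp']
  have cI: "continuous_on UNIV (\<lambda>y. J0 (\<theta> y, y) + \<xi> y \<bullet> J (\<theta> y, y))"
    and \<xi>: "norm (\<xi> y) \<le> 1"
    and le: "integral B (\<lambda>y. J0 (\<theta> y, y) + \<xi> y \<bullet> J (\<theta> y, y)) \<le> integral B (\<lambda>y. J0 (1, y))" for y
    unfolding \<theta>_def \<xi>_def \<rho>_def B_def by (rule fl; assumption)+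
  have "R \<ge> 1/2" unfolding R_def by simp
  then have le': "integral B (\<lambda>y. J0 (\<theta> y, y) + \<xi> y \<bullet> J (\<theta> y, y)) \<le> energy"
    using le energy_eq[of R] unfolding B_def by simp
  let ?I = "\<lambda>y. J0 (\<theta> y, y) + \<xi> y \<bullet> J (\<theta> y, y)"
  have dom: "(k0 (\<theta> y, y) + 2 * \<theta> y * (\<xi> y \<bullet> y)) * pot (\<theta> y, y) \<le> ?I y" for y
    using J_dominates_pot[OF _ \<xi>, of "(\<theta> y, y)" y] \<theta>1[of y] by simp
  have wt: "k0 (s, y) + 2 * s * (v \<bullet> y) \<ge> 0" if "norm v \<le> 1" "s \<ge> 0" for s and y v :: "real^3"
  proof -
    have "\<bar>v \<bullet> y\<bar> \<le> 1 * norm y"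
      using Cauchy_Schwarz_ineq2[of v y] mult_right_mono[OF that(1) norm_ge_zero[of y]] by linarith
    then have "2 * s * (v \<bullet> y) \<ge> 2 * s * - norm y" using that(2) by (intro mult_left_mono) auto
    moreover have "2 * s * norm y \<le> s\<^sup>2 + (norm y)\<^sup>2" by (rule sum_squares_bound)
    moreover have "k0 (s, y) = s\<^sup>2 + (norm y)\<^sup>2"
      unfolding k0_def power2_norm_eq_inner inner_vec_def by (simp add: power2_eq_square)
    ultimately show ?thesis by simp
  qed
  have nonneg: "?I y \<ge> 0" for y
    using dom[of y] mult_nonneg_nonneg[OF wt[OF \<xi>[of y], of "\<theta> y" y] pot_nonneg[of "(\<theta> y, y)"]] \<theta>1[of y] by linarith
  have "(\<integral>\<^sup>+y. ennreal (((\<tau> y)\<^sup>2 + (norm y)\<^sup>2 + 2 * \<tau> y * ((y - x) \<bullet> y) / \<rho> y) * pot (\<tau> y, y))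
      * indicator {y. \<tau> y > 3/2} y \<partial>lborel) \<le> (\<integral>\<^sup>+y. ennreal (?I y) * indicator B y \<partial>lborel)"
  proof (rule nn_integral_mono)
    fix y :: "real^3"
    show "ennreal (((\<tau> y)\<^sup>2 + (norm y)\<^sup>2 + 2 * \<tau> y * ((y - x) \<bullet> y) / \<rho> y) * pot (\<tau> y, y))
      * indicator {y. \<tau> y > 3/2} y \<le> ennreal (?I y) * indicator B y"
    proof (cases "\<tau> y > 3/2")
      case True
      then have eq: "\<theta> y = \<tau> y" "\<xi> y = (1 / \<rho> y) *\<^sub>R (y - x)"
        using soft_max_eq_id[OF half, of "t - \<rho> y"] unfolding \<theta>_def \<xi>_def \<tau>_def by auto
      have k: "k0 (\<tau> y, y) = (\<tau> y)\<^sup>2 + (norm y)\<^sup>2"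
        unfolding k0_def power2_norm_eq_inner inner_vec_def by (simp add: power2_eq_square)
      show ?thesis
      proof (cases "y \<in> B")
        case B: True
        have "((\<tau> y)\<^sup>2 + (norm y)\<^sup>2 + 2 * \<tau> y * ((y - x) \<bullet> y) / \<rho> y) * pot (\<tau> y, y) \<le> ?I y"
          using dom[of y] unfolding eq k by simp
        with B True show ?thesis by (simp add: ennreal_leI)
      next
        case False
        then have "norm y > R" unfolding B_def using cball_subset_cbox_One[of R] by (force simp: not_le)
        then have "pot (\<tau> y, y) = 0"
          using \<theta>R[of y] True eq by (intro J_outside) auto
        then show ?thesis by simp
      qed
    qed simp
  qed
  also have "\<dots> = ennreal (integral B ?I)"
  proof (rule nn_integral_has_integral_lebesgue')
    show "(?I has_integral integral B ?I) B"
      unfolding B_def by (intro integrable_integral integrable_continuous continuous_on_subset[OF cI]) simp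
  qed (rule nonneg)
  also have "\<dots> \<le> ennreal energy" using le' by (rule ennreal_leI)
  finally show ?thesis .
qed

text \<open>Fatou's lemma along hyperboloids that shrink to the cone.\<close>

lemma cone_energy:
  "(\<integral>\<^sup>+y. ennreal (cone_wt t x y * pot (ret t x y, y)) * indicator {y. y \<noteq> x \<and> ret t x y > 3/2} y \<partial>lborel)
    \<le> ennreal energy"
proof -
  define eps where "eps = (\<lambda>n. 1 / real (Suc n))"
  define \<rho> where "\<rho> = (\<lambda>n y. sqrt ((norm (y - x))\<^sup>2 + (eps n)\<^sup>2))"
  define \<tau> where "\<tau> = (\<lambda>n y. t - \<rho> n y)"
  define w where "w = (\<lambda>n y. ((\<tau> n y)\<^sup>2 + (norm y)\<^sup>2 + 2 * \<tau> n y * ((y - x) \<bullet> y) / \<rho> n y))"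
  define u where "u = (\<lambda>n y. ennreal (w n y * pot (\<tau> n y, y)) * indicator {y. \<tau> n y > 3/2} y)"
  have eps: "eps n > 0" "eps \<longlonglongrightarrow> 0" for n
    unfolding eps_def using LIMSEQ_inverse_real_of_nat by (simp_all add: inverse_eq_divide)
  have le: "(\<integral>\<^sup>+y. u n y \<partial>lborel) \<le> ennreal energy" for n
    using hyperboloid_energy[OF eps(1)[of n], where x=x and t=t] unfolding u_def w_def \<tau>_def \<rho>_def .
  have m[measurable]: "u n \<in> borel_measurable borel" for n
  proof -
    have [measurable]: "\<rho> n \<in> borel_measurable borel" unfolding \<rho>_def by measurable
    have [measurable]: "\<tau> n \<in> borel_measurable borel" unfolding \<tau>_def by measurable
    have "(\<lambda>y. (\<lambda>z. indicator future z * pot z) (\<tau> n y, y)) \<in> borel_measurable borel"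
      by (rule measurable_compose[OF _ measurable_on_future[OF continuous_nonlin(2)]]) measurable
    then have [measurable]: "(\<lambda>y. indicator future (\<tau> n y, y) * pot (\<tau> n y, y)) \<in> borel_measurable borel" .
    have "u n = (\<lambda>y. ennreal (w n y * (indicator future (\<tau> n y, y) * pot (\<tau> n y, y))) * indicator {y. \<tau> n y > 3/2} y)"
      unfolding u_def by (auto simp: fun_eq_iff indicator_def)
    moreover have "(\<lambda>y. ennreal (w n y * (indicator future (\<tau> n y, y) * pot (\<tau> n y, y))) * indicator {y. \<tau> n y > 3/2} y)
        \<in> borel_measurable borel"
      unfolding w_def by measurable
    ultimately show ?thesis by simp
  qed
  have "(\<integral>\<^sup>+y. ennreal (cone_wt t x y * pot (ret t x y, y)) * indicator {y. y \<noteq> x \<and> ret t x y > 3/2} y \<partial>lborel)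
      \<le> (\<integral>\<^sup>+y. liminf (\<lambda>n. u n y) \<partial>lborel)"
  proof (rule nn_integral_mono)
    fix y :: "real^3"
    show "ennreal (cone_wt t x y * pot (ret t x y, y)) * indicator {y. y \<noteq> x \<and> ret t x y > 3/2} y \<le> liminf (\<lambda>n. u n y)"
    proof (cases "y \<noteq> x \<and> ret t x y > 3/2")
      case True
      have \<rho>: "(\<lambda>n. \<rho> n y) \<longlonglongrightarrow> norm (y - x)"
      proof -
        have "(\<lambda>n. \<rho> n y) \<longlonglongrightarrow> sqrt ((norm (y - x))\<^sup>2 + 0\<^sup>2)"
          unfolding \<rho>_def by (intro tendsto_intros eps)
        then show ?thesis by simp
      qed
      then have \<tau>: "(\<lambda>n. \<tau> n y) \<longlonglongrightarrow> ret t x y"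
        unfolding \<tau>_def ret_def by (intro tendsto_intros)
      have ev: "\<forall>\<^sub>F n in sequentially. \<tau> n y > 3/2"
        by (rule order_tendstoD(1)[OF \<tau>]) (use True in simp)
      have "(\<lambda>n. pot (\<tau> n y, y)) \<longlonglongrightarrow> pot (ret t x y, y)"
        using True ev
        by (intro continuous_on_tendsto_compose[OF continuous_nonlin(2)] tendsto_intros \<tau>)
          (auto elim!: eventually_mono)
      then have "(\<lambda>n. w n y * pot (\<tau> n y, y)) \<longlonglongrightarrow>
          ((ret t x y)\<^sup>2 + (norm y)\<^sup>2 + 2 * ret t x y * ((y - x) \<bullet> y) / norm (y - x)) * pot (ret t x y, y)"
        unfolding w_def using True by (intro tendsto_intros \<tau> \<rho>) auto
      also have "((ret t x y)\<^sup>2 + (norm y)\<^sup>2 + 2 * ret t x y * ((y - x) \<bullet> y) / norm (y - x)) = cone_wt t x y"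
      proof -
        have "(y - x) \<bullet> y = - (y \<bullet> (x - y))" by (simp add: inner_diff_left inner_diff_right inner_commute)
        then show ?thesis unfolding cone_wt_def by (simp add: norm_minus_commute)
      qed
      finally have "(\<lambda>n. ennreal (w n y * pot (\<tau> n y, y))) \<longlonglongrightarrow> ennreal (cone_wt t x y * pot (ret t x y, y))"
        by (rule tendsto_ennrealI)
      then have "(\<lambda>n. u n y) \<longlonglongrightarrow> ennreal (cone_wt t x y * pot (ret t x y, y))"
        by (rule Lim_transform_eventually) (use ev in \<open>auto simp: u_def elim!: eventually_mono\<close>)
      then have "liminf (\<lambda>n. u n y) = ennreal (cone_wt t x y * pot (ret t x y, y))"
        by (intro lim_imp_Liminf) auto
      then show ?thesis using True by simp
    qed simp
  qed
  also have "\<dots> \<le> liminf (\<lambda>n. \<integral>\<^sup>+y. u n y \<partial>lborel)"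
    by (rule nn_integral_liminf) measurable
  also have "\<dots> \<le> limsup (\<lambda>n. \<integral>\<^sup>+y. u n y \<partial>lborel)"
    by (rule Liminf_le_Limsup) simp
  also have "\<dots> \<le> ennreal energy"
    by (rule Limsup_bounded) (use le in auto)
  finally show ?thesis .
qed

end

subsection \<open>The retarded representation\<close>

text \<open>The cutoff is a cubic B-spline distribution function: it is twice continuously differentiable,
  \<open>0\<close> before \<open>5/4\<close> and \<open>1\<close> after \<open>3/2\<close>.\<close>

definition spline :: "nat \<Rightarrow> real \<Rightarrow> real" where
  "spline k t = max (t - 5/4) 0 ^ k - 3 * max (t - 4/3) 0 ^ k + 3 * max (t - 17/12) 0 ^ k - max (t - 3/2) 0 ^ k"

text \<open>The knots are 1/12 apart, so the third difference of t^3 beyond the last knot is 6/12^3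
  = 1/288.\<close>

definition cut :: "real \<Rightarrow> real" where "cut t = 288 * spline 3 t"
definition cut' :: "real \<Rightarrow> real" where "cut' t = 864 * spline 2 t"
definition cut'' :: "real \<Rightarrow> real" where "cut'' t = 1728 * spline 1 t"

lemma DERIV_spline: "(spline (Suc (Suc k)) has_real_derivative real (Suc (Suc k)) * spline (Suc k) t) (at t)"
proof -
  have *: "((\<lambda>t. max (t - a) 0 ^ Suc (Suc k)) has_real_derivative real (Suc (Suc k)) * max (t - a) 0 ^ Suc k) (at t)" for a
  proof -
    have "((\<lambda>t. t - a) has_real_derivative 1) (at t)" by (auto intro!: derivative_eq_intros)
    from DERIV_chain2[where f="\<lambda>z. max z 0 ^ Suc (Suc k)" and g="\<lambda>z. z - a", OF DERIV_max0_power this]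
    show ?thesis by simp
  qed
  show ?thesis
    unfolding spline_def[abs_def]
    by (rule DERIV_cong[OF DERIV_diff[OF DERIV_add[OF DERIV_diff[OF * DERIV_cmult[OF *]] DERIV_cmult[OF *]] *]])
      (simp add: algebra_simps)
qed

lemma DERIV_cut: "(cut has_real_derivative cut' t) (at t)" "(cut' has_real_derivative cut'' t) (at t)"
  using DERIV_cmult[OF DERIV_spline[of 1 t], of 288] DERIV_cmult[OF DERIV_spline[of 0 t], of 864]
  unfolding cut_def[abs_def] cut'_def[abs_def] cut''_def by (simp_all add: numeral_2_eq_2 numeral_3_eq_3)

lemma cut_past: "t \<le> 5/4 \<Longrightarrow> cut t = 0" "t \<le> 5/4 \<Longrightarrow> cut' t = 0" "t \<le> 5/4 \<Longrightarrow> cut'' t = 0"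
  unfolding cut_def cut'_def cut''_def spline_def by (simp_all add: max_def)

lemma cut_future:
  assumes "t \<ge> 3/2" shows "cut t = 1" "cut' t = 0" "cut'' t = 0"
proof -
  have m: "max (t - 5/4) 0 = t - 5/4" "max (t - 4/3) 0 = t - 4/3" "max (t - 17/12) 0 = t - 17/12" "max (t - 3/2) 0 = t - 3/2"
    using assms by auto
  show "cut t = 1" "cut' t = 0" "cut'' t = 0"
    unfolding cut_def cut'_def cut''_def spline_def m by (simp_all add: power2_eq_square power3_eq_cube field_simps)
qed

lemma continuous_on_cut: "continuous_on S cut" "continuous_on S cut'" "continuous_on S cut''"
  unfolding cut_def[abs_def] cut'_def[abs_def] cut''_def[abs_def] spline_def by (intro continuous_intros)+

text \<open>\<open>F\<close> is differentiable after time 1 and \<open>X\<close> vanishes up to 5/4;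
  the overlap of these time ranges makes the product differentiable on all of spacetime.\<close>

lemma has_gradient_cutoff:
  assumes X: "\<And>t. (X has_real_derivative X' t) (at t)" "\<And>t. t \<le> 5/4 \<Longrightarrow> X t = 0" "\<And>t. t \<le> 5/4 \<Longrightarrow> X' t = 0"
    and F: "\<And>z. fst z > 1 \<Longrightarrow> has_gradient F (a z) (b z) (at z)"
  shows "has_gradient (\<lambda>z. X (fst z) * F z) (X' (fst z) * F z + X (fst z) * a z) (X (fst z) *\<^sub>R b z) (at z)"
proof (cases "fst z > 1")
  case True
  have "has_gradient (\<lambda>z. X (fst z)) (X' (fst z) * 1) (X' (fst z) *\<^sub>R 0) (at z)"
    by (rule has_gradient_compose[OF X(1) has_gradient_fst])
  from has_gradient_mult[OF this F[OF True]] show ?thesis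
    by (rule has_gradient_eq) simp_all
next
  case False
  have "open ({..<(5/4::real)} \<times> UNIV)"
    by (intro open_Times open_lessThan open_UNIV)
  then have "((\<lambda>z. X (fst z) * F z) has_derivative (\<lambda>h. 0)) (at z)"
    by (rule has_derivative_transform_within_open[OF has_derivative_const[of 0]])
      (use False X(2) in \<open>auto simp: mem_Times_iff\<close>)
  then show ?thesis using False X(2,3)[of "fst z"] unfolding has_gradient_def by simp
qed

lemma continuous_on_cutoff:
  fixes F :: "real \<times> (real^3) \<Rightarrow> 'b::real_normed_vector"
  assumes X: "continuous_on UNIV X" "\<And>t. t \<le> 5/4 \<Longrightarrow> X t = 0" and F: "continuous_on future F"
  shows "continuous_on UNIV (\<lambda>z. X (fst z) *\<^sub>R F z)"
proof -
  let ?A = "{1::real<..} \<times> (UNIV :: (real^3) set)" and ?V = "{..<(5/4::real)} \<times> (UNIV :: (real^3) set)"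
  have o: "open ?A" "open ?V" by (intro open_Times open_greaterThan open_lessThan open_UNIV)+
  have "continuous_on ?A (\<lambda>z. X (fst z) *\<^sub>R F z)"
    by (intro continuous_intros continuous_on_compose2[OF X(1)] continuous_on_subset[OF F]) auto
  moreover have "continuous_on ?V (\<lambda>z. X (fst z) *\<^sub>R F z)"
    by (rule continuous_on_eq[of _ "\<lambda>_. 0"]) (use X(2) in auto)
  ultimately have "continuous_on (?A \<union> ?V) (\<lambda>z. X (fst z) *\<^sub>R F z)"
    by (rule continuous_on_open_Un[OF o])
  moreover have "?A \<union> ?V = UNIV" by auto
  ultimately show ?thesis by simp
qed

lemma continuous_on_cut_mult:
  fixes F :: "real \<times> (real^3) \<Rightarrow> 'b::real_normed_vector"
  assumes F: "continuous_on future F"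
  shows "continuous_on UNIV (\<lambda>z. cut (fst z) *\<^sub>R F z)" "continuous_on UNIV (\<lambda>z. cut' (fst z) *\<^sub>R F z)"
    "continuous_on UNIV (\<lambda>z. cut'' (fst z) *\<^sub>R F z)"
  by (rule continuous_on_cutoff[OF continuous_on_cut(1) cut_past(1) F], assumption,
      rule continuous_on_cutoff[OF continuous_on_cut(2) cut_past(2) F], assumption,
      rule continuous_on_cutoff[OF continuous_on_cut(3) cut_past(3) F], assumption)

context wave_solution
begin

text \<open>The wave operator applied to \<open>cut * \<phi>\<close>.\<close>

definition "src z = cut'' (fst z) * \<phi> z + 2 * (cut' (fst z) * \<phi>t z) - cut (fst z) * nonlin z"

lemma gradients_at:
  assumes "fst z > 1"
  shows "has_gradient \<phi> (\<phi>t z) (\<phi>x z) (at z)"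
    "has_gradient \<phi>t (\<phi>tt z) (\<phi>xt z) (at z)"
    "has_gradient (\<lambda>z. \<phi>x z $ i) (\<phi>tx z $ i) (\<phi>xx i z) (at z)"
  using gradients[of z] assms unfolding at_within_future[OF assms] by (auto simp: mem_Times_iff)

text \<open>\<open>kirchhoff_formula\<close> for the product of \<open>cut\<close> and \<phi>, which
  vanishes up to time 5/4; the data survive only through the derivatives of \<open>cut\<close> in
  \<open>src\<close>.\<close>

lemma retarded_formula:
  "kirchhoff_const * (cut t * \<phi> (t, x)) = (\<integral>y. src (t - norm y, x + y) / norm y \<partial>lborel)"
proof -
  define \<psi> where "\<psi> = (\<lambda>z. cut (fst z) * \<phi> z)"
  define \<psi>t where "\<psi>t = (\<lambda>z. cut' (fst z) * \<phi> z + cut (fst z) * \<phi>t z)"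
  define \<psi>tt where "\<psi>tt = (\<lambda>z. (cut'' (fst z) * \<phi> z + cut' (fst z) * \<phi>t z) + (cut' (fst z) * \<phi>t z + cut (fst z) * \<phi>tt z))"
  define \<psi>x where "\<psi>x = (\<lambda>z. cut (fst z) *\<^sub>R \<phi>x z)"
  define \<psi>tx where "\<psi>tx = (\<lambda>z. cut' (fst z) *\<^sub>R \<phi>x z + cut (fst z) *\<^sub>R \<phi>tx z)"
  define \<psi>xx where "\<psi>xx = (\<lambda>i z. cut (fst z) *\<^sub>R \<phi>xx i z)"
  have mixed: "cut (fst z) *\<^sub>R \<phi>xt z = cut (fst z) *\<^sub>R \<phi>tx z" for z
    using mixed_partials(1)[of z] cut_past(1)[of "fst z"] by (cases "fst z > 1") auto
  have "kirchhoff_const * \<psi> (t, x) =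
     (\<integral>y. (\<psi>tt (t - norm y, x + y) - (\<Sum>i\<in>UNIV. \<psi>xx i (t - norm y, x + y) $ i)) / norm y \<partial>lborel)"
  proof (rule kirchhoff_formula[where c="5/4" and \<psi>t=\<psi>t and \<psi>x=\<psi>x and \<psi>tx=\<psi>tx])
    show "has_gradient \<psi> (\<psi>t z) (\<psi>x z) (at z)" for z
      unfolding \<psi>_def \<psi>t_def \<psi>x_def
      by (rule has_gradient_cutoff[OF DERIV_cut(1) cut_past(1,2) gradients_at(1)])
    show "has_gradient \<psi>t (\<psi>tt z) (\<psi>tx z) (at z)" for z
    proof -
      have "has_gradient \<psi>t (\<psi>tt z) (cut' (fst z) *\<^sub>R \<phi>x z + cut (fst z) *\<^sub>R \<phi>xt z) (at z)"
        unfolding \<psi>t_def \<psi>tt_def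
        by (intro has_gradient_add has_gradient_cutoff[OF DERIV_cut(2) cut_past(2,3) gradients_at(1)]
            has_gradient_cutoff[OF DERIV_cut(1) cut_past(1,2) gradients_at(2)])
      then show ?thesis unfolding mixed \<psi>tx_def .
    qed
    show "has_gradient (\<lambda>z. \<psi>x z $ i) (\<psi>tx z $ i) (\<psi>xx i z) (at z)" for z i
      using has_gradient_cutoff[where F="\<lambda>z. \<phi>x z $ i" and z=z, OF DERIV_cut(1) cut_past(1,2) gradients_at(3)]
      unfolding \<psi>x_def \<psi>tx_def \<psi>xx_def by simp
    note c = continuous_on_cut_mult
    have c': "continuous_on UNIV (\<lambda>z. cut (fst z) * F z)" "continuous_on UNIV (\<lambda>z. cut' (fst z) * F z)"
      "continuous_on UNIV (\<lambda>z. cut'' (fst z) * F z)" if "continuous_on future F" for F :: "real \<times> (real^3) \<Rightarrow> real"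
      using c[OF that] by simp_all
    show "continuous_on UNIV \<psi>tt"
      unfolding \<psi>tt_def by (intro continuous_on_add c' continuous)
    show "continuous_on UNIV (\<psi>xx i)" for i
      unfolding \<psi>xx_def by (intro c continuous)
  qed (simp_all add: \<psi>_def \<psi>t_def \<psi>tt_def \<psi>x_def \<psi>xx_def cut_past)
  moreover have "\<psi>tt z - (\<Sum>i\<in>UNIV. \<psi>xx i z $ i) = src z" for z
  proof (cases "fst z > 5/4")
    case True
    then have "\<phi>tt z - (\<Sum>i\<in>UNIV. \<phi>xx i z $ i) = - nonlin z"
      by (intro wave_equation) (simp add: mem_Times_iff)
    then have "cut (fst z) * (\<phi>tt z - (\<Sum>i\<in>UNIV. \<phi>xx i z $ i)) = - (cut (fst z) * nonlin z)" by simp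
    then show ?thesis
      unfolding \<psi>tt_def \<psi>xx_def src_def by (simp add: sum_distrib_left[symmetric] algebra_simps)
  qed (simp add: \<psi>tt_def \<psi>xx_def src_def cut_past)
  ultimately show ?thesis unfolding \<psi>_def by simp
qed

lemma continuous_src: "continuous_on UNIV src"
proof -
  have c: "continuous_on UNIV (\<lambda>z. cut (fst z) * F z)" "continuous_on UNIV (\<lambda>z. cut' (fst z) * F z)"
    "continuous_on UNIV (\<lambda>z. cut'' (fst z) * F z)" if "continuous_on future F" for F :: "real \<times> (real^3) \<Rightarrow> real"
    using continuous_on_cut_mult[OF that] by simp_all
  show ?thesis
    unfolding src_def[abs_def] by (intro continuous_intros c continuous continuous_nonlin)
qed

lemma retarded_bound:
  assumes t: "t \<ge> 3/2"
  shows "ennreal (kirchhoff_const * \<bar>\<phi> (t, x)\<bar>) \<le> (\<integral>\<^sup>+y. ennreal (\<bar>src (ret t x y, y)\<bar> / norm (y - x)) \<partial>lborel)"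
proof -
  let ?f = "\<lambda>y. src (t - norm y, x + y) / norm y"
  have [measurable]: "(\<lambda>y. src (t - norm y, x + y)) \<in> borel_measurable borel"
    by (intro borel_measurable_continuous_onI continuous_on_compose2[OF continuous_src] continuous_intros) auto
  have [measurable]: "(\<lambda>y. src (ret t x y, y)) \<in> borel_measurable borel"
    unfolding ret_def
    by (intro borel_measurable_continuous_onI continuous_on_compose2[OF continuous_src] continuous_intros) auto
  have "kirchhoff_const * \<bar>\<phi> (t, x)\<bar> = norm (integral\<^sup>L lborel ?f)"
    using retarded_formula[of t x, symmetric] cut_future(1)[OF t] kirchhoff_const_pos by (simp add: abs_mult)
  also have "ennreal \<dots> \<le> (\<integral>\<^sup>+y. ennreal (norm (?f y)) \<partial>lborel)"
  \<comment> \<open>A non-integrable function has Bochner integral 0, so the bound holds in that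
    case too.\<close>
  proof (cases "integrable lborel ?f")
    case False
    show ?thesis unfolding not_integrable_integral_eq[OF False] by simp
  qed (rule integral_norm_bound_ennreal)
  also have "\<dots> = (\<integral>\<^sup>+y. ennreal (\<bar>src (ret t x (x + y), x + y)\<bar> / norm (x + y - x)) \<partial>lborel)"
    by (simp add: ret_def)
  also have "\<dots> = (\<integral>\<^sup>+y. ennreal (\<bar>src (ret t x y, y)\<bar> / norm (y - x)) \<partial>distr lborel borel ((+) x))"
    by (rule nn_integral_distr[symmetric]) measurable
  finally show ?thesis unfolding lborel_distr_plus .
qed

lemma src_past: "fst z \<le> 5/4 \<Longrightarrow> src z = 0"
  unfolding src_def by (simp add: cut_past)

lemma src_outside: "norm (snd z) \<ge> fst z - 1/2 \<Longrightarrow> src z = 0"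
proof (cases "fst z \<le> 5/4")
  case False
  assume "norm (snd z) \<ge> fst z - 1/2"
  with False finite_speed[of z] show ?thesis
    unfolding src_def nonlin_def by (simp add: mem_Times_iff)
qed (simp add: src_past)

lemma src_future: "fst z \<ge> 3/2 \<Longrightarrow> \<bar>src z\<bar> = \<bar>\<phi> z\<bar> powr p"
proof (cases "\<phi> z = 0")
  case False
  assume "fst z \<ge> 3/2"
  then have "\<bar>src z\<bar> = \<bar>\<phi> z\<bar> powr 1 * \<bar>\<phi> z\<bar> powr (p - 1)"
    unfolding src_def nonlin_def using False by (simp add: cut_future abs_mult)
  also have "\<dots> = \<bar>\<phi> z\<bar> powr (1 + (p - 1))" by (rule powr_add[symmetric])
  finally show ?thesis by simp
qed (simp add: src_def nonlin_def cut_future)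

text \<open>Up to 5/4 \<open>src\<close> is zero, and from there to 3/2 finite speed confines it to
  the unit ball, so a compact set decides.\<close>

lemma src_bounded: "\<exists>B\<ge>0. \<forall>z. fst z \<le> 3/2 \<longrightarrow> \<bar>src z\<bar> \<le> B"
proof -
  let ?K = "{1..3/2} \<times> cball (0::real^3) 1"
  have "compact (src ` ?K)"
    by (intro compact_continuous_image continuous_on_subset[OF continuous_src] compact_Times) auto
  then have "bounded (src ` ?K)" by (rule compact_imp_bounded)
  then obtain M where M: "\<forall>v\<in>src ` ?K. norm v \<le> M" unfolding bounded_iff by blast
  have "\<bar>src z\<bar> \<le> \<bar>M\<bar>" if "fst z \<le> 3/2" for z
  proof (cases "fst z \<le> 5/4 \<or> norm (snd z) \<ge> fst z - 1/2")
    case False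
    then have "z \<in> ?K" using that by (auto simp: mem_Times_iff)
    from bspec[OF M imageI[OF this]] show ?thesis by simp
  qed (use src_past[of z] src_outside[of z] in auto)
  then show ?thesis by (intro exI[of _ "\<bar>M\<bar>"]) auto
qed

end

subsection \<open>Pointwise decay\<close>

text \<open>For 0 <= k < 3 the integral is finite, so \<open>enn2real\<close> loses nothing.\<close>

definition radial :: "real \<Rightarrow> real \<Rightarrow> real" where
  "radial k \<delta> = enn2real (\<integral>\<^sup>+z. ennreal (norm (z::real^3) powr - k) * indicator (ball 0 \<delta>) z \<partial>lborel)"

lemma radial_nonneg: "radial k \<delta> \<ge> 0"
  unfolding radial_def by simp

lemma nn_integral_radial:
  assumes "0 \<le> k" "k < 3"
  shows "(\<integral>\<^sup>+z. ennreal (norm (z::real^3) powr - k) * indicator (ball 0 \<delta>) z \<partial>lborel) = ennreal (radial k \<delta>)"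
  using nn_integral_norm_powr_ball[where 'a="real^3", of k \<delta>] assms
  unfolding radial_def by (simp add: less_top)

text \<open>Dominated convergence over the balls of radius 1/(n+1). Even at the origin the integrand
  is 0, by \<open>0 powr a = 0\<close>.\<close>

lemma radial_small:
  assumes k: "0 \<le> k" "k < 3" and e: "e > 0"
  obtains \<delta> where "\<delta> > 0" "\<delta> < 2" "radial k \<delta> \<le> e"
proof -
  let ?r = "\<lambda>n. 1 / real (Suc n)"
  let ?f = "\<lambda>n z::real^3. ennreal (norm z powr - k) * indicator (ball 0 (?r n)) z"
  have r0: "?r \<longlonglongrightarrow> 0" using LIMSEQ_inverse_real_of_nat by (simp add: inverse_eq_divide)
  have "(\<lambda>n. \<integral>\<^sup>+z. ?f n z \<partial>lborel) \<longlonglongrightarrow> integral\<^sup>N lborel (\<lambda>_::real^3. 0)"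
  proof (rule nn_integral_dominated_convergence[where w="?f 0"])
    show "?f n \<in> borel_measurable lborel" for n
      by (auto intro!: borel_measurable_times_ennreal borel_measurable_indicator measurable_compose[OF borel_measurable_norm_powr])
    then show "?f 0 \<in> borel_measurable lborel" .
    show "AE z in lborel. ?f n z \<le> ?f 0 z" for n
    proof -
      have "ball (0::real^3) (?r n) \<subseteq> ball 0 (?r 0)" by (rule subset_ball) simp
      then show ?thesis by (intro AE_I2) (auto simp: indicator_def simp del: mem_ball)
    qed
    show "(\<integral>\<^sup>+z. ?f 0 z \<partial>lborel) < \<infinity>"
      using nn_integral_norm_powr_ball[where 'a="real^3", of k "?r 0"] k by simp
    show "AE z in lborel. (\<lambda>n. ?f n z) \<longlonglongrightarrow> 0"
    proof (rule AE_I2)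
      fix z :: "real^3"
      show "(\<lambda>n. ?f n z) \<longlonglongrightarrow> 0"
      proof (cases "z = 0")
        case False
        then have "\<forall>\<^sub>F n in sequentially. ?r n < norm z"
          by (intro order_tendstoD(2)[OF r0]) simp
        then have "\<forall>\<^sub>F n in sequentially. ?f n z = 0"
          by (rule eventually_mono) (simp add: indicator_def)
        then show ?thesis by (rule tendsto_eventually)
      qed simp
    qed
  qed auto
  then have "(\<lambda>n. ennreal (radial k (?r n))) \<longlonglongrightarrow> 0"
    by (simp only: nn_integral_radial[OF k] nn_integral_0_iff_AE nn_integral_const mult_zero_left)
  then have "\<forall>\<^sub>F n in sequentially. ennreal (radial k (?r n)) < ennreal e"
    by (rule order_tendstoD(2)) (use e in simp)
  then obtain n where "ennreal (radial k (?r n)) < ennreal e"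
    by (rule eventually_happens'[OF sequentially_bot, THEN exE])
  then have "radial k (?r n) \<le> e"
    using e by (simp add: ennreal_less_iff radial_nonneg)
  moreover have "?r n > 0" "?r n < 2" by (auto simp: divide_simps)
  ultimately show thesis using that by blast
qed

text \<open>A weighted Young inequality. If 1/r <= \<kappa> a^2, the first term suffices; otherwise
  a^2 < 1/(\<kappa> r), and raising this to the power (p - 1)/2 yields the second.\<close>

lemma powr_young:
  fixes a r \<kappa> p :: real
  assumes a: "a \<ge> 0" and r: "r > 0" and \<kappa>: "\<kappa> > 0" and p: "p > 1"
  shows "a powr (p - 1) / r \<le> \<kappa> * a powr (p + 1) + \<kappa> powr (- (p - 1) / 2) * r powr (- (p + 1) / 2)"
proof (cases "1 / r \<le> \<kappa> * a powr 2")
  case True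
  have "a powr (p - 1) * (1 / r) \<le> a powr (p - 1) * (\<kappa> * a powr 2)"
    by (rule mult_left_mono[OF True]) simp
  also have "\<dots> = \<kappa> * a powr ((p - 1) + 2)" unfolding powr_add by simp
  finally have "a powr (p - 1) / r \<le> \<kappa> * a powr (p + 1)" by (simp add: add.commute)
  moreover have "0 \<le> \<kappa> powr (- (p - 1) / 2) * r powr (- (p + 1) / 2)" by simp
  ultimately show ?thesis by linarith
next
  case False
  then have "a powr 2 \<le> 1 / (r * \<kappa>)" using r \<kappa> by (simp add: field_simps)
  then have "(a powr 2) powr ((p - 1) / 2) \<le> (1 / (r * \<kappa>)) powr ((p - 1) / 2)"
    using p by (intro powr_mono2) auto
  moreover have "2 * ((p - 1) / 2) = p - 1" by simp
  ultimately have "a powr (p - 1) \<le> (1 / (r * \<kappa>)) powr ((p - 1) / 2)" by (simp only: powr_powr)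
  also have "\<dots> = \<kappa> powr (- (p - 1) / 2) * r powr (- (p - 1) / 2)"
  proof -
    have e: "- (p - 1) / 2 = - ((p - 1) / 2)" by (rule minus_divide_left[symmetric])
    have "(1 / (r * \<kappa>)) powr m = \<kappa> powr - m * r powr - m" for m
    proof -
      have "(1 / (r * \<kappa>)) powr m = 1 / (r powr m * \<kappa> powr m)"
        using r \<kappa> by (simp add: powr_divide powr_mult)
      also have "\<dots> = inverse (\<kappa> powr m) * inverse (r powr m)"
        by (simp add: divide_inverse)
      finally show ?thesis unfolding powr_minus .
    qed
    then show ?thesis unfolding e .
  qed
  finally have "a powr (p - 1) * r powr - 1 \<le> \<kappa> powr (- (p - 1) / 2) * r powr (- (p - 1) / 2) * r powr - 1"
    by (rule mult_right_mono) simp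
  also have "\<dots> = \<kappa> powr (- (p - 1) / 2) * r powr (- (p - 1) / 2 + - 1)"
    unfolding powr_add by simp
  also have "- (p - 1) / 2 + - 1 = - (p + 1) / 2" by (simp add: field_simps)
  finally have F: "a powr (p - 1) * r powr - 1 \<le> \<kappa> powr (- (p - 1) / 2) * r powr (- (p + 1) / 2)" .
  have "r powr - 1 = 1 / r" using r by (simp only: powr_minus powr_one_gt_zero_iff powr_one divide_inverse mult_1_left less_imp_le)
  then have "a powr (p - 1) / r \<le> \<kappa> powr (- (p - 1) / 2) * r powr (- (p + 1) / 2)"
    using F by (simp only: times_divide_eq_right mult_1_right)
  moreover have "0 \<le> \<kappa> * a powr (p + 1)" using \<kappa> by simp
  ultimately show ?thesis by linarith
qed

lemma ennreal_combination:
  assumes "0 \<le> c1" "0 \<le> c2" "0 \<le> c3" "0 \<le> c4" "0 \<le> x1" "0 \<le> x2" "0 \<le> x3" "0 \<le> x4"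
  shows "ennreal (((c1 * x1 + c2 * x2) + c3 * x3) + c4 * x4) =
    ((ennreal c1 * ennreal x1 + ennreal c2 * ennreal x2) + ennreal c3 * ennreal x3) + ennreal c4 * ennreal x4"
  using assms by (simp add: ennreal_mult ennreal_plus)

section \<open>The retarded integral in inverted coordinates\<close>

definition dens :: "real \<Rightarrow> real^3 \<Rightarrow> real^3 \<Rightarrow> ennreal" where
  "dens t x y = ennreal (cone_wt t x y / mink (ret t x y) y ^ 4) * indicator (cone_dom t x) y"

text \<open>\<open>dens\<close> is the Jacobian of the inversion on the cone, so \<open>kern\<close>
  is the pull-back of a singularity of order k in the ball of radius \<delta> about the image of the
  vertex.\<close>

definition kern :: "real \<Rightarrow> real \<Rightarrow> real \<Rightarrow> real^3 \<Rightarrow> real^3 \<Rightarrow> ennreal" where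
  "kern k \<delta> t x y = ennreal (conf_dist t x y powr - k) * indicator {..<\<delta>} (conf_dist t x y) * dens t x y"

lemma measurable_kern [measurable]: "dens t x \<in> borel_measurable borel" "kern k \<delta> t x \<in> borel_measurable borel"
proof -
  show [measurable]: "dens t x \<in> borel_measurable borel" unfolding dens_def[abs_def] by measurable
  show "kern k \<delta> t x \<in> borel_measurable borel" unfolding kern_def[abs_def] by measurable
qed

lemma nn_integral_kern:
  assumes "0 \<le> k" "k < 3"
  shows "(\<integral>\<^sup>+y. kern k \<delta> t x y \<partial>lborel) \<le> ennreal (radial k \<delta>)"
proof -
  have "(\<integral>\<^sup>+y. kern k \<delta> t x y \<partial>lborel) \<le> (\<integral>\<^sup>+z. ennreal (norm (z::real^3) powr - k) * indicator {..<\<delta>} (norm z) \<partial>lborel)"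
    unfolding kern_def dens_def by (rule nn_integral_conf_dist_le) measurable
  also have "\<dots> = (\<integral>\<^sup>+z. ennreal (norm (z::real^3) powr - k) * indicator (ball 0 \<delta>) z \<partial>lborel)"
    by (rule nn_integral_cong) (auto simp: indicator_def)
  finally show ?thesis unfolding nn_integral_radial[OF assms] .
qed

context wave_solution
begin

text \<open>The part of the cone on which \<open>src\<close> can be nonzero.\<close>

definition "zone t x = {y \<in> cone_dom t x. norm y < ret t x y - 1/2 \<and> ret t x y > 5/4}"

text \<open>With s the Lorentz square, s = (ret - |y|)(ret + |y|) >= (ret + |y|)/2 >= ret/2 > 1/2.
  The weights follow from this, from t - |x| <= ret + |y| and from 3 - p <= 0. The bound 2 on
  \<open>conf_dist\<close> is a bound on the inverted time ret/s.\<close>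

lemma zone_bounds:
  assumes y: "y \<in> zone t x"
  shows "mink (ret t x y) y > 0" "mink (ret t x y) y powr (3 - p) \<le> (1/2) powr (3 - p)"
    "mink (ret t x y) y powr (3 - p) \<le> ((t - norm x) / 2) powr (3 - p)"
    "0 < conf_dist t x y" "conf_dist t x y < 2"
proof -
  let ?\<tau> = "ret t x y" and ?s = "mink (ret t x y) y"
  have d: "y \<in> cone_dom t x" "norm y < ?\<tau> - 1/2" "?\<tau> > 5/4" using y unfolding zone_def by auto
  have "?s = (?\<tau> - norm y) * (?\<tau> + norm y)" unfolding mink_def by (simp add: power2_eq_square algebra_simps)
  also have "\<dots> \<ge> (1/2) * (?\<tau> + norm y)" using d norm_ge_zero[of y] by (intro mult_right_mono) linarith+
  finally have s: "?s \<ge> (?\<tau> + norm y) / 2" by simp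
  have "?\<tau> / 2 \<le> (?\<tau> + norm y) / 2" by simp
  then have s2: "?s \<ge> ?\<tau> / 2" using s by (rule order.trans)
  then have "?s \<ge> 1/2" using d by linarith
  note s1 = s2 this
  show spos: "?s > 0" using s1(2) by linarith
  show "?s powr (3 - p) \<le> (1/2) powr (3 - p)" using s1 p by (intro powr_mono2') auto
  have u: "t - norm x \<le> ?\<tau> + norm y"
    unfolding ret_def using norm_triangle_ineq4[of y x] by simp
  have "t - norm x > 0" using cone_dom_imp_norm_less[OF d(1)] by simp
  then show "?s powr (3 - p) \<le> ((t - norm x) / 2) powr (3 - p)"
    using u s p by (intro powr_mono2') auto
  show "0 < conf_dist t x y" by (rule conf_dist_pos[OF d(1)])
  have "0 < t / mink t x"
    using mink_pos[OF cone_dom_imp_norm_less[OF d(1)]] cone_dom_imp_norm_less[OF d(1)] norm_ge_zero[of x]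
    by (intro divide_pos_pos) linarith+
  then have "conf_dist t x y < ?\<tau> / ?s"
    unfolding conf_dist_eq_time_difference[OF d(1)] by simp
  also have "\<dots> \<le> 2" using s1 spos by (simp add: divide_simps)
  finally show "conf_dist t x y < 2" .
qed

text \<open>Multiplying the representation by t^2 - |x|^2 and writing dy through \<open>dens\<close>
  turns 1/|y - x| into 1/\<open>conf_dist\<close> and gives \<open>src\<close> its conformal weight
  s^3: this is the retarded integral of \<Phi> in inverted coordinates.\<close>

lemma weighted_bound:
  assumes t: "t \<ge> 3/2" and x: "norm x < t"
  shows "ennreal (kirchhoff_const * (mink t x * \<bar>\<phi> (t, x)\<bar>)) \<le>
    (\<integral>\<^sup>+y. ennreal (mink (ret t x y) y ^ 3 * \<bar>src (ret t x y, y)\<bar> / conf_dist t x y) * indicator (zone t x) y * dens t x y \<partial>lborel)"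
proof -
  have P: "mink t x > 0" using x by (rule mink_pos)
  have [measurable]: "(\<lambda>y. src (ret t x y, y)) \<in> borel_measurable borel"
    unfolding ret_def
    by (intro borel_measurable_continuous_onI continuous_on_compose2[OF continuous_src] continuous_intros) auto
  have "ennreal (kirchhoff_const * (mink t x * \<bar>\<phi> (t, x)\<bar>)) = ennreal (mink t x) * ennreal (kirchhoff_const * \<bar>\<phi> (t, x)\<bar>)"
    using P kirchhoff_const_pos by (simp add: ennreal_mult[symmetric] mult_ac)
  also have "\<dots> \<le> ennreal (mink t x) * (\<integral>\<^sup>+y. ennreal (\<bar>src (ret t x y, y)\<bar> / norm (y - x)) \<partial>lborel)"
    by (intro mult_left_mono retarded_bound t) simp
  also have "\<dots> = (\<integral>\<^sup>+y. ennreal (mink t x) * ennreal (\<bar>src (ret t x y, y)\<bar> / norm (y - x)) \<partial>lborel)"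
    by (rule nn_integral_cmult[symmetric]) measurable
  also have "\<dots> \<le> (\<integral>\<^sup>+y. ennreal (mink (ret t x y) y ^ 3 * \<bar>src (ret t x y, y)\<bar> / conf_dist t x y) * indicator (zone t x) y * dens t x y \<partial>lborel)"
  proof (rule nn_integral_mono_AE)
    have "AE y in lborel. y \<noteq> x" by (rule AE_lborel_singleton)
    then show "AE y in lborel. ennreal (mink t x) * ennreal (\<bar>src (ret t x y, y)\<bar> / norm (y - x)) \<le>
      ennreal (mink (ret t x y) y ^ 3 * \<bar>src (ret t x y, y)\<bar> / conf_dist t x y) * indicator (zone t x) y * dens t x y"
    proof eventually_elim
      case (elim y)
      show ?case
      proof (cases "y \<in> zone t x")
        case False
        then have "src (ret t x y, y) = 0"
          using src_past[of "(ret t x y, y)"] src_outside[of "(ret t x y, y)"] elim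
          unfolding zone_def cone_dom_def by fastforce
        then show ?thesis by simp
      next
        case True
        then have d: "y \<in> cone_dom t x" unfolding zone_def by auto
        note z = zone_bounds[OF True]
        have W: "cone_wt t x y > 0" by (rule cone_wt_pos[OF d])
        have n: "norm (y - x) > 0" using elim by simp
        have "mink t x * (\<bar>src (ret t x y, y)\<bar> / norm (y - x)) =
          (mink (ret t x y) y ^ 3 * \<bar>src (ret t x y, y)\<bar> / conf_dist t x y) * (cone_wt t x y / mink (ret t x y) y ^ 4)"
          unfolding conf_dist_def using P z(1) W n by (simp add: divide_simps) (simp add: numeral_eq_Suc)
        then have "ennreal (mink t x) * ennreal (\<bar>src (ret t x y, y)\<bar> / norm (y - x))
          = ennreal ((mink (ret t x y) y ^ 3 * \<bar>src (ret t x y, y)\<bar> / conf_dist t x y) * (cone_wt t x y / mink (ret t x y) y ^ 4))"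
          using P by (simp add: ennreal_mult[symmetric])
        also have "\<dots> = ennreal (mink (ret t x y) y ^ 3 * \<bar>src (ret t x y, y)\<bar> / conf_dist t x y) * ennreal (cone_wt t x y / mink (ret t x y) y ^ 4)"
          using z W by (intro ennreal_mult) (auto intro!: divide_nonneg_nonneg mult_nonneg_nonneg simp: less_imp_le)
        finally show ?thesis using True d by (simp add: dens_def)
      qed
    qed
  qed
  finally show ?thesis .
qed

text \<open>Late points: s^3 |\<phi>|^p = s^(3-p) \<Phi>^p with \<Phi> = s |\<phi>|. Early points:
  \<open>src\<close> is bounded and s <= (3/2)^2 = 9/4, whence the factor (9/4)^p in the
  proof.\<close>

lemma src_weighted:
  obtains B where "B \<ge> 0" "\<And>t x y. y \<in> zone t x \<Longrightarrow> mink (ret t x y) y ^ 3 * \<bar>src (ret t x y, y)\<bar> \<le>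
    mink (ret t x y) y powr (3 - p) * (B + (if ret t x y > 3/2 then (mink (ret t x y) y * \<bar>\<phi> (ret t x y, y)\<bar>) powr p else 0))"
proof -
  obtain B where B: "B \<ge> 0" "\<And>z. fst z \<le> 3/2 \<Longrightarrow> \<bar>src z\<bar> \<le> B" using src_bounded by blast
  show thesis
  proof (rule that[of "B * (9/4) powr p"])
    show "0 \<le> B * (9/4) powr p" using B(1) by simp
    fix t x y assume y: "y \<in> zone t x"
    let ?s = "mink (ret t x y) y"
    have s: "?s > 0" by (rule zone_bounds[OF y])
    have s3: "?s ^ 3 = ?s powr (3 - p) * ?s powr p"
      using powr_add[of ?s "3 - p" p] s by (simp add: powr_numeral)
    show "?s ^ 3 * \<bar>src (ret t x y, y)\<bar> \<le>
      ?s powr (3 - p) * (B * (9/4) powr p + (if ret t x y > 3/2 then (?s * \<bar>\<phi> (ret t x y, y)\<bar>) powr p else 0))"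
    proof (cases "ret t x y > 3/2")
      case True
      have "?s ^ 3 * \<bar>src (ret t x y, y)\<bar> = ?s powr (3 - p) * ((?s * \<bar>\<phi> (ret t x y, y)\<bar>) powr p)"
        using True s src_future[of "(ret t x y, y)"] unfolding s3 by (simp add: powr_mult)
      also have "\<dots> \<le> ?s powr (3 - p) * (B * (9/4) powr p + (?s * \<bar>\<phi> (ret t x y, y)\<bar>) powr p)"
        using B(1) by (intro mult_left_mono) auto
      finally show ?thesis using True by simp
    next
      case False
      have "norm y < ret t x y" "ret t x y > 5/4" using y unfolding zone_def cone_dom_def by auto
      then have "(ret t x y)\<^sup>2 \<le> (3/2)\<^sup>2" using False by (intro power_mono) auto
      moreover have "?s \<le> (ret t x y)\<^sup>2" unfolding mink_def by simp
      moreover have "(3/2)\<^sup>2 = (9/4 :: real)" by (simp add: power2_eq_square)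
      ultimately have "?s \<le> 9/4" by linarith
      then have "?s powr p \<le> (9/4) powr p" using s p by (intro powr_mono2) auto
      then have "?s powr p * \<bar>src (ret t x y, y)\<bar> \<le> (9/4) powr p * B"
        using B(2)[of "(ret t x y, y)"] False by (intro mult_mono) auto
      then have "?s powr (3 - p) * (?s powr p * \<bar>src (ret t x y, y)\<bar>) \<le> ?s powr (3 - p) * ((9/4) powr p * B)"
        by (rule mult_left_mono) simp
      then show ?thesis using False unfolding s3 by (simp add: mult_ac)
    qed
  qed
qed

text \<open>On the whole zone s^(3-p) is at most ((t - |x|)/2)^(3-p) and can leave the integral;
  what remains is the integral of 1/r over the ball of radius 2. The bound M is assumed up to time
  t, which covers the cone.\<close>

lemma improved_bound:
  obtains B where "B \<ge> 0" "\<And>t x M. t \<ge> 3/2 \<Longrightarrow> norm x < t \<Longrightarrow> M \<ge> 0 \<Longrightarrow>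
      (\<And>s y. 3/2 < s \<Longrightarrow> norm y < s \<Longrightarrow> s \<le> t \<Longrightarrow> mink s y * \<bar>\<phi> (s, y)\<bar> \<le> M) \<Longrightarrow>
      kirchhoff_const * (mink t x * \<bar>\<phi> (t, x)\<bar>) \<le> (B + M powr p) * ((t - norm x) / 2) powr (3 - p) * radial 1 2"
proof -
  obtain B where B: "B \<ge> 0" "\<And>t x y. y \<in> zone t x \<Longrightarrow> mink (ret t x y) y ^ 3 * \<bar>src (ret t x y, y)\<bar> \<le>
    mink (ret t x y) y powr (3 - p) * (B + (if ret t x y > 3/2 then (mink (ret t x y) y * \<bar>\<phi> (ret t x y, y)\<bar>) powr p else 0))"
    using src_weighted by blast
  show thesis
  proof (rule that[of B])
    fix t :: real and x :: "real^3" and M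
    assume t: "t \<ge> 3/2" and x: "norm x < t" and M0: "M \<ge> 0"
      and M: "\<And>s y. 3/2 < s \<Longrightarrow> norm y < s \<Longrightarrow> s \<le> t \<Longrightarrow> mink s y * \<bar>\<phi> (s, y)\<bar> \<le> M"
    let ?C = "(B + M powr p) * ((t - norm x) / 2) powr (3 - p)"
    have C: "?C \<ge> 0" using B(1) by simp
    have "ennreal (kirchhoff_const * (mink t x * \<bar>\<phi> (t, x)\<bar>)) \<le> (\<integral>\<^sup>+y. ennreal ?C * kern 1 2 t x y \<partial>lborel)"
    proof (rule order.trans[OF weighted_bound[OF t x]], rule nn_integral_mono)
      fix y :: "real^3"
      show "ennreal (mink (ret t x y) y ^ 3 * \<bar>src (ret t x y, y)\<bar> / conf_dist t x y) * indicator (zone t x) y * dens t x y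
        \<le> ennreal ?C * kern 1 2 t x y"
      proof (cases "y \<in> zone t x")
        case True
        note z = zone_bounds[OF True]
        have y: "norm y < ret t x y" using True unfolding zone_def cone_dom_def by auto
        have "(if ret t x y > 3/2 then (mink (ret t x y) y * \<bar>\<phi> (ret t x y, y)\<bar>) powr p else 0) \<le> M powr p"
          using M[of "ret t x y" y] y z(1) p by (auto simp: ret_def intro!: powr_mono2)
        then have "mink (ret t x y) y ^ 3 * \<bar>src (ret t x y, y)\<bar> \<le> mink (ret t x y) y powr (3 - p) * (B + M powr p)"
          by (intro order.trans[OF B(2)[OF True]] mult_left_mono) auto
        also have "\<dots> \<le> ((t - norm x) / 2) powr (3 - p) * (B + M powr p)"
          using z(3) B(1) by (intro mult_right_mono) auto
        finally have "mink (ret t x y) y ^ 3 * \<bar>src (ret t x y, y)\<bar> / conf_dist t x y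
            \<le> ((t - norm x) / 2) powr (3 - p) * (B + M powr p) / conf_dist t x y"
          using z(4) by (intro divide_right_mono) auto
        also have "\<dots> = ?C * conf_dist t x y powr - 1"
          unfolding powr_neg_one[OF z(4)] by (simp add: mult_ac)
        finally have "mink (ret t x y) y ^ 3 * \<bar>src (ret t x y, y)\<bar> / conf_dist t x y \<le> ?C * conf_dist t x y powr - 1" .
        then have "ennreal (mink (ret t x y) y ^ 3 * \<bar>src (ret t x y, y)\<bar> / conf_dist t x y) \<le> ennreal ?C * ennreal (conf_dist t x y powr - 1)"
          unfolding ennreal_mult[OF C powr_ge_zero, symmetric] by (rule ennreal_leI)
        then show ?thesis
          using True z(5) by (simp add: kern_def mult.assoc[symmetric] mult_right_mono)
      qed simp
    qed
    also have "\<dots> = ennreal ?C * (\<integral>\<^sup>+y. kern 1 2 t x y \<partial>lborel)"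
      by (rule nn_integral_cmult) measurable
    also have "\<dots> \<le> ennreal ?C * ennreal (radial 1 2)"
      by (intro mult_left_mono nn_integral_kern) auto
    also have "\<dots> = ennreal (?C * radial 1 2)"
      by (rule ennreal_mult[OF C radial_nonneg, symmetric])
    finally show "kirchhoff_const * (mink t x * \<bar>\<phi> (t, x)\<bar>) \<le> ?C * radial 1 2"
      using C radial_nonneg by (subst (asm) ennreal_le_iff) auto
  qed (rule B)
qed

section \<open>Absorption of the nonlinear term into the conformal energy\<close>

definition "pot_kern t x y = ennreal (cone_wt t x y * pot (ret t x y, y)) * indicator {y. y \<noteq> x \<and> ret t x y > 3/2} y"

lemma measurable_pot_kern [measurable]: "pot_kern t x \<in> borel_measurable borel"
proof -
  have "(\<lambda>y. (\<lambda>z. indicator future z * pot z) (ret t x y, y)) \<in> borel_measurable borel"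
    by (rule measurable_compose[OF _ measurable_on_future[OF continuous_nonlin(2)]]) measurable
  then have [measurable]: "(\<lambda>y. indicator future (ret t x y, y) * pot (ret t x y, y)) \<in> borel_measurable borel" .
  have "pot_kern t x = (\<lambda>y. ennreal (cone_wt t x y * (indicator future (ret t x y, y) * pot (ret t x y, y)))
      * indicator {y. y \<noteq> x \<and> ret t x y > 3/2} y)"
    unfolding pot_kern_def by (auto simp: fun_eq_iff indicator_def)
  moreover have "(\<lambda>y. ennreal (cone_wt t x y * (indicator future (ret t x y, y) * pot (ret t x y, y)))
      * indicator {y. y \<noteq> x \<and> ret t x y > 3/2} y) \<in> borel_measurable borel"
    by measurable
  ultimately show ?thesis by simp
qed

text \<open>Near the vertex one factor \<open>\<Phi> \<le> M\<close> is split off and the remaining power of \<open>\<Phi>\<close> is absorbed by the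
  conformal energy; \<open>p < 5\<close> makes \<open>r powr (- (p + 1) / 2)\<close> integrable. Far from the vertex the energy suffices.\<close>

lemma absorption_bound:
  obtains K where "K \<ge> 0" "\<And>t x M. t \<ge> 3/2 \<Longrightarrow> norm x < t \<Longrightarrow> M \<ge> 0 \<Longrightarrow>
      (\<And>s y. 3/2 < s \<Longrightarrow> norm y < s \<Longrightarrow> s \<le> t \<Longrightarrow> mink s y * \<bar>\<phi> (s, y)\<bar> \<le> M) \<Longrightarrow>
      kirchhoff_const * (mink t x * \<bar>\<phi> (t, x)\<bar>) \<le> K + kirchhoff_const / 2 * M"
proof -
  obtain B where B: "B \<ge> 0" "\<And>t x y. y \<in> zone t x \<Longrightarrow> mink (ret t x y) y ^ 3 * \<bar>src (ret t x y, y)\<bar> \<le>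
    mink (ret t x y) y powr (3 - p) * (B + (if ret t x y > 3/2 then (mink (ret t x y) y * \<bar>\<phi> (ret t x y, y)\<bar>) powr p else 0))"
    using src_weighted by blast
  define c0 where "c0 = (1/2) powr (3 - p)"
  define k where "k = (p + 1) / 2"
  define E where "E = (p + 1) * energy"
  \<comment> \<open>Fixed first, so that the energy term costs at most a quarter of
    \<open>kirchhoff_const\<close> times M. Using E + 1 avoids division by zero.\<close>
  define \<kappa> where "\<kappa> = kirchhoff_const / (4 * (E + 1))"
  define D where "D = \<kappa> powr (- (p - 1) / 2)"
  have k: "0 \<le> k" "k < 3" using p unfolding k_def by auto
  have E: "E \<ge> 0" using energy_nonneg p unfolding E_def by simp
  have \<kappa>: "\<kappa> > 0" using E kirchhoff_const_pos unfolding \<kappa>_def by simp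
  have c0: "c0 > 0" and D: "D > 0" using \<kappa> unfolding c0_def D_def by auto
  have "\<kappa> * E \<le> \<kappa> * (E + 1)" using \<kappa> by simp
  also have "\<dots> = kirchhoff_const / 4" unfolding \<kappa>_def using E by (simp add: field_simps)
  finally have \<kappa>E: "\<kappa> * E \<le> kirchhoff_const / 4" .
  have "kirchhoff_const / (4 * c0 * D) > 0" using kirchhoff_const_pos c0 D by simp
  \<comment> \<open>A small \<kappa> is paid for by the constant D; \<delta> is then so small that
    the Young remainder near the vertex costs another quarter. The two quarters make up the factor
    1/2 in front of M.\<close>
  then obtain \<delta> where \<delta>: "\<delta> > 0" "\<delta> < 2" "radial k \<delta> \<le> kirchhoff_const / (4 * c0 * D)"
    using radial_small[OF k] by blast
  have R: "c0 * D * radial k \<delta> \<le> kirchhoff_const / 4"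
    using mult_left_mono[OF \<delta>(3), of "c0 * D"] c0 D by (simp add: field_simps)
  define K where "K = c0 * B * radial 1 2 + E / \<delta> + c0 / \<delta> * radial 0 2"
  have K: "K \<ge> 0" unfolding K_def using c0 B(1) E \<delta> radial_nonneg by simp
  show thesis
  proof (rule that[OF K])
    fix t :: real and x :: "real^3" and M
    assume t: "t \<ge> 3/2" and x: "norm x < t" and M0: "M \<ge> 0"
      and M: "\<And>s y. 3/2 < s \<Longrightarrow> norm y < s \<Longrightarrow> s \<le> t \<Longrightarrow> mink s y * \<bar>\<phi> (s, y)\<bar> \<le> M"
    define c1 where "c1 = c0 * B"
    define c2 where "c2 = (p + 1) * (1 / \<delta> + M * \<kappa>)"
    define c3 where "c3 = c0 / \<delta>"
    define c4 where "c4 = c0 * M * D"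
    have c: "c1 \<ge> 0" "c2 \<ge> 0" "c3 \<ge> 0" "c4 \<ge> 0"
      unfolding c1_def c2_def c3_def c4_def using c0 B(1) p \<delta> M0 \<kappa> D by auto
    have "ennreal (kirchhoff_const * (mink t x * \<bar>\<phi> (t, x)\<bar>)) \<le>
      (\<integral>\<^sup>+y. ((ennreal c1 * kern 1 2 t x y + ennreal c2 * pot_kern t x y) + ennreal c3 * kern 0 2 t x y)
        + ennreal c4 * kern k \<delta> t x y \<partial>lborel)"
    proof (rule order.trans[OF weighted_bound[OF t x]], rule nn_integral_mono)
      fix y :: "real^3"
      show "ennreal (mink (ret t x y) y ^ 3 * \<bar>src (ret t x y, y)\<bar> / conf_dist t x y) * indicator (zone t x) y * dens t x y
        \<le> ((ennreal c1 * kern 1 2 t x y + ennreal c2 * pot_kern t x y) + ennreal c3 * kern 0 2 t x y)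
        + ennreal c4 * kern k \<delta> t x y"
      proof (cases "y \<in> zone t x")
        case True
        note z = zone_bounds[OF True]
        have yd: "y \<in> cone_dom t x" using True unfolding zone_def by simp
        have y: "norm y < ret t x y" "y \<noteq> x" using yd unfolding cone_dom_def by auto
        define s where "s = mink (ret t x y) y"
        define r where "r = conf_dist t x y"
        define \<Phi> where "\<Phi> = s * \<bar>\<phi> (ret t x y, y)\<bar>"
        define b where "b = (if ret t x y > 3/2 then 1 else 0 :: real)"
        define d where "d = (if r < \<delta> then 1 else 0 :: real)"
        define w where "w = cone_wt t x y / s ^ 4"
        have s: "s > 0" and r: "r > 0" "r < 2" and w: "w > 0"
          using z cone_wt_pos[OF yd] unfolding s_def r_def w_def by auto
        have \<Phi>: "\<Phi> \<ge> 0" unfolding \<Phi>_def using s by simp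
        have sc0: "s powr (3 - p) \<le> c0" using z(2) unfolding s_def c0_def .
        \<comment> \<open>b marks late points and d points near the vertex. Early points contribute
          nothing here, near points use \<Phi> <= M and \<open>powr_young\<close>, and far points
          use 1/r <= 1/\<delta> together with \<Phi>^p <= 1 + \<Phi>^(p+1).\<close>
        have main: "b * \<Phi> powr p / r \<le> b * ((1 / \<delta> + M * \<kappa>) * \<Phi> powr (p + 1)) + 1 / \<delta> + M * D * (d * r powr - k)"
        proof (cases "ret t x y > 3/2")
          case late: True
          have \<Phi>M: "\<Phi> \<le> M" using M[of "ret t x y" y] late y unfolding \<Phi>_def s_def ret_def by simp
          show ?thesis
          proof (cases "r < \<delta>")
            case near: True
            have "\<Phi> powr p / r = \<Phi> * (\<Phi> powr (p - 1) / r)"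
              using powr_add[of \<Phi> 1 "p - 1"] \<Phi> by simp
            also have "\<dots> \<le> M * (\<kappa> * \<Phi> powr (p + 1) + D * r powr - k)"
              using powr_young[OF \<Phi> r(1) \<kappa>, of p] p \<Phi>M \<Phi> M0 r unfolding D_def k_def
              by (intro mult_mono) (auto simp: minus_divide_left)
            finally have "\<Phi> powr p / r \<le> M * (\<kappa> * \<Phi> powr (p + 1) + D * r powr - k)" .
            moreover have "0 \<le> 1 / \<delta> + \<Phi> powr (p + 1) / \<delta>" using \<delta>(1) by simp
            moreover have "b * ((1 / \<delta> + M * \<kappa>) * \<Phi> powr (p + 1)) + 1 / \<delta> + M * D * (d * r powr - k)
                = M * (\<kappa> * \<Phi> powr (p + 1) + D * r powr - k) + (1 / \<delta> + \<Phi> powr (p + 1) / \<delta>)"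
              using late near by (simp add: b_def d_def algebra_simps)
            moreover have "b * \<Phi> powr p / r = \<Phi> powr p / r" using late by (simp add: b_def)
            ultimately show ?thesis by linarith
          next
            case far: False
            have "\<Phi> powr p \<le> 1 + \<Phi> powr (p + 1)"
            proof (cases "\<Phi> \<le> 1")
              case True
              then have "\<Phi> powr p \<le> 1 powr p" using \<Phi> p by (intro powr_mono2) auto
              then show ?thesis by (simp add: add_increasing2)
            next
              case False
              then have "\<Phi> powr p \<le> \<Phi> powr (p + 1)" by (intro powr_mono) auto
              then show ?thesis by simp
            qed
            then have "\<Phi> powr p / r \<le> (1 + \<Phi> powr (p + 1)) / \<delta>"
              using far \<delta>(1) by (intro frac_le) auto
            moreover have "0 \<le> M * \<kappa> * \<Phi> powr (p + 1)" using M0 \<kappa> by simp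
            ultimately show ?thesis
              using late far by (simp add: b_def d_def algebra_simps add_divide_distrib)
          qed
        next
          case False
          then show ?thesis using \<delta>(1) M0 D by (simp add: b_def d_def)
        qed
        \<comment> \<open>The weights match: s^(3-p) s^(p+1) = s^4 cancels the s^4 in the Jacobian,
          so the absorbed power is exactly the density of \<open>cone_energy\<close>.\<close>
        have pk: "s powr (3 - p) * \<Phi> powr (p + 1) * w = (p + 1) * (cone_wt t x y * pot (ret t x y, y))"
        proof -
          have "s powr (3 - p) * \<Phi> powr (p + 1) = s powr ((3 - p) + (p + 1)) * \<bar>\<phi> (ret t x y, y)\<bar> powr (p + 1)"
            unfolding \<Phi>_def powr_add using s by (simp add: powr_mult powr_add)
          also have "(3 - p) + (p + 1) = real 4" by simp
          finally have "s powr (3 - p) * \<Phi> powr (p + 1) = s ^ 4 * \<bar>\<phi> (ret t x y, y)\<bar> powr (p + 1)"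
            using s by (simp only: powr_realpow)
          then show ?thesis unfolding w_def pot_def using s p by simp
        qed
        have "s ^ 3 * \<bar>src (ret t x y, y)\<bar> / r \<le> s powr (3 - p) * (B + b * \<Phi> powr p) / r"
          using B(2)[OF True] r unfolding s_def[symmetric] \<Phi>_def b_def by (intro divide_right_mono) (auto split: if_splits)
        also have "\<dots> = s powr (3 - p) * (B / r + b * \<Phi> powr p / r)"
          by (simp add: add_divide_distrib distrib_left)
        also have "\<dots> \<le> s powr (3 - p) * (B / r + (b * ((1 / \<delta> + M * \<kappa>) * \<Phi> powr (p + 1)) + 1 / \<delta> + M * D * (d * r powr - k)))"
          using main by (intro mult_left_mono add_left_mono) auto
        also have "\<dots> = s powr (3 - p) * (B / r + 1 / \<delta> + M * D * (d * r powr - k)) + (1 / \<delta> + M * \<kappa>) * (b * (s powr (3 - p) * \<Phi> powr (p + 1)))"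
          by (simp add: algebra_simps)
        also have "\<dots> \<le> c0 * (B / r + 1 / \<delta> + M * D * (d * r powr - k)) + (1 / \<delta> + M * \<kappa>) * (b * (s powr (3 - p) * \<Phi> powr (p + 1)))"
          using sc0 B(1) r \<delta>(1) M0 D by (intro add_right_mono mult_right_mono) (auto simp: d_def)
        finally have "s ^ 3 * \<bar>src (ret t x y, y)\<bar> / r * w \<le> (c0 * (B / r + 1 / \<delta> + M * D * (d * r powr - k)) + (1 / \<delta> + M * \<kappa>) * (b * (s powr (3 - p) * \<Phi> powr (p + 1)))) * w"
          using w by (intro mult_right_mono) auto
        also have "\<dots> = c0 * (B / r + 1 / \<delta> + M * D * (d * r powr - k)) * w + (1 / \<delta> + M * \<kappa>) * (b * (s powr (3 - p) * \<Phi> powr (p + 1) * w))"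
          by (simp add: algebra_simps)
        also have "\<dots> = ((c1 * (r powr - 1 * w) + c2 * (b * (cone_wt t x y * pot (ret t x y, y)))) + c3 * w) + c4 * (d * r powr - k * w)"
          unfolding pk c1_def c2_def c3_def c4_def using r(1) by (simp add: powr_minus divide_inverse algebra_simps)
        finally have "ennreal (s ^ 3 * \<bar>src (ret t x y, y)\<bar> / r * w) \<le>
            ennreal (((c1 * (r powr - 1 * w) + c2 * (b * (cone_wt t x y * pot (ret t x y, y)))) + c3 * w) + c4 * (d * r powr - k * w))"
          by (rule ennreal_leI)
        also have "\<dots> = ((ennreal c1 * ennreal (r powr - 1 * w) + ennreal c2 * ennreal (b * (cone_wt t x y * pot (ret t x y, y))))
            + ennreal c3 * ennreal w) + ennreal c4 * ennreal (d * r powr - k * w)"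
        proof -
          have "0 \<le> b * (cone_wt t x y * pot (ret t x y, y))" "0 \<le> d * r powr - k * w" "0 \<le> r powr - 1 * w"
            using cone_wt_pos[OF yd] pot_nonneg w by (auto simp: b_def d_def)
          then show ?thesis
            using w by (intro ennreal_combination c) auto
        qed
        also have "ennreal (r powr - 1 * w) = kern 1 2 t x y"
          using r yd w ennreal_mult[of "r powr - 1" w]
          unfolding kern_def dens_def r_def[symmetric] s_def[symmetric] w_def[symmetric] by simp
        also have "ennreal (b * (cone_wt t x y * pot (ret t x y, y))) = pot_kern t x y"
          using y unfolding pot_kern_def b_def by simp
        also have "ennreal w = kern 0 2 t x y"
          using r yd unfolding kern_def dens_def r_def[symmetric] s_def[symmetric] w_def[symmetric] by simp
        also have "ennreal (d * r powr - k * w) = kern k \<delta> t x y"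
          using r yd w unfolding kern_def dens_def r_def[symmetric] s_def[symmetric] w_def[symmetric] d_def by (simp add: ennreal_mult)
        finally have "ennreal (s ^ 3 * \<bar>src (ret t x y, y)\<bar> / r * w) \<le> ((ennreal c1 * kern 1 2 t x y + ennreal c2 * pot_kern t x y)
            + ennreal c3 * kern 0 2 t x y) + ennreal c4 * kern k \<delta> t x y" .
        moreover have "ennreal (s ^ 3 * \<bar>src (ret t x y, y)\<bar> / r * w) =
            ennreal (mink (ret t x y) y ^ 3 * \<bar>src (ret t x y, y)\<bar> / conf_dist t x y) * indicator (zone t x) y * dens t x y"
          using True yd s r w ennreal_mult[of "s ^ 3 * \<bar>src (ret t x y, y)\<bar> / r" w]
          unfolding dens_def r_def[symmetric] s_def[symmetric] w_def[symmetric] by simp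
        ultimately show ?thesis by simp
      qed simp
    qed
    also have "\<dots> = ((ennreal c1 * (\<integral>\<^sup>+y. kern 1 2 t x y \<partial>lborel) + ennreal c2 * (\<integral>\<^sup>+y. pot_kern t x y \<partial>lborel))
        + ennreal c3 * (\<integral>\<^sup>+y. kern 0 2 t x y \<partial>lborel)) + ennreal c4 * (\<integral>\<^sup>+y. kern k \<delta> t x y \<partial>lborel)"
      by (simp add: nn_integral_add nn_integral_cmult)
    also have "\<dots> \<le> ((ennreal c1 * ennreal (radial 1 2) + ennreal c2 * ennreal energy)
        + ennreal c3 * ennreal (radial 0 2)) + ennreal c4 * ennreal (radial k \<delta>)"
      using cone_energy[of t x] unfolding pot_kern_def
      by (intro add_mono mult_left_mono nn_integral_kern k) auto
    also have "\<dots> = ennreal (((c1 * radial 1 2 + c2 * energy) + c3 * radial 0 2) + c4 * radial k \<delta>)"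
      by (rule ennreal_combination[symmetric]) (intro c radial_nonneg energy_nonneg)+
    finally have "kirchhoff_const * (mink t x * \<bar>\<phi> (t, x)\<bar>) \<le> ((c1 * radial 1 2 + c2 * energy) + c3 * radial 0 2) + c4 * radial k \<delta>"
      using c radial_nonneg energy_nonneg by (subst (asm) ennreal_le_iff) auto
    also have "\<dots> = K + M * (\<kappa> * E) + M * (c0 * D * radial k \<delta>)"
      unfolding c1_def c2_def c3_def c4_def K_def E_def using \<delta>(1) by (simp add: field_simps)
    also have "\<dots> \<le> K + M * (kirchhoff_const / 4) + M * (kirchhoff_const / 4)"
      using \<kappa>E R M0 by (intro add_mono mult_left_mono) auto
    also have "\<dots> = K + kirchhoff_const / 2 * M" by (simp add: field_simps)
    finally show "kirchhoff_const * (mink t x * \<bar>\<phi> (t, x)\<bar>) \<le> K + kirchhoff_const / 2 * M" .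
  qed
qed

text \<open>On each truncated solid cone \<Phi> attains its maximum. If this happens after 3/2 and
  inside the light cone, \<open>absorption_bound\<close> applies with M equal to the maximum itself,
  and the factor 1/2 leaves a bound by 2 K / \<open>kirchhoff_const\<close>. As K does not depend on
  t, the bound is global.\<close>

lemma weak_decay:
  obtains M where "M \<ge> 0" "\<And>t x. t \<ge> 1 \<Longrightarrow> norm x \<le> t \<Longrightarrow> mink t x * \<bar>\<phi> (t, x)\<bar> \<le> M"
proof -
  obtain K where K: "K \<ge> 0" "\<And>t x M. t \<ge> 3/2 \<Longrightarrow> norm x < t \<Longrightarrow> M \<ge> 0 \<Longrightarrow>
      (\<And>s y. 3/2 < s \<Longrightarrow> norm y < s \<Longrightarrow> s \<le> t \<Longrightarrow> mink s y * \<bar>\<phi> (s, y)\<bar> \<le> M) \<Longrightarrow>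
      kirchhoff_const * (mink t x * \<bar>\<phi> (t, x)\<bar>) \<le> K + kirchhoff_const / 2 * M"
    using absorption_bound by blast
  let ?\<Phi> = "\<lambda>z. mink (fst z) (snd z) * \<bar>\<phi> z\<bar>"
  let ?S = "\<lambda>T. {z. 1 \<le> fst z \<and> fst z \<le> T \<and> norm (snd z) \<le> fst z} :: (real \<times> (real^3)) set"
  have cpt: "compact (?S T)" for T
  proof -
    have "closed (?S T)" by (intro closed_Collect_conj closed_Collect_le continuous_intros)
    moreover have "?S T \<subseteq> {1..T} \<times> cball 0 T" by (auto simp: mem_Times_iff)
    then have "?S T = ({1..T} \<times> cball 0 T) \<inter> ?S T" by blast
    moreover have "compact (({1..T} \<times> cball 0 T) \<inter> ?S T)"
      by (intro compact_Int_closed compact_Times compact_cball compact_Icc) fact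
    ultimately show ?thesis by (simp only:)
  qed
  have cont: "continuous_on (?S T) ?\<Phi>" for T
    unfolding mink_def
    by (intro continuous_intros continuous_on_subset[OF continuous(1)]) (auto simp: mem_Times_iff)
  have max: "\<exists>z\<in>?S T. \<forall>w\<in>?S T. ?\<Phi> w \<le> ?\<Phi> z" if "T \<ge> 1" for T
  proof (rule continuous_attains_sup[OF cpt _ cont])
    have "(1, 0) \<in> ?S T" using that by simp
    then show "?S T \<noteq> {}" by blast
  qed
  \<comment> \<open>Times up to 3/2 lie outside the reach of the representation formula; a second
    maximum, over a fixed compact set, bounds \<Phi> there.\<close>
  obtain z0 where z0: "z0 \<in> ?S (3/2)" "\<And>w. w \<in> ?S (3/2) \<Longrightarrow> ?\<Phi> w \<le> ?\<Phi> z0" using max[of "3/2"] by auto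
  have nonneg: "?\<Phi> z \<ge> 0" if "z \<in> ?S T" for z T
    using that unfolding mink_def by (intro mult_nonneg_nonneg) (auto intro: power_mono)
  define M where "M = max (?\<Phi> z0) (2 * K / kirchhoff_const)"
  have M0: "M \<ge> 0" unfolding M_def using nonneg[OF z0(1)] by simp
  show thesis
  proof (rule that[OF M0])
    fix t :: real and x :: "real^3" assume t: "t \<ge> 1" "norm x \<le> t"
    obtain z where z: "z \<in> ?S t" "\<And>w. w \<in> ?S t \<Longrightarrow> ?\<Phi> w \<le> ?\<Phi> z" using max[OF t(1)] by blast
    have "?\<Phi> z \<le> M"
    proof (cases "fst z \<le> 3/2")
      case True
      then show ?thesis using z(1) z0(2)[of z] unfolding M_def by auto
    next
      case False
      show ?thesis
      proof (cases "norm (snd z) < fst z")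
        case inside: True
        have "kirchhoff_const * (mink (fst z) (snd z) * \<bar>\<phi> (fst z, snd z)\<bar>) \<le> K + kirchhoff_const / 2 * ?\<Phi> z"
        proof (rule K(2)[OF _ inside nonneg[OF z(1)]])
          fix s :: real and y :: "real^3" assume "3/2 < s" "norm y < s" "s \<le> fst z"
          then show "mink s y * \<bar>\<phi> (s, y)\<bar> \<le> ?\<Phi> z" using z(1) by (intro z(2)[of "(s, y)", simplified]) auto
        qed (use False in simp)
        then have "kirchhoff_const / 2 * ?\<Phi> z \<le> K" by simp
        then have "?\<Phi> z \<le> 2 * K / kirchhoff_const" using kirchhoff_const_pos by (simp add: field_simps)
        then show ?thesis unfolding M_def by simp
      next
        case False
        then have "\<phi> z = 0" using z(1) by (intro finite_speed) (auto simp: mem_Times_iff)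
        then show ?thesis using M0 by simp
      qed
    qed
    moreover have "?\<Phi> (t, x) \<le> ?\<Phi> z" using t by (intro z(2)) simp
    ultimately show "mink t x * \<bar>\<phi> (t, x)\<bar> \<le> M" by simp
  qed
qed

text \<open>For t >= 3/2 inside the light cone, \<open>improved_bound\<close> with the M of
  \<open>weak_decay\<close> bounds (t^2 - |x|^2) |\<phi>| by a multiple of (t - |x|)^(3-p).
  Elsewhere \<phi> vanishes or is bounded by compactness.\<close>

lemma decay:
  "\<exists>C>0. \<forall>t\<ge>1. \<forall>x. \<bar>\<phi> (t, x)\<bar> \<le> C / ((1 + t + norm x) * (1 + \<bar>t - norm x\<bar>) powr (p - 2))"
proof -
  obtain M where M: "M \<ge> 0" "\<And>t x. t \<ge> 1 \<Longrightarrow> norm x \<le> t \<Longrightarrow> mink t x * \<bar>\<phi> (t, x)\<bar> \<le> M"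
    using weak_decay by blast
  obtain B where B: "B \<ge> 0" "\<And>t x M. t \<ge> 3/2 \<Longrightarrow> norm x < t \<Longrightarrow> M \<ge> 0 \<Longrightarrow>
      (\<And>s y. 3/2 < s \<Longrightarrow> norm y < s \<Longrightarrow> s \<le> t \<Longrightarrow> mink s y * \<bar>\<phi> (s, y)\<bar> \<le> M) \<Longrightarrow>
      kirchhoff_const * (mink t x * \<bar>\<phi> (t, x)\<bar>) \<le> (B + M powr p) * ((t - norm x) / 2) powr (3 - p) * radial 1 2"
    using improved_bound by blast
  define A where "A = (B + M powr p) * radial 1 2 * (1/2) powr (3 - p) / kirchhoff_const"
  have A: "A \<ge> 0" unfolding A_def using B(1) radial_nonneg kirchhoff_const_pos by simp
  have late: "(t - norm x) powr (p - 2) * (t + norm x) * \<bar>\<phi> (t, x)\<bar> \<le> A" if t: "t \<ge> 3/2" and x: "norm x < t" for t x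
  proof -
    have u: "t - norm x > 0" using x by simp
    have "kirchhoff_const * (mink t x * \<bar>\<phi> (t, x)\<bar>) \<le> (B + M powr p) * ((t - norm x) / 2) powr (3 - p) * radial 1 2"
      using M(2) by (intro B(2)[OF t x M(1)]) auto
    also have "\<dots> = kirchhoff_const * (A * (t - norm x) powr (3 - p))"
      unfolding A_def using u kirchhoff_const_pos by (simp add: powr_divide)
    finally have "mink t x * \<bar>\<phi> (t, x)\<bar> \<le> A * (t - norm x) powr (3 - p)"
      using kirchhoff_const_pos by simp
    then have "mink t x * \<bar>\<phi> (t, x)\<bar> * (t - norm x) powr (p - 3) \<le> A * (t - norm x) powr (3 - p) * (t - norm x) powr (p - 3)"
      by (rule mult_right_mono) simp
    also have "\<dots> = A" using u by (simp add: mult.assoc powr_add[symmetric])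
    finally have "mink t x * \<bar>\<phi> (t, x)\<bar> * (t - norm x) powr (p - 3) \<le> A" .
    note le = this
    have e2: "mink t x * (t - norm x) powr (p - 3) = (t - norm x) powr (p - 2) * (t + norm x)"
    proof -
      have "(t - norm x) powr (p - 2) = (t - norm x) powr (1 + (p - 3))" by (simp add: algebra_simps)
      also have "\<dots> = (t - norm x) * (t - norm x) powr (p - 3)" using u by (simp only: powr_add) simp
      finally have e: "(t - norm x) powr (p - 2) = (t - norm x) * (t - norm x) powr (p - 3)" .
      show ?thesis unfolding mink_def e by (simp add: power2_eq_square algebra_simps)
    qed
    have "(t - norm x) powr (p - 2) * (t + norm x) * \<bar>\<phi> (t, x)\<bar> = mink t x * \<bar>\<phi> (t, x)\<bar> * (t - norm x) powr (p - 3)"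
      unfolding e2[symmetric] by (simp only: mult_ac)
    then show ?thesis using le by (simp only:)
  qed
  have "compact ((\<lambda>z. \<bar>\<phi> z\<bar>) ` ({1..3/2} \<times> cball 0 1))"
    by (intro compact_continuous_image continuous_intros continuous_on_subset[OF continuous(1)] compact_Times) auto
  then have "bounded ((\<lambda>z. \<bar>\<phi> z\<bar>) ` ({1..3/2} \<times> cball 0 1))" by (rule compact_imp_bounded)
  then obtain D where D: "\<forall>v\<in>(\<lambda>z. \<bar>\<phi> z\<bar>) ` ({1..3/2} \<times> cball 0 1). norm v \<le> D" unfolding bounded_iff by blast
  have D': "\<bar>\<phi> (t, x)\<bar> \<le> D" if "1 \<le> t" "t \<le> 3/2" "norm x \<le> 1" for t x
    using D that by force
  have D0: "D \<ge> 0" using D'[of 1 0] by simp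
  \<comment> \<open>On the support at late times t - |x| > 1/2 gives 1 + |t - |x|| <= 3 (t - |x|),
    and t + |x| >= 1 gives 1 + t + |x| <= 2 (t + |x|). Up to time 3/2 the two quantities are at most
    3 and 4. The final 1 makes C positive.\<close>
  define C where "C = max (2 * 3 powr (p - 2) * A) (4 * 3 powr (p - 2) * D) + 1"
  have C: "C > 0" unfolding C_def using A by (simp add: add_nonneg_pos le_max_iff_disj)
  have "\<bar>\<phi> (t, x)\<bar> * ((1 + t + norm x) * (1 + \<bar>t - norm x\<bar>) powr (p - 2)) \<le> C" if t: "t \<ge> 1" for t x
  proof (cases "norm x < t - 1/2")
    case False
    then have "\<phi> (t, x) = 0" using t by (intro finite_speed) auto
    then show ?thesis using C by simp
  next
    case True
    have n: "norm x \<ge> 0" by simp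
    show ?thesis
    proof (cases "t \<ge> 3/2")
      case late': True
      have 1: "(1 + \<bar>t - norm x\<bar>) powr (p - 2) \<le> (3 * (t - norm x)) powr (p - 2)"
        using True p by (intro powr_mono2) auto
      have w: "1 \<le> t + norm x" using add_mono[OF t n] by simp
      then have 2: "1 + t + norm x \<le> 2 * (t + norm x)"
        using add_right_mono[of 1 "t + norm x" "t + norm x"] by (simp only: mult_2 add.assoc)
      have "(1 + t + norm x) * (1 + \<bar>t - norm x\<bar>) powr (p - 2) \<le> (2 * (t + norm x)) * (3 * (t - norm x)) powr (p - 2)"
        using w by (intro mult_mono 1 2) simp_all
      also have "\<dots> = 2 * 3 powr (p - 2) * ((t - norm x) powr (p - 2) * (t + norm x))"
      proof -
        have "(3 * (t - norm x)) powr (p - 2) = 3 powr (p - 2) * (t - norm x) powr (p - 2)"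
          by (rule powr_mult)
        then show ?thesis by (simp only: mult_ac)
      qed
      finally have "\<bar>\<phi> (t, x)\<bar> * ((1 + t + norm x) * (1 + \<bar>t - norm x\<bar>) powr (p - 2))
          \<le> \<bar>\<phi> (t, x)\<bar> * (2 * 3 powr (p - 2) * ((t - norm x) powr (p - 2) * (t + norm x)))"
        by (rule mult_left_mono) simp
      also have "\<dots> = 2 * 3 powr (p - 2) * ((t - norm x) powr (p - 2) * (t + norm x) * \<bar>\<phi> (t, x)\<bar>)" by simp
      also have "\<dots> \<le> 2 * 3 powr (p - 2) * A"
        using late[OF late', of x] True by (intro mult_left_mono) auto
      also have "\<dots> \<le> C" unfolding C_def by simp
      finally show ?thesis .
    next
      case False
      have "1 + \<bar>t - m\<bar> \<le> 3 \<and> 1 + t + m \<le> 4 \<and> m \<le> 1" if "m \<ge> 0" "m < t - 1/2" for m :: real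
        using that False t by auto
      from this[OF n True] have b: "1 + \<bar>t - norm x\<bar> \<le> 3" "1 + t + norm x \<le> 4" "norm x \<le> 1" by auto
      then have "(1 + \<bar>t - norm x\<bar>) powr (p - 2) \<le> 3 powr (p - 2)"
        using p by (intro powr_mono2) auto
      moreover note b(2)
      ultimately have "(1 + t + norm x) * (1 + \<bar>t - norm x\<bar>) powr (p - 2) \<le> 4 * 3 powr (p - 2)"
        using t n by (intro mult_mono) auto
      note Q = this
      have "0 \<le> 1 + t + norm x" using add_nonneg_nonneg[of "1 + t" "norm x"] t n by simp
      then have N: "0 \<le> (1 + t + norm x) * (1 + \<bar>t - norm x\<bar>) powr (p - 2)" by simp
      have "t \<le> 3/2" using False by simp
      from mult_mono[OF D'[OF t this b(3)] Q D0 N]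
      have "\<bar>\<phi> (t, x)\<bar> * ((1 + t + norm x) * (1 + \<bar>t - norm x\<bar>) powr (p - 2)) \<le> D * (4 * 3 powr (p - 2))" .
      also have "\<dots> \<le> C" unfolding C_def by (simp add: mult_ac)
      finally show ?thesis .
    qed
  qed
  moreover have "(1 + t + norm x) * (1 + \<bar>t - norm x\<bar>) powr (p - 2) > 0" if "t \<ge> 1" for t and x :: "real^3"
    using that norm_ge_zero[of x] by (intro mult_pos_pos) (auto intro: add_pos_nonneg)
  ultimately show ?thesis
    using C by (intro exI[of _ C] conjI allI impI) (simp_all add: pos_le_divide_eq)
qed

end

theorem corollary2:
  fixes p \<alpha> :: real
    and \<phi>\<^sub>0 \<phi>\<^sub>1 :: "real^3 \<Rightarrow> real"
    and \<phi> :: "real \<times> (real^3) \<Rightarrow> real"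
  assumes p: "3 \<le> p" "p < 5"
    and alpha: "\<alpha> = 1/2"
    and data_reg: "C_k_on 3 UNIV \<phi>\<^sub>0" "C_k_on 2 UNIV \<phi>\<^sub>1"
    and data_supp: "closure {x. \<phi>\<^sub>0 x \<noteq> 0} \<subseteq> ball 0 \<alpha>" "closure {x. \<phi>\<^sub>1 x \<noteq> 0} \<subseteq> ball 0 \<alpha>"
    and sol_reg: "C_k_on 2 future \<phi>"
    and sol: "\<And>z. z \<in> future \<Longrightarrow> wave_op \<phi> z + \<phi> z * \<bar>\<phi> z\<bar> powr (p - 1) = 0"
    and init: "\<And>x. \<phi> (1, x) = \<phi>\<^sub>0 x" "\<And>x. dt \<phi> (1, x) = \<phi>\<^sub>1 x"
  shows "\<exists>C>0. \<forall>t\<ge>1. \<forall>x. \<bar>\<phi> (t, x)\<bar> \<le>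
           C / ((1 + t + norm x) * (1 + \<bar>t - norm x\<bar>) powr (p - 2))"
proof -
  \<comment> \<open>The closed supports lie in the open ball, so the data vanish on the sphere of
    radius 1/2 as well.\<close>
  have "\<phi>\<^sub>0 x = 0" "\<phi>\<^sub>1 x = 0" if "norm x \<ge> 1/2" for x
    using that data_supp closure_subset[of "{x. \<phi>\<^sub>0 x \<noteq> 0}"] closure_subset[of "{x. \<phi>\<^sub>1 x \<noteq> 0}"]
    unfolding alpha by force+
  then interpret wave_solution p \<phi>
    using p sol_reg sol init by unfold_locales auto
  show ?thesis by (rule decay)
qed

end
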